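(* Let $p$ be a prime, let $(X,\le)$ be a finite nonempty totally ordered set, and let $S$ be the free profinite group on the basis $X$. Let $w_0$ be a Lyndon word of length $s$ in the alphabet $X$, and let $C$ be the set of all Lyndon words which are permutations of $w_0$, ordered lexicographically. Then the matrix over $\mathbb{F}_p$ $$\bigl[(\sigma_{w,n},\alpha_{w',n})_n\bigr]_{w,w'\in C}$$ is independent of $n$, as long as $n\ge 2$ and $s\le n$. Here $(\cdot,\cdot)_n\colon S^{(n,p)}\times H^2(S/S^{(n,p)},\mathbb{F}_p)\to\mathbb{F}_p$ is the transgression pairing, and $\sigma_{w,n}\in S^{(n,p)}$, $\alpha_{w',n}\in H^2(S/S^{(n,p)},\mathbb{F}_p)$ are the elements defined in the context.
   Context: Lower $p$-central filtration. For a profinite group $G$: $G^{(1,p)}=G$ and $G^{(n+1,p)}=(G^{(n,p)})^p[G,G^{(n,p)}]$, i.e. the closed subgroup generated by all $\tau^p$ and $[\sigma,\tau]=\sigma^{-1}\tau^{-1}\sigma\tau$ with $\sigma\in G$, $\tau\in G^{(n,p)}$. Words. $X^*$ is the free monoid on $X$ (words under concatenation), and $|w|$ is the length of $w$. A nonempty word is Lyndon if it is strictly smaller, in the lexicographic order induced by $\le$, than all its proper (nonempty) suffixes. If $w$ is Lyndon with $|w|\ge2$, its standard factorization is $w=uv$ where $v$ is the longest proper suffix of $w$ which is Lyndon; then $u$ is also Lyndon. Two words are permutations of one another if each letter occurs in both the same number of times. Elements $\sigma_{w,n}$. For a Lyndon word $w$ define $\tau_w\in S$ recursively: $\tau_{(x)}=x$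 for $x\in X$, and $\tau_w=[\tau_u,\tau_v]=\tau_u^{-1}\tau_v^{-1}\tau_u\tau_v$ if $|w|\ge 2$ has standard factorization $w=uv$. For $|w|=s\le n$ put $\sigma_{w,n}=\tau_w^{p^{n-s}}$; it lies in $S^{(n,p)}$. Magnus coefficients. For a profinite commutative unital ring $R$, $R\langle\langle X\rangle\rangle$ is the algebra of formal power series in the non-commuting variables $X$ over $R$ (words are viewed as monomials), and $\mathrm{Mag}_R\colon S\to R\langle\langle X\rangle\rangle^{\times}$ is the continuous homomorphism with $\mathrm{Mag}_R(x)=1+x$ for $x\in X$. Write $\epsilon_{w,R}(\sigma)$ for the coefficient of the word $w$ in $\mathrm{Mag}_R(\sigma)$. Elements $\alpha_{w,n}$. Let $w=(a_1\cdots a_s)$ be a word with $1\le s\le n$ and let $R=\mathbb{Z}/p^{n-s+1}$. Let $\mathbb{U}_s(R)$ be the group of unipotent upper triangular $(s+1)\times(s+1)$ matrices over $R$. The map $\rho_w\colon S\to\mathbb{U}_s(R)$, $\sigma\mapsto[\epsilon_{(a_i\cdots a_{j-1}),R}(\sigma)]_{1\le i\le j\le s+1}$, is a continuous homomorphism. The subgroup $\mathbb{U}_s(R)^{(n,p)}$ is central and consists of all matrices $I+ap^{n-s}E_{1,s+1}$, $a\in\mathbb{Z}$; identify it with $\mathbb{F}_p$ via $I+ap^{n-s}E_{1,s+1}\leftrightarrow a \bmod p$. Put $\overline{\mathbb{U}}_s(R)=\mathbb{U}_s(R)/\mathbb{U}_s(R)^{(n,p)}$ and let $\omega_{s,n}\in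 H^2(\overline{\mathbb{U}}_s(R),\mathbb{F}_p)$ be the class of the central extension $0\to\mathbb{F}_p\to\mathbb{U}_s(R)\to\overline{\mathbb{U}}_s(R)\to1$ (represented, for a set-theoretic section $\theta$, by the cocycle $(g,h)\mapsto \theta(g)\theta(h)\theta(gh)^{-1}$). The map $\rho_w$ induces $\bar\rho_w\colon S/S^{(n,p)}\to\overline{\mathbb{U}}_s(R)$, and $\alpha_{w,n}=\bar\rho_w^{\,*}\omega_{s,n}\in H^2(S/S^{(n,p)},\mathbb{F}_p)$. Transgression pairing. For $n\ge2$ the transgression map $\mathrm{trg}\colon H^1(S^{(n,p)},\mathbb{F}_p)^S\to H^2(S/S^{(n,p)},\mathbb{F}_p)$ in the five-term exact sequence of $S^{(n,p)}\trianglelefteq S$ (trivial coefficients) is an isomorphism. Convention: $\mathrm{trg}(\psi)$ is the class of the cocycle on $S/S^{(n,p)}$ induced by the coboundary $(g,h)\mapsto y(h)-y(gh)+y(g)$, for a suitable continuous map $y\colon S\to\mathbb{F}_p$ extending $\psi$ for which this coboundary depends only on cosets modulo $S^{(n,p)}$. Define $(\sigma,\alpha)_n=-(\mathrm{trg}^{-1}(\alpha))(\sigma)$ for $\sigma\in S^{(n,p)}$ and $\alpha\in H^2(S/S^{(n,p)},\mathbb{F}_p)$. *)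

theory Defs
  imports "HOL-Analysis.Analysis" "HOL-Number_Theory.Residues" "HOL-Library.Multiset"
begin

section \<open>Profinite groups\<close>

definition profinite_group :: "('a, 'b) monoid_scheme \<Rightarrow> 'a topology \<Rightarrow> bool" where
  "profinite_group G T \<longleftrightarrow>
     group G \<and> topspace T = carrier G \<and>
     continuous_map (prod_topology T T) T (\<lambda>(x, y). x \<otimes>\<^bsub>G\<^esub> y) \<and>
     continuous_map T T (\<lambda>x. inv\<^bsub>G\<^esub> x) \<and>
     compact_space T \<and> Hausdorff_space T \<and>
     (\<forall>A. connectedin T A \<longrightarrow> (\<exists>a. A \<subseteq> {a}))"

text \<open>
  The universal property of the free profinite group on the finite basis \<open>\<iota> x\<close>, where \<open>x\<close> ranges
  over the type \<open>'x\<close>.  Letting the test groups \<open>H\<close> have carriers of type \<^typ>\<open>nat set\<close> loses nothing: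
  \<open>H\<close> may be replaced by its closed subgroup generated by the finite set \<open>range f\<close>, and a
  topologically finitely generated profinite group has at most continuum many elements.
\<close>

definition free_profinite_group ::
    "('g, 'b) monoid_scheme \<Rightarrow> 'g topology \<Rightarrow> ('x::finite \<Rightarrow> 'g) \<Rightarrow> bool" where
  "free_profinite_group S T \<iota> \<longleftrightarrow>
     profinite_group S T \<and> range \<iota> \<subseteq> carrier S \<and>
     (\<forall>(H :: nat set monoid) TH f.
        profinite_group H TH \<and> range f \<subseteq> carrier H \<longrightarrow>
        (\<exists>!\<phi>. \<phi> \<in> hom S H \<and> \<phi> \<in> extensional (carrier S) \<and>
              continuous_map T TH \<phi> \<and> (\<forall>x. \<phi> (\<iota> x) = f x)))"

definition closed_subgroup_generated ::
    "('a, 'b) monoid_scheme \<Rightarrow> 'a topology \<Rightarrow> 'a set \<Rightarrow> 'a set" where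
  "closed_subgroup_generated G T A = \<Inter>{H. subgroup H G \<and> closedin T H \<and> A \<subseteq> H}"

definition commutator :: "('a, 'b) monoid_scheme \<Rightarrow> 'a \<Rightarrow> 'a \<Rightarrow> 'a" where
  "commutator G \<sigma> \<tau> = inv\<^bsub>G\<^esub> \<sigma> \<otimes>\<^bsub>G\<^esub> inv\<^bsub>G\<^esub> \<tau> \<otimes>\<^bsub>G\<^esub> \<sigma> \<otimes>\<^bsub>G\<^esub> \<tau>"

text \<open>The filtration starts at index 1; the value at index 0 is a dummy.\<close>

primrec lower_p_central ::
    "('a, 'b) monoid_scheme \<Rightarrow> 'a topology \<Rightarrow> nat \<Rightarrow> nat \<Rightarrow> 'a set" where
  "lower_p_central G T p 0 = carrier G"
| "lower_p_central G T p (Suc n) =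
     (if n = 0 then carrier G
      else closed_subgroup_generated G T
        ({\<tau> [^]\<^bsub>G\<^esub> p | \<tau>. \<tau> \<in> lower_p_central G T p n} \<union>
         {commutator G \<sigma> \<tau> | \<sigma> \<tau>. \<sigma> \<in> carrier G \<and> \<tau> \<in> lower_p_central G T p n}))"

definition quotient_topology :: "'a topology \<Rightarrow> ('a \<Rightarrow> 'b) \<Rightarrow> 'b topology" where
  "quotient_topology T f =
     topology (\<lambda>U. U \<subseteq> f ` topspace T \<and> openin T {x \<in> topspace T. f x \<in> U})"

lemma openin_quotient_topology:
  "openin (quotient_topology T f) U \<longleftrightarrow>
     U \<subseteq> f ` topspace T \<and> openin T {x \<in> topspace T. f x \<in> U}"
proof -
  have "istopology (\<lambda>U. U \<subseteq> f ` topspace T \<and> openin T {x \<in> topspace T. f x \<in> U})"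
    unfolding istopology_def
  proof (intro conjI allI impI)
    fix A B
    assume A: "A \<subseteq> f ` topspace T \<and> openin T {x \<in> topspace T. f x \<in> A}"
      and B: "B \<subseteq> f ` topspace T \<and> openin T {x \<in> topspace T. f x \<in> B}"
    have eq: "{x \<in> topspace T. f x \<in> A \<inter> B} =
        {x \<in> topspace T. f x \<in> A} \<inter> {x \<in> topspace T. f x \<in> B}" by auto
    show "openin T {x \<in> topspace T. f x \<in> A \<inter> B}"
      unfolding eq using A B by (intro openin_Int) auto
    show "A \<inter> B \<subseteq> f ` topspace T" using A by auto
  next
    fix K
    assume K: "\<forall>A\<in>K. A \<subseteq> f ` topspace T \<and> openin T {x \<in> topspace T. f x \<in> A}"
    have eq: "{x \<in> topspace T. f x \<in> \<Union>K} = (\<Union>A\<in>K. {x \<in> topspace T. f x \<in> A})" by auto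
    show "openin T {x \<in> topspace T. f x \<in> \<Union>K}"
      unfolding eq using K by (intro openin_Union) auto
    show "\<Union>K \<subseteq> f ` topspace T" using K by auto
  qed
  then show ?thesis by (simp add: quotient_topology_def)
qed

lemma quotient_map_quotient_topology: "quotient_map T (quotient_topology T f) f"
proof -
  have "{x \<in> topspace T. f x \<in> f ` topspace T} = topspace T" by auto
  then have "openin (quotient_topology T f) (f ` topspace T)"
    by (simp add: openin_quotient_topology)
  then have "topspace (quotient_topology T f) = f ` topspace T"
    by (meson openin_quotient_topology openin_subset openin_topspace subset_antisym)
  then show ?thesis
    by (auto simp: quotient_map_def openin_quotient_topology)
qed


section \<open>Continuous cohomology with trivial coefficients\<close>

text \<open>
  The coefficients are the additive group of a ring \<open>A\<close>, with the discrete topology and the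
  trivial action.
\<close>

definition cochains1 ::
    "('a, 'b) monoid_scheme \<Rightarrow> 'a topology \<Rightarrow> ('k, 'm) ring_scheme \<Rightarrow> ('a \<Rightarrow> 'k) set" where
  "cochains1 G T A =
     {y \<in> carrier G \<rightarrow>\<^sub>E carrier A. continuous_map T (discrete_topology (carrier A)) y}"

definition cochains2 ::
    "('a, 'b) monoid_scheme \<Rightarrow> 'a topology \<Rightarrow> ('k, 'm) ring_scheme \<Rightarrow> ('a \<times> 'a \<Rightarrow> 'k) monoid" where
  "cochains2 G T A =
     \<lparr>carrier = {c \<in> carrier G \<times> carrier G \<rightarrow>\<^sub>E carrier A.
                   continuous_map (prod_topology T T) (discrete_topology (carrier A)) c},
      mult = (\<lambda>c d. \<lambda>x\<in>carrier G \<times> carrier G. c x \<oplus>\<^bsub>A\<^esub> d x),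
      one = (\<lambda>x\<in>carrier G \<times> carrier G. \<zero>\<^bsub>A\<^esub>)\<rparr>"

definition coboundary1 ::
    "('a, 'b) monoid_scheme \<Rightarrow> ('k, 'm) ring_scheme \<Rightarrow> ('a \<Rightarrow> 'k) \<Rightarrow> 'a \<times> 'a \<Rightarrow> 'k" where
  "coboundary1 G A y =
     (\<lambda>(g, h)\<in>carrier G \<times> carrier G. y h \<ominus>\<^bsub>A\<^esub> y (g \<otimes>\<^bsub>G\<^esub> h) \<oplus>\<^bsub>A\<^esub> y g)"

definition cocycles2 ::
    "('a, 'b) monoid_scheme \<Rightarrow> 'a topology \<Rightarrow> ('k, 'm) ring_scheme \<Rightarrow> ('a \<times> 'a \<Rightarrow> 'k) set" where
  "cocycles2 G T A =
     {c \<in> carrier (cochains2 G T A). \<forall>g\<in>carrier G. \<forall>h\<in>carrier G. \<forall>k\<in>carrier G.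
        c (h, k) \<ominus>\<^bsub>A\<^esub> c (g \<otimes>\<^bsub>G\<^esub> h, k) \<oplus>\<^bsub>A\<^esub> c (g, h \<otimes>\<^bsub>G\<^esub> k) \<ominus>\<^bsub>A\<^esub> c (g, h) = \<zero>\<^bsub>A\<^esub>}"

definition coboundaries2 ::
    "('a, 'b) monoid_scheme \<Rightarrow> 'a topology \<Rightarrow> ('k, 'm) ring_scheme \<Rightarrow> ('a \<times> 'a \<Rightarrow> 'k) set" where
  "coboundaries2 G T A = coboundary1 G A ` cochains1 G T A"

definition H2 ::
    "('a, 'b) monoid_scheme \<Rightarrow> 'a topology \<Rightarrow> ('k, 'm) ring_scheme \<Rightarrow>
     ('a \<times> 'a \<Rightarrow> 'k) set monoid" where
  "H2 G T A = (cochains2 G T A)\<lparr>carrier := cocycles2 G T A\<rparr> Mod coboundaries2 G T A"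

definition H2_class ::
    "('a, 'b) monoid_scheme \<Rightarrow> 'a topology \<Rightarrow> ('k, 'm) ring_scheme \<Rightarrow>
     ('a \<times> 'a \<Rightarrow> 'k) \<Rightarrow> ('a \<times> 'a \<Rightarrow> 'k) set" where
  "H2_class G T A c = coboundaries2 G T A #>\<^bsub>cochains2 G T A\<^esub> c"

lemma H2_class_in_H2:
  "c \<in> cocycles2 G T A \<Longrightarrow> H2_class G T A c \<in> carrier (H2 G T A)"
  by (auto simp: H2_def H2_class_def FactGroup_def RCOSETS_def r_coset_def)

text \<open>The pullback along a homomorphism \<open>f\<close> from \<open>G\<close>, on classes of 2-cocycles.\<close>

definition H2_pullback ::
    "('a, 'b) monoid_scheme \<Rightarrow> 'a topology \<Rightarrow> ('k, 'm) ring_scheme \<Rightarrow> ('a \<Rightarrow> 'c) \<Rightarrow>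
     ('c \<times> 'c \<Rightarrow> 'k) set \<Rightarrow> ('a \<times> 'a \<Rightarrow> 'k) set" where
  "H2_pullback G T A f \<alpha> =
     the_elem ((\<lambda>c. H2_class G T A (\<lambda>(g, h)\<in>carrier G \<times> carrier G. c (f g, f h))) ` \<alpha>)"

text \<open>
  The group $H^1(N, A)^G$: since the action on \<open>A\<close> is trivial, $H^1$ consists of the continuous
  homomorphisms.
\<close>

definition H1_invariants ::
    "('a, 'b) monoid_scheme \<Rightarrow> 'a topology \<Rightarrow> 'a set \<Rightarrow> ('k, 'm) ring_scheme \<Rightarrow> ('a \<Rightarrow> 'k) set" where
  "H1_invariants G T N A =
     {\<psi> \<in> hom (G\<lparr>carrier := N\<rparr>) (add_monoid A) \<inter> extensional N.
        continuous_map (subtopology T N) (discrete_topology (carrier A)) \<psi> \<and>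
        (\<forall>\<sigma>\<in>carrier G. \<forall>\<tau>\<in>N. \<psi> (inv\<^bsub>G\<^esub> \<sigma> \<otimes>\<^bsub>G\<^esub> \<tau> \<otimes>\<^bsub>G\<^esub> \<sigma>) = \<psi> \<tau>)}"

abbreviation coset_topology ::
    "('a, 'b) monoid_scheme \<Rightarrow> 'a topology \<Rightarrow> 'a set \<Rightarrow> 'a set topology" where
  "coset_topology G T N \<equiv> quotient_topology T (\<lambda>g. N #>\<^bsub>G\<^esub> g)"

definition transgression ::
    "('a, 'b) monoid_scheme \<Rightarrow> 'a topology \<Rightarrow> 'a set \<Rightarrow> ('k, 'm) ring_scheme \<Rightarrow>
     ('a \<Rightarrow> 'k) \<Rightarrow> ('a set \<times> 'a set \<Rightarrow> 'k) set" where
  "transgression G T N A \<psi> =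
     the_elem {H2_class (G Mod N) (coset_topology G T N) A c | c y.
       c \<in> cocycles2 (G Mod N) (coset_topology G T N) A \<and>
       y \<in> cochains1 G T A \<and> (\<forall>\<tau>\<in>N. y \<tau> = \<psi> \<tau>) \<and>
       (\<forall>g\<in>carrier G. \<forall>h\<in>carrier G.
          c (N #>\<^bsub>G\<^esub> g, N #>\<^bsub>G\<^esub> h) = coboundary1 G A y (g, h))}"

definition transgression_pairing ::
    "('a, 'b) monoid_scheme \<Rightarrow> 'a topology \<Rightarrow> 'a set \<Rightarrow> ('k, 'm) ring_scheme \<Rightarrow>
     'a \<Rightarrow> ('a set \<times> 'a set \<Rightarrow> 'k) set \<Rightarrow> 'k" where
  "transgression_pairing G T N A \<sigma> \<alpha> =
     \<ominus>\<^bsub>A\<^esub> (the_inv_into (H1_invariants G T N A) (transgression G T N A) \<alpha>) \<sigma>"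


section \<open>Lyndon words\<close>

definition lyndon :: "'x::linorder list \<Rightarrow> bool" where
  "lyndon w \<longleftrightarrow> w \<noteq> [] \<and>
     (\<forall>u v. w = u @ v \<longrightarrow> u \<noteq> [] \<longrightarrow> v \<noteq> [] \<longrightarrow> (w, v) \<in> lexord {(a, b). a < b})"

text \<open>
  The standard factorization of \<open>w\<close> is \<open>take i w @ drop i w\<close> with \<open>i = std_split w\<close>: the least
  \<open>i\<close> gives the longest suffix.
\<close>

definition std_split :: "'x::linorder list \<Rightarrow> nat" where
  "std_split w = (LEAST i. 0 < i \<and> lyndon (drop i w))"

lemma lyndon_singleton: "lyndon [x]"
  by (auto simp: lyndon_def Cons_eq_append_conv)

lemma std_split_bounds:
  assumes "2 \<le> length w"
  shows "0 < std_split w" "std_split w < length w" "lyndon (drop (std_split w) w)"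
proof -
  have "drop (length w - 1) w = [last w]"
    using assms
    by (metis append_butlast_last_id append_eq_conv_conj length_butlast list.size(3)
        not_numeral_le_zero)
  then have "0 < length w - 1 \<and> lyndon (drop (length w - 1) w)"
    using assms by (simp add: lyndon_singleton)
  then have *: "0 < std_split w \<and> lyndon (drop (std_split w) w)"
    unfolding std_split_def by (rule LeastI)
  then show "0 < std_split w" "lyndon (drop (std_split w) w)" by auto
  then show "std_split w < length w" by (auto simp: lyndon_def)
qed

function lyndon_tau ::
    "('g, 'b) monoid_scheme \<Rightarrow> ('x::linorder \<Rightarrow> 'g) \<Rightarrow> 'x list \<Rightarrow> 'g" where
  "lyndon_tau S \<iota> w =
     (if w = [] then \<one>\<^bsub>S\<^esub>
      else if length w = 1 then \<iota> (hd w)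
      else commutator S (lyndon_tau S \<iota> (take (std_split w) w))
                        (lyndon_tau S \<iota> (drop (std_split w) w)))"
  by auto
termination
proof (relation "Wellfounded.measure (\<lambda>(S, \<iota>, w). length w)", goal_cases)
  case 1
  then show ?case by simp
next
  case (2 S \<iota> w)
  then have "2 \<le> length w" by (cases w) (auto simp: Suc_le_eq)
  from std_split_bounds[OF this] show ?case by simp
next
  case (3 S \<iota> w)
  then have "2 \<le> length w" by (cases w) (auto simp: Suc_le_eq)
  from std_split_bounds[OF this] show ?case by simp
qed

declare lyndon_tau.simps [simp del]

definition lyndon_sigma ::
    "('g, 'b) monoid_scheme \<Rightarrow> ('x::linorder \<Rightarrow> 'g) \<Rightarrow> nat \<Rightarrow> nat \<Rightarrow> 'x list \<Rightarrow> 'g" where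
  "lyndon_sigma S \<iota> p n w = lyndon_tau S \<iota> w [^]\<^bsub>S\<^esub> (p ^ (n - length w))"


section \<open>The Magnus homomorphism\<close>

text \<open>
  Formal power series in the non-commuting variables \<open>x :: 'x\<close> over \<open>R\<close>, given by their
  coefficients.  The ring \<open>R\<close> is only ever finite here, hence discrete.
\<close>

definition nc_series :: "('r, 'm) ring_scheme \<Rightarrow> ('x list \<Rightarrow> 'r) ring" where
  "nc_series R =
     \<lparr>carrier = UNIV \<rightarrow>\<^sub>E carrier R,
      mult = (\<lambda>f g w. \<Oplus>\<^bsub>R\<^esub>i\<in>{..length w}. f (take i w) \<otimes>\<^bsub>R\<^esub> g (drop i w)),
      one = (\<lambda>w. if w = [] then \<one>\<^bsub>R\<^esub> else \<zero>\<^bsub>R\<^esub>),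
      zero = (\<lambda>w. \<zero>\<^bsub>R\<^esub>),
      add = (\<lambda>f g w. f w \<oplus>\<^bsub>R\<^esub> g w)\<rparr>"

definition nc_var :: "('r, 'm) ring_scheme \<Rightarrow> 'x \<Rightarrow> 'x list \<Rightarrow> 'r" where
  "nc_var R x = (\<lambda>w. if w = [x] then \<one>\<^bsub>R\<^esub> else \<zero>\<^bsub>R\<^esub>)"

definition nc_series_topology :: "('r, 'm) ring_scheme \<Rightarrow> ('x list \<Rightarrow> 'r) topology" where
  "nc_series_topology R = product_topology (\<lambda>_. discrete_topology (carrier R)) UNIV"

definition magnus ::
    "('g, 'b) monoid_scheme \<Rightarrow> 'g topology \<Rightarrow> ('x \<Rightarrow> 'g) \<Rightarrow> ('r, 'm) ring_scheme \<Rightarrow>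
     'g \<Rightarrow> 'x list \<Rightarrow> 'r" where
  "magnus S T \<iota> R =
     (THE \<phi>. \<phi> \<in> hom S (units_of (nc_series R)) \<and> \<phi> \<in> extensional (carrier S) \<and>
        continuous_map T (subtopology (nc_series_topology R) (Units (nc_series R))) \<phi> \<and>
        (\<forall>x. \<phi> (\<iota> x) = \<one>\<^bsub>nc_series R\<^esub> \<oplus>\<^bsub>nc_series R\<^esub> nc_var R x))"

definition magnus_coeff ::
    "('g, 'b) monoid_scheme \<Rightarrow> 'g topology \<Rightarrow> ('x \<Rightarrow> 'g) \<Rightarrow> ('r, 'm) ring_scheme \<Rightarrow>
     'x list \<Rightarrow> 'g \<Rightarrow> 'r" where
  "magnus_coeff S T \<iota> R w \<sigma> = magnus S T \<iota> R \<sigma> w"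


section \<open>Unitriangular matrices and the classes \<open>\<alpha>\<^bsub>w,n\<^esub>\<close>\<close>

text \<open>Rows and columns of the $(s+1) \times (s+1)$ matrices are indexed by $0, \dots, s$.\<close>

definition unitriangular :: "('r, 'm) ring_scheme \<Rightarrow> nat \<Rightarrow> (nat \<times> nat \<Rightarrow> 'r) monoid" where
  "unitriangular R s =
     \<lparr>carrier = {M \<in> {..s} \<times> {..s} \<rightarrow>\<^sub>E carrier R.
                   (\<forall>i\<le>s. M (i, i) = \<one>\<^bsub>R\<^esub>) \<and> (\<forall>i\<le>s. \<forall>j<i. M (i, j) = \<zero>\<^bsub>R\<^esub>)},
      mult = (\<lambda>M N. \<lambda>(i, k)\<in>{..s} \<times> {..s}. \<Oplus>\<^bsub>R\<^esub>j\<in>{..s}. M (i, j) \<otimes>\<^bsub>R\<^esub> N (j, k)),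
      one = (\<lambda>(i, j)\<in>{..s} \<times> {..s}. if i = j then \<one>\<^bsub>R\<^esub> else \<zero>\<^bsub>R\<^esub>)\<rparr>"

abbreviation Fp :: "nat \<Rightarrow> int ring" where
  "Fp p \<equiv> residue_ring (int p)"

abbreviation coeff_ring :: "nat \<Rightarrow> nat \<Rightarrow> nat \<Rightarrow> int ring" where
  "coeff_ring p n s \<equiv> residue_ring (int p ^ (n - s + 1))"

abbreviation UU :: "nat \<Rightarrow> nat \<Rightarrow> nat \<Rightarrow> (nat \<times> nat \<Rightarrow> int) monoid" where
  "UU p n s \<equiv> unitriangular (coeff_ring p n s) s"

abbreviation UU_central :: "nat \<Rightarrow> nat \<Rightarrow> nat \<Rightarrow> (nat \<times> nat \<Rightarrow> int) set" where
  "UU_central p n s \<equiv>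
     lower_p_central (UU p n s) (discrete_topology (carrier (UU p n s))) p n"

abbreviation UU_bar :: "nat \<Rightarrow> nat \<Rightarrow> nat \<Rightarrow> (nat \<times> nat \<Rightarrow> int) set monoid" where
  "UU_bar p n s \<equiv> UU p n s Mod UU_central p n s"

text \<open>The identification of $I + a p^{n-s} E_{1,s+1}$ with $a$ modulo $p$.\<close>

definition UU_central_to_Fp :: "nat \<Rightarrow> nat \<Rightarrow> nat \<Rightarrow> (nat \<times> nat \<Rightarrow> int) \<Rightarrow> int" where
  "UU_central_to_Fp p n s M =
     (THE a. a \<in> carrier (Fp p) \<and>
        M = \<one>\<^bsub>UU p n s\<^esub>((0, s) := (a * int p ^ (n - s)) mod int p ^ (n - s + 1)))"

definition extension_class ::
    "nat \<Rightarrow> nat \<Rightarrow> nat \<Rightarrow>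
     ((nat \<times> nat \<Rightarrow> int) set \<times> (nat \<times> nat \<Rightarrow> int) set \<Rightarrow> int) set" where
  "extension_class p n s =
     the_elem {H2_class (UU_bar p n s) (discrete_topology (carrier (UU_bar p n s))) (Fp p)
         (\<lambda>(g, h)\<in>carrier (UU_bar p n s) \<times> carrier (UU_bar p n s).
            UU_central_to_Fp p n s
              (\<theta> g \<otimes>\<^bsub>UU p n s\<^esub> \<theta> h \<otimes>\<^bsub>UU p n s\<^esub> inv\<^bsub>UU p n s\<^esub> (\<theta> (g \<otimes>\<^bsub>UU_bar p n s\<^esub> h)))) | \<theta>.
       \<forall>g\<in>carrier (UU_bar p n s). \<theta> g \<in> g}"

definition magnus_rep ::
    "('g, 'b) monoid_scheme \<Rightarrow> 'g topology \<Rightarrow> ('x \<Rightarrow> 'g) \<Rightarrow> ('r, 'm) ring_scheme \<Rightarrow> 'x list \<Rightarrow>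
     'g \<Rightarrow> nat \<times> nat \<Rightarrow> 'r" where
  "magnus_rep S T \<iota> R w \<sigma> =
     (\<lambda>(i, j)\<in>{..length w} \<times> {..length w}.
        if i \<le> j then magnus_coeff S T \<iota> R (take (j - i) (drop i w)) \<sigma> else \<zero>\<^bsub>R\<^esub>)"

definition magnus_rep_bar ::
    "('g, 'b) monoid_scheme \<Rightarrow> 'g topology \<Rightarrow> ('x \<Rightarrow> 'g) \<Rightarrow> nat \<Rightarrow> nat \<Rightarrow> 'x list \<Rightarrow>
     'g set \<Rightarrow> (nat \<times> nat \<Rightarrow> int) set" where
  "magnus_rep_bar S T \<iota> p n w K =
     (let s = length w in
      the_elem ((\<lambda>\<sigma>. UU_central p n s #>\<^bsub>UU p n s\<^esub> magnus_rep S T \<iota> (coeff_ring p n s) w \<sigma>) ` K))"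

definition lyndon_alpha ::
    "('g, 'b) monoid_scheme \<Rightarrow> 'g topology \<Rightarrow> ('x \<Rightarrow> 'g) \<Rightarrow> nat \<Rightarrow> nat \<Rightarrow> 'x list \<Rightarrow>
     ('g set \<times> 'g set \<Rightarrow> int) set" where
  "lyndon_alpha S T \<iota> p n w =
     (let N = lower_p_central S T p n in
      H2_pullback (S Mod N) (coset_topology S T N) (Fp p)
        (magnus_rep_bar S T \<iota> p n w) (extension_class p n (length w)))"


section \<open>The transgression matrix\<close>

definition pairing ::
    "('g, 'b) monoid_scheme \<Rightarrow> 'g topology \<Rightarrow> nat \<Rightarrow> nat \<Rightarrow>
     'g \<Rightarrow> ('g set \<times> 'g set \<Rightarrow> int) set \<Rightarrow> int" where
  "pairing S T p n = transgression_pairing S T (lower_p_central S T p n) (Fp p)"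

definition lyndon_perms :: "'x::linorder list \<Rightarrow> 'x list set" where
  "lyndon_perms w0 = {w. lyndon w \<and> mset w = mset w0}"

definition lyndon_matrix ::
    "('g, 'b) monoid_scheme \<Rightarrow> 'g topology \<Rightarrow> ('x::linorder \<Rightarrow> 'g) \<Rightarrow> nat \<Rightarrow> nat \<Rightarrow> 'x list \<Rightarrow>
     'x list \<times> 'x list \<Rightarrow> int" where
  "lyndon_matrix S T \<iota> p n w0 =
     (\<lambda>(w, w')\<in>lyndon_perms w0 \<times> lyndon_perms w0.
        pairing S T p n (lyndon_sigma S \<iota> p n w) (lyndon_alpha S T \<iota> p n w'))"

end

theory Submission
  imports Defs
begin

text \<open>
  The class \<open>\<alpha>\<^sub>w\<close> of a word \<open>w\<close> of length \<open>s\<close> is the transgression of the homomorphism sending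
  \<open>\<sigma>\<close> to \<open>-a\<close>, where \<open>\<rho>\<^sub>w(\<sigma>) = I + a p\<^bsup>n-s\<^esup> E\<^bsub>1,s+1\<^esub>\<close>; hence the pairing of \<open>\<sigma>\<close> with
  \<open>\<alpha>\<^sub>w\<close> is the coefficient of \<open>w\<close> in \<open>Mag(\<sigma>)\<close> divided by \<open>p\<^bsup>n-s\<^esup>\<close>.  For a Lyndon word \<open>v\<close> of
  length \<open>s\<close> the series \<open>Mag(\<tau>\<^sub>v) - 1\<close> begins in degree \<open>s\<close> with an integral Lie polynomial \<open>L\<close>,
  and raising \<open>\<tau>\<^sub>v\<close> to the power \<open>p\<^bsup>n-s\<^esup>\<close> multiplies this leading form by \<open>p\<^bsup>n-s\<^esup>\<close>.  So the
  matrix entry at \<open>(v, w)\<close> is the coefficient of \<open>w\<close> in \<open>L\<close> modulo \<open>p\<close>, whatever \<open>n\<close> is.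
\<close>

section \<open>Residue rings and locally constant functions\<close>

text \<open>The pairing inverts transgression by a definite description, so exhibiting one preimage
  of \<open>\<alpha>\<^sub>w\<close> is not enough: every invariant character of S^(n,p) has to be
  compared with it. Each such character must first get a cochain lifting it, since otherwise its
  transgression has no specified value; then transgression must be injective. Two characters with
  equal transgression differ by the restriction of a continuous homomorphism S -> F_p, and this
  vanishes because n >= 2 puts S^(n,p) inside the closed subgroup generated by p-th powers and
  commutators. Comparing different n means comparing different rings Z/p^(n-s+1). The leading
  polynomial is therefore fixed with integer coefficients before a modulus is chosen, so that one
  polynomial serves all of them. The exponent n-s+1 is the one for which the n-th filtration step of
  the matrix group is confined to multiples of p^(n-s) in the corner entry, while the next step is
  trivial.\<close>

lemma residue_ring_simps:
  "carrier (residue_ring m) = {0..m - 1}"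
  "x \<oplus>\<^bsub>residue_ring m\<^esub> y = (x + y) mod m"
  "x \<otimes>\<^bsub>residue_ring m\<^esub> y = (x * y) mod m"
  "\<zero>\<^bsub>residue_ring m\<^esub> = 0"
  "\<one>\<^bsub>residue_ring m\<^esub> = 1"
  by (simp_all add: residue_ring_def)

lemma residue_ring_uminus:
  assumes "1 < m"
  shows "\<ominus>\<^bsub>residue_ring m\<^esub> x = (- x) mod m"
  using residues.res_neg_eq[of m x] assms by (simp add: residues_def)

lemma residue_ring_minus:
  assumes "1 < m"
  shows "x \<ominus>\<^bsub>residue_ring m\<^esub> y = (x - y) mod m"
  using assms by (simp add: a_minus_def residue_ring_uminus residue_ring_simps mod_simps)

lemma residue_ring_finsum:
  assumes "1 < m" "finite A" "\<And>i. i \<in> A \<Longrightarrow> f i mod m = f i"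
  shows "(\<Oplus>\<^bsub>residue_ring m\<^esub>i\<in>A. f i) = (\<Sum>i\<in>A. f i) mod m"
proof -
  interpret residues m "residue_ring m"
    using assms by (simp add: residues_def)
  have "(\<Oplus>\<^bsub>residue_ring m\<^esub>i\<in>A. f i) = (\<Oplus>\<^bsub>residue_ring m\<^esub>i\<in>A. f i mod m)"
  proof (rule finsum_cong')
    show "f i = f i mod m" if "i \<in> A" for i
      using assms(3)[OF that] by simp
  qed (auto)
  then show ?thesis using sum_cong[OF assms(2)] by simp
qed

lemma mod_residue: "(x::int) \<in> {0..m - 1} \<Longrightarrow> x mod m = x"
  by simp

lemma mod_in_residues: "1 < m \<Longrightarrow> (x::int) mod m \<in> {0..m - 1}"
  by (simp add: int_one_le_iff_zero_less zle_diff1_eq)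

section \<open>Continuity into discrete spaces as local constancy\<close>

lemma continuous_map_discrete_value:
  "continuous_map T (discrete_topology A) f \<Longrightarrow> x \<in> topspace T \<Longrightarrow> f x \<in> A"
  by (auto simp: continuous_map_def)

lemma continuous_map_discreteI:
  assumes "\<And>x. x \<in> topspace T \<Longrightarrow> f x \<in> A"
    and loc: "\<And>x. x \<in> topspace T \<Longrightarrow> \<exists>U. openin T U \<and> x \<in> U \<and> U \<subseteq> {y. f y = f x}"
  shows "continuous_map T (discrete_topology A) f"
  unfolding continuous_map_def
proof (intro conjI allI impI)
  show "f \<in> topspace T \<rightarrow> topspace (discrete_topology A)" using assms by auto
  fix W
  show "openin T {x \<in> topspace T. f x \<in> W}"
  proof (subst openin_subopen, intro ballI)
    fix x assume x: "x \<in> {x \<in> topspace T. f x \<in> W}"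
    then obtain V where V: "openin T V" "x \<in> V" "V \<subseteq> {y. f y = f x}" using loc by blast
    have "V \<subseteq> {x \<in> topspace T. f x \<in> W}"
    proof
      fix y assume y: "y \<in> V"
      with V(3) have "f y = f x" by blast
      with x have "f y \<in> W" by simp
      with openin_subset[OF V(1)] y show "y \<in> {x \<in> topspace T. f x \<in> W}" by blast
    qed
    with V show "\<exists>V. openin T V \<and> x \<in> V \<and> V \<subseteq> {x \<in> topspace T. f x \<in> W}"
      by blast
  qed
qed

lemma continuous_map_discreteE:
  assumes f: "continuous_map T (discrete_topology A) f" and x: "x \<in> topspace T"
  obtains U where "openin T U" "x \<in> U" "U \<subseteq> {y. f y = f x}"
proof -
  have "f x \<in> A" using continuous_map_discrete_value[OF f x] .
  then have "openin T {y \<in> topspace T. f y \<in> {f x}}"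
    by (intro openin_continuous_map_preimage[OF f]) auto
  moreover have "x \<in> {y \<in> topspace T. f y \<in> {f x}}" using x by blast
  moreover have "{y \<in> topspace T. f y \<in> {f x}} \<subseteq> {y. f y = f x}" by blast
  ultimately show thesis by (rule that)
qed

lemma continuous_map_discrete_binop:
  assumes f: "continuous_map T (discrete_topology A) f"
    and g: "continuous_map T (discrete_topology B) g"
    and F: "\<And>a b. a \<in> A \<Longrightarrow> b \<in> B \<Longrightarrow> F a b \<in> C"
  shows "continuous_map T (discrete_topology C) (\<lambda>x. F (f x) (g x))"
proof (rule continuous_map_discreteI)
  fix x assume x: "x \<in> topspace T"
  show "F (f x) (g x) \<in> C"
    using x by (intro F continuous_map_discrete_value[OF f] continuous_map_discrete_value[OF g])
  obtain U where U: "openin T U" "x \<in> U" "U \<subseteq> {y. f y = f x}"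
    using continuous_map_discreteE[OF f x] .
  obtain V where V: "openin T V" "x \<in> V" "V \<subseteq> {y. g y = g x}"
    using continuous_map_discreteE[OF g x] .
  have "U \<inter> V \<subseteq> {y. F (f y) (g y) = F (f x) (g x)}"
  proof
    fix y assume "y \<in> U \<inter> V"
    with U(3) V(3) have "f y = f x" "g y = g x" by blast+
    then show "y \<in> {y. F (f y) (g y) = F (f x) (g x)}" by simp
  qed
  with U V show "\<exists>U. openin T U \<and> x \<in> U \<and> U \<subseteq> {y. F (f y) (g y) = F (f x) (g x)}"
    by (meson IntI openin_Int)
qed

section \<open>Cohomology classes\<close>

text \<open>Cochains store residues as the integers 0..p-1, so coboundaries of sums and differences
  carry nested reductions; these two forms strip them.\<close>

lemma coboundary_mod:
  fixes a b c d m :: int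
  shows "(a mod m - b mod m + c mod m) mod m = (a - b + c) mod m"
    and "(a mod m - b mod m + c mod m + d) mod m = (a - b + c + d) mod m"
  by (intro mod_add_cong mod_diff_cong; simp)+

lemma cochains1_iff:
  assumes "topspace T = carrier G" "1 < p"
  shows "y \<in> cochains1 G T (Fp p) \<longleftrightarrow>
    y \<in> extensional (carrier G) \<and>
    continuous_map T (discrete_topology {0..int p - 1}) y"
  using assms by (auto simp: cochains1_def residue_ring_simps PiE_def dest: continuous_map_discrete_value)

lemma cochains1_restrictI:
  assumes "topspace T = carrier G" "1 < p"
    and "continuous_map T (discrete_topology {0..int p - 1}) y"
  shows "restrict y (carrier G) \<in> cochains1 G T (Fp p)"
proof -
  have "continuous_map T (discrete_topology {0..int p - 1}) (restrict y (carrier G))"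
    using assms by (subst continuous_map_eq[OF assms(3)]) auto
  then show ?thesis using assms by (simp add: cochains1_iff)
qed

lemma cochains1_value:
  assumes "y \<in> cochains1 G T (Fp p)" "g \<in> carrier G"
  shows "y g mod int p = y g" "y g \<in> {0..int p - 1}"
  using assms by (auto simp: cochains1_def residue_ring_simps PiE_def Pi_iff)

lemma coboundary1_Fp:
  assumes "1 < p" "g \<in> carrier G" "h \<in> carrier G"
  shows "coboundary1 G (Fp p) y (g, h) = (y h - y (g \<otimes>\<^bsub>G\<^esub> h) + y g) mod int p"
  using assms by (simp add: coboundary1_def residue_ring_simps residue_ring_minus mod_simps)

lemma H2_class_iff:
  assumes "1 < p"
  shows "d \<in> H2_class G T (Fp p) c \<longleftrightarrow>
    (\<exists>z\<in>cochains1 G T (Fp p). d = (\<lambda>(g, h)\<in>carrier G \<times> carrier G.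
       (z h - z (g \<otimes>\<^bsub>G\<^esub> h) + z g + c (g, h)) mod int p))"
proof -
  have *: "mult (cochains2 G T (Fp p)) (coboundary1 G (Fp p) z) c =
     (\<lambda>(g, h)\<in>carrier G \<times> carrier G.
       (z h - z (g \<otimes>\<^bsub>G\<^esub> h) + z g + c (g, h)) mod int p)" for z
    using assms
    by (auto simp: cochains2_def restrict_def fun_eq_iff coboundary1_Fp residue_ring_simps mod_simps)
  show ?thesis
    unfolding H2_class_def r_coset_def coboundaries2_def by (auto simp: *)
qed

text \<open>A coboundary relation can be read in both directions, with -z in place of z, so one
  inclusion between cosets gives the other.\<close>

lemma H2_class_cong:
  assumes G: "group G" and T: "topspace T = carrier G" and p: "1 < p"
    and z: "z \<in> cochains1 G T (Fp p)"
    and c: "\<And>g h. g \<in> carrier G \<Longrightarrow> h \<in> carrier G \<Longrightarrow>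
      c' (g, h) = (z h - z (g \<otimes>\<^bsub>G\<^esub> h) + z g + c (g, h)) mod int p"
  shows "H2_class G T (Fp p) c' = H2_class G T (Fp p) c"
proof -
  interpret group G by fact
  \<comment> \<open>The left side is reduced modulo p so that the inclusion applies again with the
    roles exchanged, where \<open>a\<close> is \<open>c\<close> and may have unreduced
    values.\<close>
  have sub: "H2_class G T (Fp p) a \<subseteq> H2_class G T (Fp p) b"
    if u: "u \<in> cochains1 G T (Fp p)"
      and ab: "\<And>g h. g \<in> carrier G \<Longrightarrow> h \<in> carrier G \<Longrightarrow>
        a (g, h) mod int p = (u h - u (g \<otimes>\<^bsub>G\<^esub> h) + u g + b (g, h)) mod int p" for a b u
  proof
    fix d assume "d \<in> H2_class G T (Fp p) a"
    then obtain v where v: "v \<in> cochains1 G T (Fp p)"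
      and d: "d = (\<lambda>(g, h)\<in>carrier G \<times> carrier G.
         (v h - v (g \<otimes>\<^bsub>G\<^esub> h) + v g + a (g, h)) mod int p)"
      using H2_class_iff[OF p] by blast
    define w where "w = (\<lambda>g\<in>carrier G. (u g + v g) mod int p)"
    have "w \<in> cochains1 G T (Fp p)"
      unfolding w_def
      using u v T p mod_in_residues[of "int p"]
      by (intro cochains1_restrictI continuous_map_discrete_binop[where F = "\<lambda>a b. (a + b) mod int p"])
        (auto simp: cochains1_iff)
    moreover have "d = (\<lambda>(g, h)\<in>carrier G \<times> carrier G.
         (w h - w (g \<otimes>\<^bsub>G\<^esub> h) + w g + b (g, h)) mod int p)"
    proof -
      have "(v h - v (g \<otimes>\<^bsub>G\<^esub> h) + v g + a (g, h)) mod int p =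
         (w h - w (g \<otimes>\<^bsub>G\<^esub> h) + w g + b (g, h)) mod int p"
        if "g \<in> carrier G" "h \<in> carrier G" for g h
      proof -
        have "(v h - v (g \<otimes>\<^bsub>G\<^esub> h) + v g + a (g, h)) mod int p =
          (v h - v (g \<otimes>\<^bsub>G\<^esub> h) + v g + (a (g, h) mod int p)) mod int p"
          by (simp add: mod_simps)
        also have "\<dots> = (w h - w (g \<otimes>\<^bsub>G\<^esub> h) + w g + b (g, h)) mod int p"
          using that by (simp add: ab w_def coboundary_mod mod_simps) (simp add: algebra_simps)
        finally show ?thesis .
      qed
      then show ?thesis unfolding d by (auto simp: restrict_def fun_eq_iff)
    qed
    ultimately show "d \<in> H2_class G T (Fp p) b" using H2_class_iff[OF p] by blast
  qed
  define z' where "z' = (\<lambda>g\<in>carrier G. (- z g) mod int p)"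
  have z': "z' \<in> cochains1 G T (Fp p)"
    unfolding z'_def
    using z T p mod_in_residues[of "int p"]
    by (intro cochains1_restrictI continuous_map_discrete_binop[where F = "\<lambda>a b. (- a) mod int p" and g = z])
      (auto simp: cochains1_iff)
  show ?thesis
  proof (rule antisym)
    show "H2_class G T (Fp p) c' \<subseteq> H2_class G T (Fp p) c"
      using z by (rule sub) (simp add: c)
    show "H2_class G T (Fp p) c \<subseteq> H2_class G T (Fp p) c'"
      using z' by (rule sub) (simp add: c z'_def coboundary_mod mod_simps)
  qed
qed

lemma zero_cochain:
  assumes "topspace T = carrier G" "1 < p"
  shows "(\<lambda>g\<in>carrier G. 0) \<in> cochains1 G T (Fp p)"
  using assms by (intro cochains1_restrictI) auto

lemma H2_class_eqD:
  assumes G: "group G" and T: "topspace T = carrier G" and p: "1 < p"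
    and eq: "H2_class G T (Fp p) c' = H2_class G T (Fp p) c"
  obtains z where "z \<in> cochains1 G T (Fp p)"
    "\<And>g h. g \<in> carrier G \<Longrightarrow> h \<in> carrier G \<Longrightarrow>
      c' (g, h) mod int p = (z h - z (g \<otimes>\<^bsub>G\<^esub> h) + z g + c (g, h)) mod int p"
proof -
  interpret group G by fact
  \<comment> \<open>The representative of the class of \<open>c'\<close> that comes from the zero
    cochain; its membership in the class of \<open>c\<close> produces z.\<close>
  define d where "d = (\<lambda>(g, h)\<in>carrier G \<times> carrier G. c' (g, h) mod int p)"
  have "d \<in> H2_class G T (Fp p) c'"
    unfolding H2_class_iff[OF p]
    by (rule bexI[OF _ zero_cochain[OF T p]]) (auto simp: d_def restrict_def fun_eq_iff)
  then obtain z where z: "z \<in> cochains1 G T (Fp p)"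
    and d: "d = (\<lambda>(g, h)\<in>carrier G \<times> carrier G.
       (z h - z (g \<otimes>\<^bsub>G\<^esub> h) + z g + c (g, h)) mod int p)"
    unfolding eq H2_class_iff[OF p] by blast
  have "c' (g, h) mod int p = (z h - z (g \<otimes>\<^bsub>G\<^esub> h) + z g + c (g, h)) mod int p"
    if "g \<in> carrier G" "h \<in> carrier G" for g h
    using fun_cong[OF d, of "(g, h)"] that by (simp add: d_def)
  with z show thesis by (rule that)
qed

text \<open>Pulling back commutes with coboundaries, so all representatives give the same class; as
  the class is also nonempty, \<open>the_elem\<close> in \<open>H2_pullback\<close> sees a
  singleton.\<close>

lemma H2_pullback_class:
  assumes G: "group G" and T: "topspace T = carrier G"
    and TH: "topspace TH = carrier H" and p: "1 < p"
    and f: "f \<in> hom G H" and cont: "continuous_map T TH f"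
  shows "H2_pullback G T (Fp p) f (H2_class H TH (Fp p) c) =
    H2_class G T (Fp p) (\<lambda>(g, h)\<in>carrier G \<times> carrier G. c (f g, f h))"
    (is "_ = ?rhs")
proof -
  interpret group G by fact
  have *: "H2_class G T (Fp p) (\<lambda>(g, h)\<in>carrier G \<times> carrier G. d (f g, f h)) = ?rhs"
    if d: "d \<in> H2_class H TH (Fp p) c" for d
  proof -
    obtain z where z: "z \<in> cochains1 H TH (Fp p)"
      and d: "d = (\<lambda>(g, h)\<in>carrier H \<times> carrier H.
         (z h - z (g \<otimes>\<^bsub>H\<^esub> h) + z g + c (g, h)) mod int p)"
      using d H2_class_iff[OF p] by blast
    have "continuous_map T (discrete_topology {0..int p - 1}) (z \<circ> f)"
      using z TH p by (intro continuous_map_compose[OF cont]) (auto simp: cochains1_iff)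
    then have "restrict (z \<circ> f) (carrier G) \<in> cochains1 G T (Fp p)"
      using T p by (intro cochains1_restrictI)
    from G T p this show ?thesis
      by (rule H2_class_cong) (use f in \<open>auto simp: d hom_def Pi_iff\<close>)
  qed
  have "H2_class H TH (Fp p) c \<noteq> {}"
    using H2_class_iff[OF p] zero_cochain[OF TH p] by blast
  then have "(\<lambda>c. H2_class G T (Fp p) (\<lambda>(g, h)\<in>carrier G \<times> carrier G. c (f g, f h))) `
      H2_class H TH (Fp p) c = {?rhs}"
    using * by (auto simp: image_iff)
  then show ?thesis by (simp add: H2_pullback_def)
qed

section \<open>Transgression\<close>

lemma (in group) inv_mult_cancel:
  assumes "a \<in> carrier G" "b \<in> carrier G"
  shows "inv a \<otimes> (a \<otimes> b) = b" "a \<otimes> (inv a \<otimes> b) = b"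
  using assms by (simp_all add: m_assoc[symmetric])

section \<open>Topological groups and their quotients\<close>

locale mult_topological_group = group G for G (structure) +
  fixes T :: "'a topology"
  assumes topspace_eq: "topspace T = carrier G"
    and continuous_mult: "continuous_map (prod_topology T T) T (\<lambda>(x, y). x \<otimes> y)"
begin

lemma continuous_mult_left: "a \<in> carrier G \<Longrightarrow> continuous_map T T (\<lambda>x. a \<otimes> x)"
  using continuous_map_compose[OF _ continuous_mult, of T "\<lambda>x. (a, x)"]
  by (simp add: continuous_map_pairwise o_def topspace_eq)

lemma continuous_mult_right: "a \<in> carrier G \<Longrightarrow> continuous_map T T (\<lambda>x. x \<otimes> a)"
  using continuous_map_compose[OF _ continuous_mult, of T "\<lambda>x. (x, a)"]
  by (simp add: continuous_map_pairwise o_def topspace_eq)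

lemma continuous_conjugation:
  assumes "a \<in> carrier G"
  shows "continuous_map T T (\<lambda>x. a \<otimes> x \<otimes> inv a)"
  using continuous_map_compose[OF continuous_mult_left continuous_mult_right, of a "inv a"] assms
  by (simp add: o_def)

end

locale topological_quotient = mult_topological_group G T + normal N G
  for G (structure) and T N
begin

lemma rcos_eq_iff:
  assumes "g \<in> carrier G" "h \<in> carrier G"
  shows "N #> g = N #> h \<longleftrightarrow> (\<exists>n\<in>N. h = n \<otimes> g)"
proof
  assume "N #> g = N #> h"
  then have "h \<in> N #> g" using rcos_self[OF assms(2) subgroup_axioms] by simp
  then show "\<exists>n\<in>N. h = n \<otimes> g" by (auto simp: r_coset_def)
next
  assume "\<exists>n\<in>N. h = n \<otimes> g"
  then show "N #> g = N #> h"
    using assms by (intro repr_independence[OF _ _ subgroup_axioms]) (auto simp: r_coset_def)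
qed

lemma carrier_quotient: "carrier (G Mod N) = (\<lambda>g. N #> g) ` carrier G"
  by (auto simp: FactGroup_def RCOSETS_def)

lemma quotient_map_rcos: "quotient_map T (coset_topology G T N) (\<lambda>g. N #> g)"
  by (rule quotient_map_quotient_topology)

lemma topspace_coset_topology: "topspace (coset_topology G T N) = carrier (G Mod N)"
  using quotient_imp_surjective_map[OF quotient_map_rcos]
  by (simp add: carrier_quotient topspace_eq)

text \<open>The preimage of the image of U is NU, the union of the translates nU, so the projection
  is open. Openness survives products, unlike being a quotient map, and this is how continuity on
  G/N x G/N is obtained below.\<close>

lemma openin_rcos_image:
  assumes U: "openin T U"
  shows "openin (coset_topology G T N) ((\<lambda>g. N #> g) ` U)"
  unfolding openin_quotient_topology
proof
  have UG: "U \<subseteq> carrier G" using openin_subset[OF U] by (simp add: topspace_eq)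
  then show "(\<lambda>g. N #> g) ` U \<subseteq> (\<lambda>g. N #> g) ` topspace T" by (auto simp: topspace_eq)
  have "{x \<in> topspace T. N #> x \<in> (\<lambda>g. N #> g) ` U} =
      (\<Union>n\<in>N. {x \<in> topspace T. inv n \<otimes> x \<in> U})"
  proof (intro equalityI subsetI)
    fix x assume "x \<in> {x \<in> topspace T. N #> x \<in> (\<lambda>g. N #> g) ` U}"
    then obtain g where g: "g \<in> U" "N #> g = N #> x" "x \<in> carrier G"
      by (auto simp: topspace_eq)
    then obtain n where n: "n \<in> N" "x = n \<otimes> g" using UG rcos_eq_iff[of g x] by blast
    then have "inv n \<otimes> x = g" using g UG by (auto simp: m_assoc[symmetric])
    then have "x \<in> {x \<in> topspace T. inv n \<otimes> x \<in> U}" using g by (simp add: topspace_eq)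
    with n show "x \<in> (\<Union>n\<in>N. {x \<in> topspace T. inv n \<otimes> x \<in> U})" by blast
  next
    fix x assume "x \<in> (\<Union>n\<in>N. {x \<in> topspace T. inv n \<otimes> x \<in> U})"
    then obtain n where n: "n \<in> N" "x \<in> carrier G" "inv n \<otimes> x \<in> U" by (auto simp: topspace_eq)
    then have "N #> x = N #> (inv n \<otimes> x)"
      by (subst rcos_eq_iff) auto
    with n show "x \<in> {x \<in> topspace T. N #> x \<in> (\<lambda>g. N #> g) ` U}"
      by (auto simp: topspace_eq)
  qed
  moreover have "openin T {x \<in> topspace T. inv n \<otimes> x \<in> U}" if "n \<in> N" for n
    using that by (intro openin_continuous_map_preimage[OF continuous_mult_left U]) auto
  ultimately show "openin T {x \<in> topspace T. N #> x \<in> (\<lambda>g. N #> g) ` U}"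
    by auto
qed

lemma lift_to_quotient:
  assumes p: "1 < p" and d: "continuous_map T (discrete_topology {0..int p - 1}) d"
    and inv: "\<And>n g. n \<in> N \<Longrightarrow> g \<in> carrier G \<Longrightarrow> d (n \<otimes> g) = d g"
  obtains z where "z \<in> cochains1 (G Mod N) (coset_topology G T N) (Fp p)"
    "\<And>g. g \<in> carrier G \<Longrightarrow> z (N #> g) = d g"
proof -
  have "d g = d h" if "g \<in> topspace T" "h \<in> topspace T" "N #> g = N #> h" for g h
    using that rcos_eq_iff[of g h] inv by (auto simp: topspace_eq)
  then obtain z where z: "continuous_map (coset_topology G T N) (discrete_topology {0..int p - 1}) z"
    "\<And>g. g \<in> topspace T \<Longrightarrow> z (N #> g) = d g"
    using quotient_map_lift_exists[OF quotient_map_rcos d] by metis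
  show thesis
  proof
    show "restrict z (carrier (G Mod N)) \<in> cochains1 (G Mod N) (coset_topology G T N) (Fp p)"
      using z p by (intro cochains1_restrictI topspace_coset_topology)
    show "restrict z (carrier (G Mod N)) (N #> g) = d g" if "g \<in> carrier G" for g
      using that z by (simp add: topspace_eq carrier_quotient)
  qed
qed

lemma continuous_coboundary:
  assumes p: "1 < p" and y: "y \<in> cochains1 G T (Fp p)"
  shows "continuous_map (prod_topology T T) (discrete_topology {0..int p - 1})
    (\<lambda>(g, h). (y h - y (g \<otimes> h) + y g) mod int p)"
proof -
  have y: "continuous_map T (discrete_topology {0..int p - 1}) y"
    using y p topspace_eq by (simp add: cochains1_iff)
  note mod_in_residues[of "int p"]
  have 1: "continuous_map (prod_topology T T) (discrete_topology {0..int p - 1}) (\<lambda>x. y (fst x))"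
    using continuous_map_compose[OF continuous_map_fst y] by (simp add: o_def)
  have 2: "continuous_map (prod_topology T T) (discrete_topology {0..int p - 1}) (\<lambda>x. y (snd x))"
    using continuous_map_compose[OF continuous_map_snd y] by (simp add: o_def)
  have 3: "continuous_map (prod_topology T T) (discrete_topology {0..int p - 1})
      (\<lambda>x. y (fst x \<otimes> snd x))"
    using continuous_map_compose[OF continuous_mult y] by (simp add: o_def case_prod_beta)
  have 4: "continuous_map (prod_topology T T) (discrete_topology UNIV)
      (\<lambda>x. y (snd x) - y (fst x \<otimes> snd x))"
    by (rule continuous_map_discrete_binop[OF 2 3]) auto
  have "continuous_map (prod_topology T T) (discrete_topology {0..int p - 1})
      (\<lambda>x. (y (snd x) - y (fst x \<otimes> snd x) + y (fst x)) mod int p)"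
    by (rule continuous_map_discrete_binop[OF 4 1, where F = "\<lambda>a b. (a + b) mod int p"])
      (use p mod_in_residues[of "int p"] in auto)
  then show ?thesis by (simp add: case_prod_unfold)
qed

text \<open>The cocycle identity holds on G because the coboundary of a coboundary vanishes, and it
  descends along the surjection. Continuity descends because images of open boxes are open
  boxes.\<close>

lemma induced_cocycle:
  assumes p: "1 < p" and y: "y \<in> cochains1 G T (Fp p)"
    and ext: "c \<in> extensional (carrier (G Mod N) \<times> carrier (G Mod N))"
    and c: "\<And>g h. g \<in> carrier G \<Longrightarrow> h \<in> carrier G \<Longrightarrow>
      c (N #> g, N #> h) = (y h - y (g \<otimes> h) + y g) mod int p"
  shows "c \<in> cocycles2 (G Mod N) (coset_topology G T N) (Fp p)"
proof -
  let ?Q = "carrier (G Mod N)" and ?TQ = "coset_topology G T N"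
  have range: "c q \<in> {0..int p - 1}" if "q \<in> ?Q \<times> ?Q" for q
    using that mod_in_residues[of "int p"] p by (auto simp: carrier_quotient c)
  have "continuous_map (prod_topology ?TQ ?TQ) (discrete_topology {0..int p - 1}) c"
  proof (rule continuous_map_discreteI)
    fix q assume "q \<in> topspace (prod_topology ?TQ ?TQ)"
    then have q: "q \<in> ?Q \<times> ?Q" by (simp add: topspace_coset_topology)
    then show "c q \<in> {0..int p - 1}" by (rule range)
    from q obtain g h where gh: "g \<in> carrier G" "h \<in> carrier G" "q = (N #> g, N #> h)"
      by (auto simp: carrier_quotient)
    let ?C = "\<lambda>(g, h). (y h - y (g \<otimes> h) + y g) mod int p"
    obtain W where W: "openin (prod_topology T T) W" "(g, h) \<in> W" "W \<subseteq> {x. ?C x = ?C (g, h)}"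
      using continuous_map_discreteE[OF continuous_coboundary[OF p y], of "(g, h)"] gh
      by (auto simp: topspace_eq)
    from W(1,2) have "\<exists>U V. openin T U \<and> openin T V \<and> g \<in> U \<and> h \<in> V \<and> U \<times> V \<subseteq> W"
      by (simp add: openin_prod_topology_alt)
    then obtain U V where UV: "openin T U" "openin T V" "g \<in> U" "h \<in> V" "U \<times> V \<subseteq> W"
      by blast
    have UVG: "U \<subseteq> carrier G" "V \<subseteq> carrier G"
      using openin_subset[OF UV(1)] openin_subset[OF UV(2)] topspace_eq by auto
    show "\<exists>W. openin (prod_topology ?TQ ?TQ) W \<and> q \<in> W \<and> W \<subseteq> {y. c y = c q}"
    proof (intro exI conjI)
      show "openin (prod_topology ?TQ ?TQ) ((\<lambda>g. N #> g) ` U \<times> (\<lambda>g. N #> g) ` V)"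
        using UV by (simp add: openin_prod_Times_iff openin_rcos_image)
      show "q \<in> (\<lambda>g. N #> g) ` U \<times> (\<lambda>g. N #> g) ` V" using UV gh by auto
      show "(\<lambda>g. N #> g) ` U \<times> (\<lambda>g. N #> g) ` V \<subseteq> {y. c y = c q}"
      proof clarify
        fix a b assume ab: "a \<in> U" "b \<in> V"
        then have "(a, b) \<in> {x. ?C x = ?C (g, h)}" using UV W by blast
        then have C: "?C (a, b) = ?C (g, h)" by (rule CollectD)
        have "c (N #> a, N #> b) = ?C (a, b)" using ab UVG by (subst c) auto
        also have "\<dots> = c q" unfolding C gh(3) using gh by (subst c) auto
        finally show "c (N #> a, N #> b) = c q" .
      qed
    qed
  qed
  then have "c \<in> carrier (cochains2 (G Mod N) ?TQ (Fp p))"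
    using range ext by (auto simp: cochains2_def residue_ring_simps PiE_def)
  moreover have "c (b, d) \<ominus>\<^bsub>Fp p\<^esub> c (a \<otimes>\<^bsub>G Mod N\<^esub> b, d) \<oplus>\<^bsub>Fp p\<^esub> c (a, b \<otimes>\<^bsub>G Mod N\<^esub> d)
      \<ominus>\<^bsub>Fp p\<^esub> c (a, b) = \<zero>\<^bsub>Fp p\<^esub>"
    if "a \<in> ?Q" "b \<in> ?Q" "d \<in> ?Q" for a b d
  proof -
    have *: "(a mod m - b mod m + c mod m - d mod m) mod m = (a - b + c - d) mod m"
      for a b c d m :: int
      by (intro mod_add_cong mod_diff_cong; simp)
    from that obtain g h k where "g \<in> carrier G" "h \<in> carrier G" "k \<in> carrier G"
      "a = N #> g" "b = N #> h" "d = N #> k" by (auto simp: carrier_quotient)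
    then show ?thesis using p
      by (simp add: rcos_sum c residue_ring_minus residue_ring_simps mod_simps)
        (simp add: * m_assoc)
  qed
  ultimately show ?thesis by (simp add: cocycles2_def)
qed

text \<open>As n and 1 lie in the same coset, c takes the same value on (Nn, Ng) and (N1, Ng). The
  term \<open>y \<one>\<close> survives because y is not normalized; it cancels when two extensions
  of the same character are compared.\<close>

lemma coset_invariant_coboundary:
  assumes p: "1 < p" and y: "y \<in> cochains1 G T (Fp p)"
    and c: "\<And>g h. g \<in> carrier G \<Longrightarrow> h \<in> carrier G \<Longrightarrow>
      c (N #> g, N #> h) = (y h - y (g \<otimes> h) + y g) mod int p"
    and n: "n \<in> N" and g: "g \<in> carrier G"
  shows "y (n \<otimes> g) = (y n + y g - y \<one>) mod int p"
proof -
  have "N #> n = N #> \<one>" using n by (subst rcos_eq_iff) (auto intro!: bexI[of _ "inv n"])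
  then have "(y g - y (n \<otimes> g) + y n) mod int p = (y g - y (\<one> \<otimes> g) + y \<one>) mod int p"
    using c[of n g] c[of \<one> g] n g by simp
  then have "(y g - y (n \<otimes> g) + y n) mod int p = y \<one> mod int p"
    using g by simp
  then have "y (n \<otimes> g) mod int p = (y n + y g - y \<one>) mod int p"
    by (simp add: mod_eq_dvd_iff) (metis (no_types, opaque_lifting) dvd_minus_iff minus_diff_eq add.commute diff_diff_eq2 diff_add_eq)
  then show ?thesis
    using cochains1_value[OF y, of "n \<otimes> g"] n g by simp
qed

text \<open>\<open>transgression\<close> is \<open>the_elem\<close> of the classes arising from all
  extensions of \<open>\<psi>\<close>, so the point is that two extensions give the same
  class.\<close>

lemma transgression_eqI:
  assumes p: "1 < p" and y: "y \<in> cochains1 G T (Fp p)"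
    and \<psi>: "\<And>n. n \<in> N \<Longrightarrow> y n = \<psi> n"
    and ext: "c \<in> extensional (carrier (G Mod N) \<times> carrier (G Mod N))"
    and c: "\<And>g h. g \<in> carrier G \<Longrightarrow> h \<in> carrier G \<Longrightarrow>
      c (N #> g, N #> h) = (y h - y (g \<otimes> h) + y g) mod int p"
  shows "transgression G T N (Fp p) \<psi> = H2_class (G Mod N) (coset_topology G T N) (Fp p) c"
proof -
  let ?Q = "G Mod N" and ?TQ = "coset_topology G T N"
  have "H2_class ?Q ?TQ (Fp p) c' = H2_class ?Q ?TQ (Fp p) c"
    if y': "y' \<in> cochains1 G T (Fp p)" and \<psi>': "\<And>n. n \<in> N \<Longrightarrow> y' n = \<psi> n"
      and c': "\<And>g h. g \<in> carrier G \<Longrightarrow> h \<in> carrier G \<Longrightarrow>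
        c' (N #> g, N #> h) = (y' h - y' (g \<otimes> h) + y' g) mod int p" for y' c'
  proof -
    \<comment> \<open>The difference of two extensions is invariant under N and descends to a
      cochain on the quotient, whose coboundary is the difference of the induced cocycles.\<close>
    define d where "d = (\<lambda>g. (y' g - y g) mod int p)"
    have "continuous_map T (discrete_topology {0..int p - 1}) d"
      unfolding d_def using y y' p topspace_eq mod_in_residues[of "int p"]
      by (intro continuous_map_discrete_binop[where F = "\<lambda>a b. (a - b) mod int p"])
        (auto simp: cochains1_iff)
    moreover have "d (n \<otimes> g) = d g" if "n \<in> N" "g \<in> carrier G" for n g
      using that \<psi> \<psi>' unfolding d_def
      by (simp add: coset_invariant_coboundary[OF p y c] coset_invariant_coboundary[OF p y' c']
          mod_diff_eq)
    ultimately obtain z where z: "z \<in> cochains1 ?Q ?TQ (Fp p)"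
      "\<And>g. g \<in> carrier G \<Longrightarrow> z (N #> g) = d g"
      using lift_to_quotient[OF p] by blast
    show ?thesis
    proof (rule H2_class_cong[OF factorgroup_is_group topspace_coset_topology p z(1)])
      fix a b assume "a \<in> carrier ?Q" "b \<in> carrier ?Q"
      then obtain g h where "g \<in> carrier G" "h \<in> carrier G" "a = N #> g" "b = N #> h"
        by (auto simp: carrier_quotient)
      then show "c' (a, b) = (z b - z (a \<otimes>\<^bsub>?Q\<^esub> b) + z a + c (a, b)) mod int p"
        by (simp add: rcos_sum z c c' d_def coboundary_mod mod_simps) (simp add: algebra_simps)
    qed
  qed
  then have sub: "H2_class ?Q ?TQ (Fp p) c' = H2_class ?Q ?TQ (Fp p) c"
    if "y' \<in> cochains1 G T (Fp p)" "\<forall>\<tau>\<in>N. y' \<tau> = \<psi> \<tau>"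
      "\<forall>g\<in>carrier G. \<forall>h\<in>carrier G. c' (N #> g, N #> h) = coboundary1 G (Fp p) y' (g, h)"
    for y' c'
    using that p by (simp add: coboundary1_Fp)
  have c_cocycle: "c \<in> cocycles2 ?Q ?TQ (Fp p)"
    using induced_cocycle[OF p y ext c] .
  have c_cob: "\<forall>g\<in>carrier G. \<forall>h\<in>carrier G. c (N #> g, N #> h) = coboundary1 G (Fp p) y (g, h)"
    using c p by (simp add: coboundary1_Fp)
  have "{H2_class ?Q ?TQ (Fp p) c | c y.
       c \<in> cocycles2 ?Q ?TQ (Fp p) \<and> y \<in> cochains1 G T (Fp p) \<and> (\<forall>\<tau>\<in>N. y \<tau> = \<psi> \<tau>) \<and>
       (\<forall>g\<in>carrier G. \<forall>h\<in>carrier G.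
          c (N #> g, N #> h) = coboundary1 G (Fp p) y (g, h))} =
     {H2_class ?Q ?TQ (Fp p) c}"
    (is "?A = {_}")
  proof (rule equalityI)
    show "?A \<subseteq> {H2_class ?Q ?TQ (Fp p) c}"
      by (rule subsetI, erule CollectE, elim exE conjE) (simp only: sub singleton_iff)
    have "H2_class ?Q ?TQ (Fp p) c \<in> ?A"
      using c_cocycle y \<psi> c_cob by (intro CollectI exI[of _ c] exI[of _ y] conjI ballI refl) simp_all
    then show "{H2_class ?Q ?TQ (Fp p) c} \<subseteq> ?A"
      by (simp only: insert_subset empty_subsetI simp_thms)
  qed
  then show ?thesis by (simp add: transgression_def)
qed

section \<open>Injectivity of the transgression\<close>

definition is_lift :: "nat \<Rightarrow> ('a \<Rightarrow> int) \<Rightarrow> ('a \<Rightarrow> int) \<Rightarrow> ('a set \<times> 'a set \<Rightarrow> int) \<Rightarrow> bool" where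
  "is_lift p \<psi> y c \<longleftrightarrow> y \<in> cochains1 G T (Fp p) \<and> (\<forall>n\<in>N. y n = \<psi> n) \<and>
    c \<in> extensional (carrier (G Mod N) \<times> carrier (G Mod N)) \<and>
    (\<forall>g\<in>carrier G. \<forall>h\<in>carrier G. c (N #> g, N #> h) = (y h - y (g \<otimes> h) + y g) mod int p)"

lemma H1_invariants_iff:
  assumes "1 < p"
  shows "\<psi> \<in> H1_invariants G T N (Fp p) \<longleftrightarrow> \<psi> \<in> extensional N \<and>
    continuous_map (subtopology T N) (discrete_topology {0..int p - 1}) \<psi> \<and>
    (\<forall>m\<in>N. \<forall>n\<in>N. \<psi> (m \<otimes> n) = (\<psi> m + \<psi> n) mod int p) \<and>
    (\<forall>g\<in>carrier G. \<forall>n\<in>N. \<psi> (inv g \<otimes> n \<otimes> g) = \<psi> n)"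
proof -
  have "\<psi> n \<in> {0..int p - 1}"
    if "continuous_map (subtopology T N) (discrete_topology {0..int p - 1}) \<psi>" "n \<in> N" for n
    using that continuous_map_discrete_value[OF that(1)] subset by (simp add: topspace_eq)
  then show ?thesis
    by (auto simp: H1_invariants_def hom_def residue_ring_simps Pi_iff)
qed

lemma H1_invariants_value:
  assumes "1 < p" "\<psi> \<in> H1_invariants G T N (Fp p)" "n \<in> N"
  shows "\<psi> n mod int p = \<psi> n"
  using assms continuous_map_discrete_value[of "subtopology T N" "{0..int p - 1}" \<psi> n] subset
  by (auto simp: H1_invariants_iff topspace_eq)

lemma H1_invariants_one:
  assumes "1 < p" "\<psi> \<in> H1_invariants G T N (Fp p)"
  shows "\<psi> \<one> = 0"
proof -
  have "\<psi> \<one> = (\<psi> \<one> + \<psi> \<one>) mod int p"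
    using assms one_closed by (auto simp: H1_invariants_iff dest!: bspec[of N _ \<one>])
  then have "int p dvd \<psi> \<one>"
    using H1_invariants_value[OF assms one_closed] by (metis add_diff_cancel_left' mod_eq_dvd_iff)
  then show ?thesis using H1_invariants_value[OF assms one_closed] by simp
qed

text \<open>If every continuous homomorphism to \<open>\<F>\<^sub>p\<close> is trivial on \<open>N\<close>, the restriction map in the
  five-term sequence vanishes.\<close>

lemma transgression_inject:
  assumes p: "1 < p"
    and \<psi>: "\<psi> \<in> H1_invariants G T N (Fp p)" and \<psi>': "\<psi>' \<in> H1_invariants G T N (Fp p)"
    and lift: "is_lift p \<psi> y c" and lift': "is_lift p \<psi>' y' c'"
    and eq: "transgression G T N (Fp p) \<psi> = transgression G T N (Fp p) \<psi>'"
    and triv: "\<And>\<eta> n. \<eta> \<in> cochains1 G T (Fp p) \<Longrightarrow>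
       (\<And>g h. g \<in> carrier G \<Longrightarrow> h \<in> carrier G \<Longrightarrow> \<eta> (g \<otimes> h) = (\<eta> g + \<eta> h) mod int p) \<Longrightarrow>
       n \<in> N \<Longrightarrow> \<eta> n = 0"
  shows "\<psi> = \<psi>'"
proof -
  let ?Q = "G Mod N" and ?TQ = "coset_topology G T N"
  have y: "y \<in> cochains1 G T (Fp p)" "\<And>n. n \<in> N \<Longrightarrow> y n = \<psi> n"
     "c \<in> extensional (carrier (G Mod N) \<times> carrier (G Mod N))"
     and c: "\<And>g h. g \<in> carrier G \<Longrightarrow> h \<in> carrier G \<Longrightarrow>
        c (N #> g, N #> h) = (y h - y (g \<otimes> h) + y g) mod int p"
    using lift by (auto simp: is_lift_def)
  have y': "y' \<in> cochains1 G T (Fp p)" "\<And>n. n \<in> N \<Longrightarrow> y' n = \<psi>' n"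
     "c' \<in> extensional (carrier (G Mod N) \<times> carrier (G Mod N))"
     and c': "\<And>g h. g \<in> carrier G \<Longrightarrow> h \<in> carrier G \<Longrightarrow>
        c' (N #> g, N #> h) = (y' h - y' (g \<otimes> h) + y' g) mod int p"
    using lift' by (auto simp: is_lift_def)
  have "H2_class ?Q ?TQ (Fp p) c = H2_class ?Q ?TQ (Fp p) c'"
    using eq transgression_eqI[OF p y c] transgression_eqI[OF p y' c'] by simp
  from H2_class_eqD[OF factorgroup_is_group topspace_coset_topology p this]
  obtain z where z: "z \<in> cochains1 ?Q ?TQ (Fp p)"
    "\<And>a b. a \<in> carrier ?Q \<Longrightarrow> b \<in> carrier ?Q \<Longrightarrow>
      c (a, b) mod int p = (z b - z (a \<otimes>\<^bsub>?Q\<^esub> b) + z a + c' (a, b)) mod int p" by blast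
  \<comment> \<open>Modulo p, the coboundary of y - y' equals that of the pullback of z, so
    \<open>\<eta>\<close> is a homomorphism; \<open>triv\<close> then makes it vanish on N.\<close>
  define \<eta> where "\<eta> = (\<lambda>g\<in>carrier G. (y g - y' g - z (N #> g)) mod int p)"
  have "continuous_map T (discrete_topology {0..int p - 1}) (\<lambda>g. z (N #> g))"
    using z p continuous_map_compose[OF quotient_imp_continuous_map[OF quotient_map_rcos], of _ z]
    by (auto simp: cochains1_iff topspace_coset_topology o_def)
  moreover have "continuous_map T (discrete_topology UNIV) (\<lambda>g. y g - y' g)"
    using y y' p by (intro continuous_map_discrete_binop[where F = "(-)"])
      (auto simp: cochains1_iff topspace_eq)
  ultimately have "continuous_map T (discrete_topology {0..int p - 1})
      (\<lambda>g. (y g - y' g - z (N #> g)) mod int p)"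
    using mod_in_residues[of "int p"] p
    by (intro continuous_map_discrete_binop[where F = "\<lambda>a b. (a - b) mod int p"]) auto
  then have \<eta>1: "\<eta> \<in> cochains1 G T (Fp p)"
    unfolding \<eta>_def using p topspace_eq by (intro cochains1_restrictI) auto
  have \<eta>2: "\<eta> (g \<otimes> h) = (\<eta> g + \<eta> h) mod int p" if gh: "g \<in> carrier G" "h \<in> carrier G" for g h
  proof -
    have "(y h - y (g \<otimes> h) + y g) mod int p =
       (z (N #> h) - z (N #> (g \<otimes> h)) + z (N #> g) + (y' h - y' (g \<otimes> h) + y' g)) mod int p"
      using z(2)[of "N #> g" "N #> h"] gh by (simp add: carrier_quotient rcos_sum c c' mod_simps)
    then have "int p dvd (y h - y (g \<otimes> h) + y g) -
       (z (N #> h) - z (N #> (g \<otimes> h)) + z (N #> g) + (y' h - y' (g \<otimes> h) + y' g))"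
      by (simp add: mod_eq_dvd_iff)
    also have "(y h - y (g \<otimes> h) + y g) -
       (z (N #> h) - z (N #> (g \<otimes> h)) + z (N #> g) + (y' h - y' (g \<otimes> h) + y' g)) =
       ((y g - y' g - z (N #> g)) + (y h - y' h - z (N #> h))) -
       (y (g \<otimes> h) - y' (g \<otimes> h) - z (N #> (g \<otimes> h)))" by simp
    finally have "((y g - y' g - z (N #> g)) + (y h - y' h - z (N #> h))) mod int p =
       (y (g \<otimes> h) - y' (g \<otimes> h) - z (N #> (g \<otimes> h))) mod int p"
      by (simp only: mod_eq_dvd_iff)
    then show ?thesis using gh by (simp add: \<eta>_def mod_add_eq)
  qed
  have *: "(\<psi> n - \<psi>' n - z (N #> n)) mod int p = 0" if "n \<in> N" for n
    using triv[OF \<eta>1 \<eta>2 that] that subset y(2) y'(2) by (auto simp: \<eta>_def)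
  \<comment> \<open>On N only the value of z at the trivial coset matters; taking n = 1, where both
    characters vanish, shows that it is 0 modulo p.\<close>
  have "(- z (N #> \<one>)) mod int p = 0"
    using *[OF one_closed] H1_invariants_one[OF p \<psi>] H1_invariants_one[OF p \<psi>'] by simp
  then have z0: "int p dvd z (N #> \<one>)" by (simp add: mod_eq_0_iff_dvd)
  have "\<psi> n = \<psi>' n" if n: "n \<in> N" for n
  proof -
    have "N #> n = N #> \<one>" using n by (subst rcos_eq_iff) (auto intro!: bexI[of _ "inv n"])
    then have "int p dvd \<psi> n - \<psi>' n"
      using *[OF n] z0 by (metis diff_add_cancel dvd_add mod_eq_0_iff_dvd)
    then show ?thesis
      using H1_invariants_value[OF p \<psi> n] H1_invariants_value[OF p \<psi>' n]
      by (metis mod_eq_dvd_iff)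
  qed
  then show ?thesis
    using p \<psi> \<psi>' by (intro extensionalityI[of _ N]) (auto simp: H1_invariants_iff)
qed

text \<open>If y shifts by \<open>\<psi>\<close> under left translation by N, its coboundary depends
  only on cosets: in m g n h the factor n moves to the left as g n g^-1, and \<open>\<psi>\<close>
  does not see the conjugation.\<close>

lemma lift_if_equivariant:
  assumes p: "1 < p" and \<psi>: "\<psi> \<in> H1_invariants G T N (Fp p)"
    and y: "y \<in> cochains1 G T (Fp p)" and y\<psi>: "\<And>n. n \<in> N \<Longrightarrow> y n = \<psi> n"
    and eqv: "\<And>n g. n \<in> N \<Longrightarrow> g \<in> carrier G \<Longrightarrow> y (n \<otimes> g) = (\<psi> n + y g) mod int p"
  obtains c where "is_lift p \<psi> y c"
proof -
  let ?C = "\<lambda>g h. (y h - y (g \<otimes> h) + y g) mod int p"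
  have rep: "(SOME h. h \<in> N #> g) \<in> carrier G \<and> (\<exists>n\<in>N. (SOME h. h \<in> N #> g) = n \<otimes> g)"
    if "g \<in> carrier G" for g
  proof -
    have "(SOME h. h \<in> N #> g) \<in> N #> g"
      using rcos_self[OF that subgroup_axioms] by (rule someI)
    then show ?thesis using that by (auto simp: r_coset_def)
  qed
  have inv: "?C (m \<otimes> g) (n \<otimes> h) = ?C g h"
    if "m \<in> N" "n \<in> N" and gh: "g \<in> carrier G" "h \<in> carrier G" for m n g h
  proof -
    have n': "g \<otimes> n \<otimes> inv g \<in> N" using that inv_op_closed2 by blast
    have "\<psi> (g \<otimes> n \<otimes> inv g) = \<psi> (inv g \<otimes> (g \<otimes> n \<otimes> inv g) \<otimes> g)"
      using \<psi> p n' gh by (simp add: H1_invariants_iff)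
    also have "inv g \<otimes> (g \<otimes> n \<otimes> inv g) \<otimes> g = n" using that by (simp add: m_assoc inv_mult_cancel)
    finally have \<psi>n: "\<psi> (g \<otimes> n \<otimes> inv g) = \<psi> n" .
    have eq: "m \<otimes> g \<otimes> (n \<otimes> h) = m \<otimes> ((g \<otimes> n \<otimes> inv g) \<otimes> (g \<otimes> h))"
      using that by (simp add: m_assoc inv_mult_cancel)
    have "(m \<otimes> g) \<in> carrier G" using that by auto
    have "y (m \<otimes> g \<otimes> (n \<otimes> h)) = (\<psi> m + (\<psi> n + y (g \<otimes> h))) mod int p"
      unfolding eq using that n' by (simp add: eqv \<psi>n mod_simps)
    then have "?C (m \<otimes> g) (n \<otimes> h) =
        ((\<psi> n + y h) mod int p - (\<psi> m + (\<psi> n + y (g \<otimes> h))) mod int p +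
        (\<psi> m + y g) mod int p) mod int p"
      using that by (simp add: eqv)
    also have "\<dots> = ?C g h" unfolding coboundary_mod by (simp add: algebra_simps)
    finally show ?thesis .
  qed
  define c where "c = (\<lambda>(a, b)\<in>carrier (G Mod N) \<times> carrier (G Mod N).
     ?C (SOME g. g \<in> a) (SOME h. h \<in> b))"
  have "c (N #> g, N #> h) = ?C g h" if gh: "g \<in> carrier G" "h \<in> carrier G" for g h
  proof -
    obtain m n where mn: "m \<in> N" "n \<in> N" "(SOME k. k \<in> N #> g) = m \<otimes> g" "(SOME k. k \<in> N #> h) = n \<otimes> h"
      using rep[OF gh(1)] rep[OF gh(2)] by blast
    have "c (N #> g, N #> h) = ?C (SOME k. k \<in> N #> g) (SOME k. k \<in> N #> h)"
      using gh by (simp add: c_def carrier_quotient)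
    also have "\<dots> = ?C g h" unfolding mn(3,4) by (rule inv) (use mn gh in auto)
    finally show ?thesis .
  qed
  then have "is_lift p \<psi> y c"
    using y y\<psi> by (auto simp: is_lift_def c_def)
  then show thesis by (rule that)
qed

text \<open>A continuous section of \<open>G \<rightarrow> G/N\<close> is avoided by working with the double cosets
  \<open>N t U\<close> for an open subgroup \<open>U\<close> with \<open>N \<inter> U \<subseteq> ker \<psi>\<close>.\<close>

lemma lift_exists_open_subgroup:
  assumes p: "1 < p" and \<psi>: "\<psi> \<in> H1_invariants G T N (Fp p)"
    and U: "subgroup U G" "openin T U" and U0: "\<And>u. u \<in> U \<inter> N \<Longrightarrow> \<psi> u = 0"
  obtains y c where "is_lift p \<psi> y c"
proof -
  interpret U: subgroup U G by fact
  have hom: "\<psi> (m \<otimes> n) = (\<psi> m + \<psi> n) mod int p" if "m \<in> N" "n \<in> N" for m n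
    using \<psi> p that by (simp add: H1_invariants_iff)
  define D where "D = (\<lambda>g. {n \<otimes> g \<otimes> u | n u. n \<in> N \<and> u \<in> U})"
  \<comment> \<open>A representative of the double coset, normalized to 1 on the double coset of 1,
    so that the cochain built from it restricts to \<open>\<psi>\<close> on N.\<close>
  define t where "t = (\<lambda>g. if \<one> \<in> D g then \<one> else SOME t. t \<in> D g)"
  have D_sub: "D (n \<otimes> g \<otimes> u) \<subseteq> D g" if "n \<in> N" "g \<in> carrier G" "u \<in> U" for n g u
  proof
    fix x assume "x \<in> D (n \<otimes> g \<otimes> u)"
    then obtain n' u' where "n' \<in> N" "u' \<in> U" "x = n' \<otimes> (n \<otimes> g \<otimes> u) \<otimes> u'"
      unfolding D_def by blast
    then have "n' \<otimes> n \<in> N \<and> u \<otimes> u' \<in> U \<and> x = (n' \<otimes> n) \<otimes> g \<otimes> (u \<otimes> u')"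
      using that by (simp add: m_assoc)
    then show "x \<in> D g" unfolding D_def by blast
  qed
  have D_eq: "D (n \<otimes> g \<otimes> u) = D g" if "n \<in> N" "g \<in> carrier G" "u \<in> U" for n g u
  proof
    show "D (n \<otimes> g \<otimes> u) \<subseteq> D g" using that by (rule D_sub)
    have "g = inv n \<otimes> (n \<otimes> g \<otimes> u) \<otimes> inv u" using that by (simp add: m_assoc inv_mult_cancel)
    then show "D g \<subseteq> D (n \<otimes> g \<otimes> u)"
      using D_sub[of "inv n" "n \<otimes> g \<otimes> u" "inv u"] that by auto
  qed
  have gD: "g \<in> D g" if "g \<in> carrier G" for g
    unfolding D_def using that by (intro CollectI exI[of _ \<one>]) auto
  have tD: "t g \<in> D g" if "g \<in> carrier G" for g
    unfolding t_def using someI[of "\<lambda>t. t \<in> D g", OF gD[OF that]] by simp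
  have t_carrier: "t g \<in> carrier G" if "g \<in> carrier G" for g
    using tD[OF that] that by (auto simp: D_def)
  have dec: "\<exists>n. n \<in> N \<and> (\<exists>u\<in>U. g = n \<otimes> t g \<otimes> u)" if g: "g \<in> carrier G" for g
  proof -
    from tD[OF g] obtain n u where "n \<in> N" "u \<in> U" "t g = n \<otimes> g \<otimes> u"
      unfolding D_def by blast
    then have "inv n \<in> N \<and> inv u \<in> U \<and> g = inv n \<otimes> t g \<otimes> inv u"
      using g by (simp add: m_assoc inv_mult_cancel)
    then show ?thesis by blast
  qed
  \<comment> \<open>In n t u the factor n is determined up to an element of N whose conjugate by t
    lies in both N and U, where \<open>\<psi>\<close> vanishes; conjugation invariance removes
    t.\<close>
  have wd: "\<psi> n = \<psi> n'"
    if "n \<in> N" "n' \<in> N" "u \<in> U" "u' \<in> U" and t: "t \<in> carrier G" and eq: "n \<otimes> t \<otimes> u = n' \<otimes> t \<otimes> u'"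
    for n n' u u' t
  proof -
    let ?v = "inv t \<otimes> (inv n' \<otimes> n) \<otimes> t"
    have "n \<otimes> t = n \<otimes> t \<otimes> u \<otimes> inv u" using that(1-4) t by (simp add: m_assoc)
    also have "\<dots> = n' \<otimes> t \<otimes> u' \<otimes> inv u" by (simp only: eq)
    finally have nt: "n \<otimes> t = n' \<otimes> t \<otimes> u' \<otimes> inv u" .
    have "?v = inv t \<otimes> (inv n' \<otimes> (n \<otimes> t))" using that(1-4) t by (simp add: m_assoc)
    also have "\<dots> = u' \<otimes> inv u" unfolding nt using that(1-4) t by (simp add: m_assoc inv_mult_cancel)
    finally have "?v = u' \<otimes> inv u" .
    then have "?v \<in> U" using that by simp
    moreover have "?v \<in> N" using that inv_op_closed1 by blast
    ultimately have "\<psi> ?v = 0" using U0 by blast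
    moreover have "\<psi> ?v = \<psi> (inv n' \<otimes> n)"
      using \<psi> p that by (simp add: H1_invariants_iff)
    moreover have "\<psi> n = (\<psi> n' + \<psi> (inv n' \<otimes> n)) mod int p"
      using hom[of n' "inv n' \<otimes> n"] that by (simp add: m_assoc[symmetric])
    ultimately show ?thesis using H1_invariants_value[OF p \<psi> \<open>n' \<in> N\<close>] by simp
  qed
  \<comment> \<open>The value at n t u is \<open>\<psi> n\<close>: left translation by N shifts it,
    and right translation by U leaves it unchanged, whence local constancy.\<close>
  define y0 where "y0 = (\<lambda>g. \<psi> (SOME n. n \<in> N \<and> (\<exists>u\<in>U. g = n \<otimes> t g \<otimes> u)))"
  have y0: "y0 g = \<psi> n" if "n \<in> N" "u \<in> U" "g = n \<otimes> t g \<otimes> u" "g \<in> carrier G" for g n u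
  proof -
    have "(SOME n. n \<in> N \<and> (\<exists>u\<in>U. g = n \<otimes> t g \<otimes> u)) \<in> N \<and>
       (\<exists>u\<in>U. g = (SOME n. n \<in> N \<and> (\<exists>u\<in>U. g = n \<otimes> t g \<otimes> u)) \<otimes> t g \<otimes> u)"
      using dec[OF that(4)] by (rule someI_ex)
    then obtain u' where u': "u' \<in> U" "(SOME n. n \<in> N \<and> (\<exists>u\<in>U. g = n \<otimes> t g \<otimes> u)) \<in> N"
       "g = (SOME n. n \<in> N \<and> (\<exists>u\<in>U. g = n \<otimes> t g \<otimes> u)) \<otimes> t g \<otimes> u'" by blast
    show ?thesis
      unfolding y0_def
      by (rule wd[OF u'(2) that(1) u'(1) that(2) t_carrier[OF that(4)]])
        (use u'(3) that(3) in metis)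
  qed
  have y0_range: "y0 g \<in> {0..int p - 1}" if g: "g \<in> carrier G" for g
  proof -
    obtain n u where "n \<in> N" "u \<in> U" "g = n \<otimes> t g \<otimes> u" using dec[OF g] by blast
    then have "y0 g = \<psi> n" "\<psi> n mod int p = \<psi> n" using y0 g H1_invariants_value[OF p \<psi>] by auto
    then show ?thesis using mod_in_residues[of "int p" "\<psi> n"] p by simp
  qed
  have eqv: "y0 (n \<otimes> g \<otimes> u) = (\<psi> n + y0 g) mod int p"
    if "n \<in> N" and g: "g \<in> carrier G" and "u \<in> U" for n g u
  proof -
    have t_eq: "t (n \<otimes> g \<otimes> u) = t g" unfolding t_def D_eq[OF that] ..
    obtain m v where mv: "m \<in> N" "v \<in> U" "g = m \<otimes> t g \<otimes> v" using dec[OF g] by blast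
    have "n \<otimes> g \<otimes> u = n \<otimes> (m \<otimes> t g \<otimes> v) \<otimes> u" using mv(3) by simp
    also have "\<dots> = (n \<otimes> m) \<otimes> t (n \<otimes> g \<otimes> u) \<otimes> (v \<otimes> u)"
      unfolding t_eq using that mv(1,2) t_carrier[OF g] by (simp add: m_assoc)
    finally have "y0 (n \<otimes> g \<otimes> u) = \<psi> (n \<otimes> m)"
      using that mv by (intro y0[of _ "v \<otimes> u"]) auto
    moreover have "y0 g = \<psi> m" using mv that by (intro y0) auto
    ultimately show ?thesis using hom that mv by simp
  qed
  have "\<one> \<in> D n" if "n \<in> N" for n
    unfolding D_def using that by (intro CollectI exI[of _ "inv n"] exI[of _ \<one>]) auto
  then have t1: "t n = \<one>" if "n \<in> N" for n using that by (simp add: t_def)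
  have y0N: "y0 n = \<psi> n" if "n \<in> N" for n
    using that t1[OF that] by (intro y0[of _ \<one>]) auto
  have "continuous_map T (discrete_topology {0..int p - 1}) y0"
  proof (rule continuous_map_discreteI)
    fix g assume "g \<in> topspace T"
    then have g: "g \<in> carrier G" by (simp add: topspace_eq)
    then show "y0 g \<in> {0..int p - 1}" by (rule y0_range)
    let ?V = "{x \<in> topspace T. inv g \<otimes> x \<in> U}"
    show "\<exists>V. openin T V \<and> g \<in> V \<and> V \<subseteq> {x. y0 x = y0 g}"
    proof (intro exI conjI)
      show "openin T ?V"
        using g by (intro openin_continuous_map_preimage[OF continuous_mult_left U(2)]) auto
      show "g \<in> ?V" using g by (simp add: topspace_eq)
      show "?V \<subseteq> {x. y0 x = y0 g}"
      proof clarify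
        fix x assume x: "x \<in> topspace T" "inv g \<otimes> x \<in> U"
        have "\<one> \<otimes> g \<otimes> (inv g \<otimes> x) = x" using x g by (simp add: topspace_eq m_assoc[symmetric])
        then show "y0 x = y0 g"
          using eqv[of \<one> g "inv g \<otimes> x"] x g H1_invariants_one[OF p \<psi>] y0_range[OF g] by simp
      qed
    qed
  qed
  then have "restrict y0 (carrier G) \<in> cochains1 G T (Fp p)"
    using p topspace_eq by (intro cochains1_restrictI)
  from lift_if_equivariant[OF p \<psi> this] obtain c where "is_lift p \<psi> (restrict y0 (carrier G)) c"
    using y0N eqv[of _ _ \<one>] by auto
  then show thesis by (rule that)
qed

end

text \<open>The stabilizer of a clopen neighbourhood under right translation is open by compactness.\<close>

lemma profinite_open_subgroup:
  fixes G (structure)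
  assumes pro: "profinite_group G T" and W: "openin T W" "\<one> \<in> W"
  obtains U where "subgroup U G" "openin T U" "U \<subseteq> W"
proof -
  interpret mult_topological_group G T
    using pro by (simp add: profinite_group_def mult_topological_group_def mult_topological_group_axioms_def)
  have inv_cont: "continuous_map T T (\<lambda>x. inv x)" and comp: "compact_space T" and haus: "Hausdorff_space T"
    and disc: "\<And>A. connectedin T A \<Longrightarrow> \<exists>a. A \<subseteq> {a}"
    using pro by (auto simp: profinite_group_def)
  \<comment> \<open>Connected sets have at most one point, so none joins 1 to the complement of W;
    in a compact Hausdorff space a clopen set then separates the two.\<close>
  have "\<exists>K. closedin T K \<and> openin T K \<and> \<one> \<in> K \<and> K \<subseteq> W"
  proof -
    have 1: "closedin T {\<one>}"
      using haus by (simp add: closedin_Hausdorff_sing_eq topspace_eq)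
    have 2: "closedin T (topspace T - W)" using W by blast
    have "separated_between T {\<one>} (topspace T - W)"
    proof (rule cut_wire_fence_theorem[OF comp haus 1 2])
      fix C assume "connectedin T C"
      then obtain a where "C \<subseteq> {a}" using disc by blast
      then show "disjnt C {\<one>} \<or> disjnt C (topspace T - W)"
        using W by (auto simp: disjnt_iff)
    qed
    then obtain K where "closedin T K" "openin T K" "{\<one>} \<subseteq> K" "topspace T - W \<subseteq> topspace T - K"
      unfolding separated_between by blast
    moreover from this have "K \<subseteq> W" using closedin_subset by blast
    ultimately show ?thesis by blast
  qed
  then obtain K where K: "closedin T K" "openin T K" "\<one> \<in> K" "K \<subseteq> W" by blast
  have KG: "K \<subseteq> carrier G" using openin_subset[OF K(2)] topspace_eq by simp
  define V where "V = {g \<in> carrier G. \<forall>k\<in>K. k \<otimes> g \<in> K}"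
  \<comment> \<open>The complement of the stabilizer is the projection of a closed set along the
    compact factor, hence closed.\<close>
  have "carrier G - V = snd ` {x \<in> topspace (prod_topology T T). fst x \<in> K \<and> (\<lambda>(x, y). x \<otimes> y) x \<in> topspace T - K}"
    using KG unfolding V_def by (force simp: topspace_eq image_iff)
  moreover have "closedin (prod_topology T T)
     ({x \<in> topspace (prod_topology T T). fst x \<in> K} \<inter>
      {x \<in> topspace (prod_topology T T). (\<lambda>(x, y). x \<otimes> y) x \<in> topspace T - K})"
    using K by (intro closedin_Int closedin_continuous_map_preimage[OF continuous_map_fst]
        closedin_continuous_map_preimage[OF continuous_mult]) auto
  then have "closedin (prod_topology T T)
     {x \<in> topspace (prod_topology T T). fst x \<in> K \<and> (\<lambda>(x, y). x \<otimes> y) x \<in> topspace T - K}"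
    by (rule back_subst[of "closedin (prod_topology T T)"]) auto
  ultimately have "closedin T (carrier G - V)"
    using closed_map_snd[OF comp, of T] by (simp add: closed_map_def)
  then have "openin T (topspace T - (carrier G - V))" by blast
  moreover have "topspace T - (carrier G - V) = V" by (auto simp: topspace_eq V_def)
  ultimately have V: "openin T V" by simp
  \<comment> \<open>V is only a submonoid, and intersecting it with its inverse makes it a group. It
    lies in K because 1 is in K and is moved to g by right translation by g.\<close>
  define U where "U = V \<inter> {x \<in> topspace T. inv x \<in> V}"
  show thesis
  proof
    show "openin T U"
      unfolding U_def using V by (intro openin_Int openin_continuous_map_preimage[OF inv_cont])
    show "U \<subseteq> W" using K KG unfolding U_def V_def by (auto dest!: bspec[of K _ \<one>])
    show "subgroup U G"
    proof
      show "U \<subseteq> carrier G" by (auto simp: U_def V_def)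
      show "\<one> \<in> U" using KG by (auto simp: U_def V_def topspace_eq)
      have VV: "x \<otimes> y \<in> V" if "x \<in> V" "y \<in> V" for x y
        using that KG unfolding V_def by (auto simp: m_assoc[symmetric] subset_iff)
      show "x \<otimes> y \<in> U" if "x \<in> U" "y \<in> U" for x y
        using that VV by (auto simp: U_def topspace_eq inv_mult_group)
      show "inv x \<in> U" if "x \<in> U" for x
        using that by (auto simp: U_def topspace_eq)
    qed
  qed
qed

text \<open>Without a lift, \<open>transgression\<close> would be \<open>the_elem\<close> of an
  empty set. The open subgroup comes from \<open>\<psi>\<close> being locally constant at 1 with
  value 0 there.\<close>

lemma (in topological_quotient) lift_exists:
  assumes pro: "profinite_group G T"
    and p: "1 < p" and \<psi>: "\<psi> \<in> H1_invariants G T N (Fp p)"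
  obtains y c where "is_lift p \<psi> y c"
proof -
  have cont: "continuous_map (subtopology T N) (discrete_topology {0..int p - 1}) \<psi>"
    using \<psi> p by (simp add: H1_invariants_iff)
  obtain V where V: "openin (subtopology T N) V" "\<one> \<in> V" "V \<subseteq> {n. \<psi> n = \<psi> \<one>}"
    using continuous_map_discreteE[OF cont, of \<one>] by (auto simp: topspace_eq)
  then obtain W where W: "openin T W" "V = W \<inter> N" unfolding openin_subtopology by blast
  then have "\<one> \<in> W" using V by simp
  then obtain U where U: "subgroup U G" "openin T U" "U \<subseteq> W"
    using profinite_open_subgroup[OF pro W(1)] by blast
  have "\<psi> u = 0" if "u \<in> U \<inter> N" for u
  proof -
    have "u \<in> {n. \<psi> n = \<psi> \<one>}" using that U V W by blast
    then show ?thesis using H1_invariants_one[OF p \<psi>] by simp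
  qed
  from lift_exists_open_subgroup[OF p \<psi> U(1,2) this] show thesis using that by blast
qed

section \<open>The lower p-central filtration\<close>

lemma closed_subgroup_generated_incl: "A \<subseteq> closed_subgroup_generated G T A"
  by (auto simp: closed_subgroup_generated_def)

lemma closed_subgroup_generated_least:
  "subgroup H G \<Longrightarrow> closedin T H \<Longrightarrow> A \<subseteq> H \<Longrightarrow> closed_subgroup_generated G T A \<subseteq> H"
  by (auto simp: closed_subgroup_generated_def)

lemma closed_subgroup_generated_closed_subgroup:
  assumes "group G" "topspace T = carrier G" "A \<subseteq> carrier G"
  shows "subgroup (closed_subgroup_generated G T A) G"
    and "closedin T (closed_subgroup_generated G T A)"
proof -
  interpret group G by fact
  have "carrier G \<in> {H. subgroup H G \<and> closedin T H \<and> A \<subseteq> H}"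
    using assms subgroup_self closedin_topspace[of T] by simp
  then have ne: "{H. subgroup H G \<and> closedin T H \<and> A \<subseteq> H} \<noteq> {}" by blast
  show "subgroup (closed_subgroup_generated G T A) G"
    unfolding closed_subgroup_generated_def using ne by (intro subgroups_Inter) auto
  show "closedin T (closed_subgroup_generated G T A)"
    unfolding closed_subgroup_generated_def using ne by (intro closedin_Inter) auto
qed

lemma commutator_closed:
  assumes "group G" "\<sigma> \<in> carrier G" "\<tau> \<in> carrier G"
  shows "commutator G \<sigma> \<tau> \<in> carrier G"
proof -
  interpret group G by fact
  show ?thesis using assms by (simp add: commutator_def)
qed

lemma lower_p_central_closed_subgroup:
  assumes "group G" "topspace T = carrier G"
  shows "subgroup (lower_p_central G T p n) G \<and> closedin T (lower_p_central G T p n)"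
proof (induction n)
  case 0
  interpret group G by fact
  show ?case using assms subgroup_self closedin_topspace[of T] by simp
next
  case (Suc n)
  interpret group G by fact
  interpret L: subgroup "lower_p_central G T p n" G using Suc by simp
  let ?A = "{\<tau> [^]\<^bsub>G\<^esub> p | \<tau>. \<tau> \<in> lower_p_central G T p n} \<union>
    {commutator G \<sigma> \<tau> | \<sigma> \<tau>. \<sigma> \<in> carrier G \<and> \<tau> \<in> lower_p_central G T p n}"
  have "?A \<subseteq> carrier G" using commutator_closed[OF assms(1)] by auto
  from closed_subgroup_generated_closed_subgroup[OF assms this]
  show ?case using assms subgroup_self closedin_topspace[of T] by simp
qed

lemma lower_p_central_pow:
  assumes "0 < n" "\<tau> \<in> lower_p_central G T p n"
  shows "\<tau> [^]\<^bsub>G\<^esub> p \<in> lower_p_central G T p (Suc n)"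
  using assms closed_subgroup_generated_incl by fastforce

lemma lower_p_central_commutator:
  assumes "0 < n" "\<sigma> \<in> carrier G" "\<tau> \<in> lower_p_central G T p n"
  shows "commutator G \<sigma> \<tau> \<in> lower_p_central G T p (Suc n)"
  using assms closed_subgroup_generated_incl by fastforce

lemma lower_p_central_leastI:
  assumes "subgroup H G" "closedin T H" "0 < n"
    and "\<And>\<tau>. \<tau> \<in> lower_p_central G T p n \<Longrightarrow> \<tau> [^]\<^bsub>G\<^esub> p \<in> H"
    and "\<And>\<sigma> \<tau>. \<sigma> \<in> carrier G \<Longrightarrow> \<tau> \<in> lower_p_central G T p n \<Longrightarrow> commutator G \<sigma> \<tau> \<in> H"
  shows "lower_p_central G T p (Suc n) \<subseteq> H"
proof -
  have "closed_subgroup_generated G T ({\<tau> [^]\<^bsub>G\<^esub> p | \<tau>. \<tau> \<in> lower_p_central G T p n} \<union>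
      {commutator G \<sigma> \<tau> | \<sigma> \<tau>. \<sigma> \<in> carrier G \<and> \<tau> \<in> lower_p_central G T p n}) \<subseteq> H"
    using assms by (intro closed_subgroup_generated_least) blast+
  then show ?thesis using assms(3) by simp
qed

lemma lower_p_central_1: "lower_p_central G T p (Suc 0) = carrier G"
  by simp

declare lower_p_central.simps(2) [simp del] lower_p_central_1 [simp]

lemma lower_p_central_power:
  assumes "group G" "topspace T = carrier G" "0 < n" "\<tau> \<in> lower_p_central G T p n"
  shows "\<tau> [^]\<^bsub>G\<^esub> (p ^ k) \<in> lower_p_central G T p (n + k)"
proof (induction k)
  case 0
  interpret group G by fact
  interpret L: subgroup "lower_p_central G T p n" G
    using lower_p_central_closed_subgroup[OF assms(1,2)] by simp
  show ?case using assms by simp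
next
  case (Suc k)
  interpret group G by fact
  interpret L: subgroup "lower_p_central G T p n" G
    using lower_p_central_closed_subgroup[OF assms(1,2)] by simp
  have "(\<tau> [^]\<^bsub>G\<^esub> (p ^ k)) [^]\<^bsub>G\<^esub> p \<in> lower_p_central G T p (Suc (n + k))"
    using assms Suc by (intro lower_p_central_pow) auto
  then show ?case using assms by (simp add: nat_pow_pow mult.commute)
qed

text \<open>The preimage of a closed subgroup under a continuous homomorphism is a closed subgroup,
  and by induction it contains the generators. Applied to conjugations this gives normality; applied
  to \<open>\<rho>\<close> it bounds the image of S^(n,p).\<close>

lemma lower_p_central_hom:
  assumes G: "group G" "topspace T = carrier G" and H: "group H" "topspace TH = carrier H"
    and f: "f \<in> hom G H" and cont: "continuous_map T TH f"
  shows "f ` lower_p_central G T p n \<subseteq> lower_p_central H TH p n"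
proof (induction n)
  case 0
  then show ?case using f by (auto simp: hom_def)
next
  case (Suc n)
  interpret G: group G by fact
  interpret H: group H by fact
  interpret group_hom G H f using f by unfold_locales
  interpret LG: subgroup "lower_p_central G T p n" G
    using lower_p_central_closed_subgroup[OF G] by simp
  interpret LH: subgroup "lower_p_central H TH p (Suc n)" H
    using lower_p_central_closed_subgroup[OF H] by blast
  show ?case
  proof (cases "n = 0")
    case False
    have "lower_p_central G T p (Suc n) \<subseteq> {x \<in> topspace T. f x \<in> lower_p_central H TH p (Suc n)}"
    proof (rule lower_p_central_leastI)
      show "subgroup {x \<in> topspace T. f x \<in> lower_p_central H TH p (Suc n)} G"
        using G by unfold_locales auto
      show "closedin T {x \<in> topspace T. f x \<in> lower_p_central H TH p (Suc n)}"
        using lower_p_central_closed_subgroup[OF H]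
        by (intro closedin_continuous_map_preimage[OF cont]) blast
      show "\<tau> [^]\<^bsub>G\<^esub> p \<in> {x \<in> topspace T. f x \<in> lower_p_central H TH p (Suc n)}"
        if "\<tau> \<in> lower_p_central G T p n" for \<tau>
        using that G Suc False lower_p_central_pow[of n "f \<tau>" H TH p]
        by (auto simp: hom_nat_pow)
      show "commutator G \<sigma> \<tau> \<in> {x \<in> topspace T. f x \<in> lower_p_central H TH p (Suc n)}"
        if "\<sigma> \<in> carrier G" "\<tau> \<in> lower_p_central G T p n" for \<sigma> \<tau>
      proof -
        have "f (commutator G \<sigma> \<tau>) = commutator H (f \<sigma>) (f \<tau>)"
          using that by (simp add: commutator_def)
        also have "\<dots> \<in> lower_p_central H TH p (Suc n)"
          using that Suc False by (intro lower_p_central_commutator) auto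
        finally show ?thesis
          using that G commutator_closed[OF G(1)] by simp
      qed
    qed (use False in auto)
    then show ?thesis by blast
  qed (auto)
qed

section \<open>Normality of the filtration, and characters that vanish on it\<close>

context mult_topological_group
begin

lemma lower_p_central_normal: "lower_p_central G T p n \<lhd> G"
proof (rule normal_invI)
  show "subgroup (lower_p_central G T p n) G"
    using lower_p_central_closed_subgroup[OF is_group topspace_eq] by simp
  fix g h assume g: "g \<in> carrier G" and h: "h \<in> lower_p_central G T p n"
  have "(\<lambda>x. g \<otimes> x \<otimes> inv g) \<in> hom G G"
    using g by (auto simp: hom_def m_assoc inv_mult_cancel)
  from lower_p_central_hom[OF is_group topspace_eq is_group topspace_eq this
      continuous_conjugation[OF g]] h
  show "g \<otimes> h \<otimes> inv g \<in> lower_p_central G T p n" by blast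
qed

lemma lower_p_central_Suc_subset:
  "lower_p_central G T p (Suc n) \<subseteq> lower_p_central G T p n"
proof (cases "n = 0")
  case False
  interpret L: normal "lower_p_central G T p n" G by (rule lower_p_central_normal)
  show ?thesis
  proof (rule lower_p_central_leastI)
    show "subgroup (lower_p_central G T p n) G" by (rule L.subgroup_axioms)
    show "closedin T (lower_p_central G T p n)"
      using lower_p_central_closed_subgroup[OF is_group topspace_eq] by simp
    have "\<tau> [^] k \<in> lower_p_central G T p n" if "\<tau> \<in> lower_p_central G T p n" for \<tau> and k :: nat
      using that by (induction k) auto
    then show "\<tau> [^] p \<in> lower_p_central G T p n" if "\<tau> \<in> lower_p_central G T p n" for \<tau>
      using that .
    show "commutator G \<sigma> \<tau> \<in> lower_p_central G T p n"
      if "\<sigma> \<in> carrier G" "\<tau> \<in> lower_p_central G T p n" for \<sigma> \<tau>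
      unfolding commutator_def using that L.inv_op_closed1[of \<sigma> "inv \<tau>"] by simp
  qed (use False in auto)
qed auto

lemma lower_p_central_antimono:
  "m \<le> n \<Longrightarrow> lower_p_central G T p n \<subseteq> lower_p_central G T p m"
  by (rule lift_Suc_antimono_le[where f = "lower_p_central G T p"]) (rule lower_p_central_Suc_subset)

text \<open>The target is abelian of exponent p, so the kernel is a closed subgroup containing all
  p-th powers and commutators. This is where n >= 2 enters.\<close>

lemma hom_Fp_trivial:
  assumes p: "1 < p" and y: "y \<in> cochains1 G T (Fp p)"
    and hom: "\<And>g h. g \<in> carrier G \<Longrightarrow> h \<in> carrier G \<Longrightarrow> y (g \<otimes> h) = (y g + y h) mod int p"
    and n: "2 \<le> n" and g: "g \<in> lower_p_central G T p n"
  shows "y g = 0"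
proof -
  have val: "y g mod int p = y g" if "g \<in> carrier G" for g
    using cochains1_value[OF y that] by simp
  have "y \<one> mod int p = (y \<one> + y \<one>) mod int p"
    using hom[of \<one> \<one>] val[OF one_closed] by (metis one_closed r_one)
  then have "int p dvd y \<one>" by (simp only: mod_eq_dvd_iff) simp
  then have y1: "y \<one> = 0" using val[OF one_closed] by simp
  have yinv: "y (inv g) = (- y g) mod int p" if "g \<in> carrier G" for g
  proof -
    have "(y g + y (inv g)) mod int p = 0" using hom[of g "inv g"] that y1 by simp
    then have "int p dvd y (inv g) - (- y g)" by (simp add: mod_eq_0_iff_dvd add.commute)
    then show ?thesis using val[of "inv g"] that by (metis inv_closed mod_eq_dvd_iff)
  qed
  have pow: "y (g [^] k) = (int k * y g) mod int p" if "g \<in> carrier G" for g and k :: nat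
  proof (induction k)
    case (Suc k)
    then show ?case using that by (simp add: hom mod_simps algebra_simps)
  qed (simp add: y1)
  let ?K = "{g \<in> topspace T. y g \<in> {0}}"
  have "lower_p_central G T p (Suc 1) \<subseteq> ?K"
  proof (rule lower_p_central_leastI)
    show "subgroup ?K G"
      by unfold_locales (auto simp: topspace_eq hom y1 yinv)
    have "continuous_map T (discrete_topology {0..int p - 1}) y"
      using y p topspace_eq by (simp add: cochains1_iff)
    then show "closedin T ?K" using p by (intro closedin_continuous_map_preimage) auto
    show "\<tau> [^] p \<in> ?K" if "\<tau> \<in> lower_p_central G T p 1" for \<tau>
      using that by (simp add: topspace_eq pow)
    show "commutator G \<sigma> \<tau> \<in> ?K"
      if "\<sigma> \<in> carrier G" "\<tau> \<in> lower_p_central G T p 1" for \<sigma> \<tau>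
      using that by (simp add: topspace_eq commutator_def hom yinv mod_simps)
  qed auto
  then show ?thesis using g lower_p_central_antimono[OF n] by (auto simp: numeral_2_eq_2)
qed

end

section \<open>The lower central series\<close>

context group
begin

text \<open>The index is shifted: this is the usual gamma_(n+1), taken without closure. Weights of
  iterated commutators are thereby handled by pure group theory and compared with the closed
  filtration only at the end.\<close>

primrec lower_central :: "nat \<Rightarrow> 'a set" where
  "lower_central 0 = carrier G"
| "lower_central (Suc n) =
     generate G {commutator G g x | g x. g \<in> carrier G \<and> x \<in> lower_central n}"

declare lower_central.simps(2) [simp del]

lemma inv_commutes:
  assumes "c \<in> carrier G" "y \<in> carrier G" "c \<otimes> y = y \<otimes> c"
  shows "inv c \<otimes> y = y \<otimes> inv c"
proof -
  have "inv c \<otimes> y = inv c \<otimes> (y \<otimes> c) \<otimes> inv c" using assms(1,2) by (simp add: m_assoc)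
  also have "\<dots> = y \<otimes> inv c"
    unfolding assms(3)[symmetric] using assms(1,2) by (simp add: inv_mult_cancel)
  finally show ?thesis .
qed

lemma conj_commutator:
  assumes "g \<in> carrier G" "x \<in> carrier G" "y \<in> carrier G"
  shows "y \<otimes> commutator G g x \<otimes> inv y = commutator G (y \<otimes> g \<otimes> inv y) (y \<otimes> x \<otimes> inv y)"
  using assms by (simp add: commutator_def m_assoc inv_mult_cancel inv_mult_group)

lemma lower_central_normal: "lower_central n \<lhd> G"
proof (induction n)
  case (Suc n)
  interpret L: normal "lower_central n" G by fact
  show ?case
    unfolding lower_central.simps
  proof (rule normal_generateI)
    show "{commutator G g x | g x. g \<in> carrier G \<and> x \<in> lower_central n} \<subseteq> carrier G"
      using commutator_closed[OF is_group] by auto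
    fix h y assume "h \<in> {commutator G g x | g x. g \<in> carrier G \<and> x \<in> lower_central n}"
      and y: "y \<in> carrier G"
    then obtain g x where gx: "h = commutator G g x" "g \<in> carrier G" "x \<in> lower_central n" by blast
    then have "y \<otimes> h \<otimes> inv y = commutator G (y \<otimes> g \<otimes> inv y) (y \<otimes> x \<otimes> inv y)"
      using y by (simp add: conj_commutator)
    then show "y \<otimes> h \<otimes> inv y \<in> {commutator G g x | g x. g \<in> carrier G \<and> x \<in> lower_central n}"
      using gx y L.inv_op_closed2 by blast
  qed
qed (simp add: normal_self)

lemma commutator_in_lower_central:
  "g \<in> carrier G \<Longrightarrow> x \<in> lower_central n \<Longrightarrow> commutator G g x \<in> lower_central (Suc n)"
  by (auto simp: lower_central.simps(2) intro: generate.incl)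

text \<open>Trades membership of commutators for commuting in the quotient, where commuting with a
  fixed element is a condition that cuts out a subgroup.\<close>

lemma commutator_in_normal_iff:
  assumes "N \<lhd> G" "x \<in> carrier G" "y \<in> carrier G"
  shows "commutator G x y \<in> N \<longleftrightarrow>
    (N #> x) \<otimes>\<^bsub>G Mod N\<^esub> (N #> y) = (N #> y) \<otimes>\<^bsub>G Mod N\<^esub> (N #> x)"
proof -
  interpret N: normal N G by fact
  have eq: "x \<otimes> y = y \<otimes> x \<otimes> commutator G x y"
    using assms by (simp add: commutator_def m_assoc inv_mult_cancel)
  have c: "commutator G x y \<in> carrier G" using assms commutator_closed[OF is_group] by simp
  have "(N #> x) \<otimes>\<^bsub>G Mod N\<^esub> (N #> y) = N #> (x \<otimes> y)"
    "(N #> y) \<otimes>\<^bsub>G Mod N\<^esub> (N #> x) = N #> (y \<otimes> x)"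
    using assms by (simp_all add: N.rcos_sum)
  moreover have "N #> (x \<otimes> y) = N #> (y \<otimes> x) \<longleftrightarrow> commutator G x y \<in> N"
  proof
    assume "N #> (x \<otimes> y) = N #> (y \<otimes> x)"
    then have "x \<otimes> y \<in> N #> (y \<otimes> x)"
      using rcos_self[of "x \<otimes> y", OF _ N.subgroup_axioms] assms by simp
    then obtain n where n: "n \<in> N" "x \<otimes> y = n \<otimes> (y \<otimes> x)" by (auto simp: r_coset_def)
    have "commutator G x y = inv (y \<otimes> x) \<otimes> (x \<otimes> y)"
      using assms by (simp add: commutator_def m_assoc inv_mult_group)
    then show "commutator G x y \<in> N"
      using n assms N.inv_op_closed1[of "y \<otimes> x" n] by (simp add: m_assoc)
  next
    assume "commutator G x y \<in> N"
    then have "y \<otimes> x \<otimes> commutator G x y \<otimes> inv (y \<otimes> x) \<in> N"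
      using assms N.inv_op_closed2[of "y \<otimes> x"] by simp
    moreover have "x \<otimes> y = (y \<otimes> x \<otimes> commutator G x y \<otimes> inv (y \<otimes> x)) \<otimes> (y \<otimes> x)"
      using assms c eq by (simp add: m_assoc)
    ultimately have "x \<otimes> y \<in> N #> (y \<otimes> x)" by (auto simp: r_coset_def)
    then show "N #> (x \<otimes> y) = N #> (y \<otimes> x)"
      using assms N.subgroup_axioms by (metis m_closed repr_independence)
  qed
  ultimately show ?thesis by simp
qed

text \<open>A form of the three subgroups lemma: conjugation by \<open>y\<close> maps \<open>g\<close> to \<open>g t\<close> and \<open>x\<close> to
  \<open>x z\<close>.\<close>

lemma commutator_commutes:
  assumes [simp]: "g \<in> carrier G" "x \<in> carrier G" "y \<in> carrier G"
    and z: "\<And>u. u \<in> carrier G \<Longrightarrow> u \<otimes> commutator G x y = commutator G x y \<otimes> u"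
    and t: "x \<otimes> commutator G g y = commutator G g y \<otimes> x"
    and t': "(inv g \<otimes> inv x \<otimes> g) \<otimes> commutator G g y = commutator G g y \<otimes> (inv g \<otimes> inv x \<otimes> g)"
  shows "commutator G g x \<otimes> y = y \<otimes> commutator G g x"
proof -
  define t z where "t = commutator G g y" and "z = commutator G x y"
  have [simp]: "t \<in> carrier G" "z \<in> carrier G"
    by (simp_all add: t_def z_def commutator_closed[OF is_group])
  have gt: "inv y \<otimes> g \<otimes> y = g \<otimes> t" and xz: "inv y \<otimes> x \<otimes> y = x \<otimes> z"
    by (simp_all add: t_def z_def commutator_def m_assoc inv_mult_cancel)
  have "inv y \<otimes> commutator G g x \<otimes> y = commutator G (g \<otimes> t) (x \<otimes> z)"
    using conj_commutator[of g x "inv y"] gt xz by simp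
  also have "\<dots> = inv t \<otimes> inv g \<otimes> (inv z \<otimes> (inv x \<otimes> g \<otimes> t \<otimes> x \<otimes> z))"
    by (simp add: commutator_def m_assoc inv_mult_group)
  \<comment> \<open>Here z is central and cancels against its inverse; next t is moved past g^-1
    x^-1 g and cancels as well.\<close>
  also have "inv z \<otimes> (inv x \<otimes> g \<otimes> t \<otimes> x \<otimes> z) = inv x \<otimes> g \<otimes> t \<otimes> x"
    using z[of "inv x \<otimes> g \<otimes> t \<otimes> x", folded z_def] by (simp add: inv_mult_cancel)
  also have "inv t \<otimes> inv g \<otimes> (inv x \<otimes> g \<otimes> t \<otimes> x) = inv t \<otimes> ((inv g \<otimes> inv x \<otimes> g) \<otimes> t) \<otimes> x"
    by (simp add: m_assoc)
  also have "\<dots> = (inv g \<otimes> inv x \<otimes> g) \<otimes> x"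
    unfolding t'[folded t_def] by (simp add: inv_mult_cancel)
  also have "\<dots> = commutator G g x" by (simp add: commutator_def)
  finally have "inv y \<otimes> commutator G g x \<otimes> y = commutator G g x" .
  then have "y \<otimes> (inv y \<otimes> commutator G g x \<otimes> y) = y \<otimes> commutator G g x" by simp
  then show ?thesis by (simp add: m_assoc inv_mult_cancel commutator_closed[OF is_group])
qed

text \<open>The elements commuting with y modulo the target term form a subgroup, so only generators
  [g,x] matter. The induction hypothesis is used for [x,y] and, with b+1 in place of b, for
  commutators with [g,y]; hence b is arbitrary.\<close>

lemma commutator_lower_central:
  assumes "x \<in> lower_central a" "y \<in> lower_central b"
  shows "commutator G x y \<in> lower_central (Suc (a + b))"
  using assms
proof (induction a arbitrary: b x y)
  case 0
  then show ?case using commutator_in_lower_central by simp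
next
  case (Suc a)
  let ?N = "lower_central (Suc (Suc (a + b)))"
  let ?Q = "G Mod ?N"
  interpret N: normal ?N G by (rule lower_central_normal)
  interpret A: normal "lower_central a" G by (rule lower_central_normal)
  interpret B: normal "lower_central b" G by (rule lower_central_normal)
  interpret Q: group ?Q by (rule N.factorgroup_is_group)
  define \<pi> where "\<pi> = (\<lambda>g. ?N #> g)"
  have "\<pi> \<in> hom G ?Q" unfolding \<pi>_def by (rule N.r_coset_hom_Mod)
  then interpret \<pi>: group_hom G ?Q \<pi> by unfold_locales
  have iff: "commutator G u v \<in> ?N \<longleftrightarrow> \<pi> u \<otimes>\<^bsub>?Q\<^esub> \<pi> v = \<pi> v \<otimes>\<^bsub>?Q\<^esub> \<pi> u"
    if "u \<in> carrier G" "v \<in> carrier G" for u v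
    unfolding \<pi>_def using commutator_in_normal_iff[OF N.normal_axioms that] .
  have \<pi>_comm: "\<pi> (commutator G u v) = commutator ?Q (\<pi> u) (\<pi> v)"
    if "u \<in> carrier G" "v \<in> carrier G" for u v
    using that unfolding commutator_def by (simp del: mult_FactGroup)
  have y: "y \<in> carrier G" using Suc.prems by simp
  let ?C = "{c \<in> carrier G. \<pi> c \<otimes>\<^bsub>?Q\<^esub> \<pi> y = \<pi> y \<otimes>\<^bsub>?Q\<^esub> \<pi> c}"
  have "lower_central (Suc a) \<subseteq> ?C"
    unfolding lower_central.simps(2)[of a]
  proof (rule generate_subgroup_incl)
    show "subgroup ?C G"
    proof
      show "inv c \<in> ?C" if "c \<in> ?C" for c
      proof -
        have "\<pi> c \<otimes>\<^bsub>?Q\<^esub> \<pi> y = \<pi> y \<otimes>\<^bsub>?Q\<^esub> \<pi> c" using that by blast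
        then have "inv\<^bsub>?Q\<^esub> \<pi> c \<otimes>\<^bsub>?Q\<^esub> \<pi> y = \<pi> y \<otimes>\<^bsub>?Q\<^esub> inv\<^bsub>?Q\<^esub> \<pi> c"
          using that y by (intro Q.inv_commutes) (auto simp del: mult_FactGroup carrier_FactGroup)
        then show ?thesis using that y by (simp del: mult_FactGroup)
      qed
      show "c \<otimes> d \<in> ?C" if "c \<in> ?C" "d \<in> ?C" for c d
        using that y by (simp del: mult_FactGroup add: Q.m_assoc)
          (simp del: mult_FactGroup add: Q.m_assoc[symmetric])
    qed (use y in \<open>auto simp del: mult_FactGroup one_FactGroup\<close>)
    show "{commutator G g x | g x. g \<in> carrier G \<and> x \<in> lower_central a} \<subseteq> ?C"
    proof (rule subsetI, elim CollectE exE conjE)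
      fix h g x assume h: "h = commutator G g x" and g: "g \<in> carrier G" and x: "x \<in> lower_central a"
      have xc: "x \<in> carrier G" using x by simp
      have xy: "commutator G x y \<in> lower_central (Suc (a + b))"
        using Suc.IH[OF x Suc.prems(2)] .
      have gy: "commutator G g y \<in> lower_central (Suc b)"
        using commutator_in_lower_central g Suc.prems by simp
      have t: "\<pi> u \<otimes>\<^bsub>?Q\<^esub> \<pi> (commutator G g y) = \<pi> (commutator G g y) \<otimes>\<^bsub>?Q\<^esub> \<pi> u"
        if "u \<in> lower_central a" for u
        using Suc.IH[OF that gy] that g y commutator_closed[OF is_group]
        by (subst iff[symmetric]) auto
      have z: "\<pi> u \<otimes>\<^bsub>?Q\<^esub> \<pi> (commutator G x y) = \<pi> (commutator G x y) \<otimes>\<^bsub>?Q\<^esub> \<pi> u"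
        if "u \<in> carrier G" for u
        using commutator_in_lower_central[OF that xy] that xc y commutator_closed[OF is_group]
        by (subst iff[symmetric]) auto
      have "\<pi> (commutator G g x) \<otimes>\<^bsub>?Q\<^esub> \<pi> y = \<pi> y \<otimes>\<^bsub>?Q\<^esub> \<pi> (commutator G g x)"
        unfolding \<pi>_comm[OF g xc]
      proof (rule Q.commutator_commutes)
        fix u assume "u \<in> carrier ?Q"
        then obtain v where "v \<in> carrier G" "u = \<pi> v" by (auto simp: \<pi>_def FactGroup_def RCOSETS_def)
        then show "u \<otimes>\<^bsub>?Q\<^esub> commutator ?Q (\<pi> x) (\<pi> y) =
            commutator ?Q (\<pi> x) (\<pi> y) \<otimes>\<^bsub>?Q\<^esub> u"
          using z xc y by (simp only: \<pi>_comm)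
      next
        show "\<pi> x \<otimes>\<^bsub>?Q\<^esub> commutator ?Q (\<pi> g) (\<pi> y) =
            commutator ?Q (\<pi> g) (\<pi> y) \<otimes>\<^bsub>?Q\<^esub> \<pi> x"
          using t[OF x] g y by (simp only: \<pi>_comm)
        have "inv g \<otimes> inv x \<otimes> g \<in> lower_central a" using A.inv_op_closed1 g x by simp
        from t[OF this] show "inv\<^bsub>?Q\<^esub> \<pi> g \<otimes>\<^bsub>?Q\<^esub> inv\<^bsub>?Q\<^esub> \<pi> x \<otimes>\<^bsub>?Q\<^esub> \<pi> g
             \<otimes>\<^bsub>?Q\<^esub> commutator ?Q (\<pi> g) (\<pi> y) =
            commutator ?Q (\<pi> g) (\<pi> y) \<otimes>\<^bsub>?Q\<^esub>
            (inv\<^bsub>?Q\<^esub> \<pi> g \<otimes>\<^bsub>?Q\<^esub> inv\<^bsub>?Q\<^esub> \<pi> x \<otimes>\<^bsub>?Q\<^esub> \<pi> g)"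
          using g xc y by (simp del: mult_FactGroup add: \<pi>_comm)
      qed (use g xc y in \<open>auto simp del: carrier_FactGroup\<close>)
      then show "h \<in> ?C"
        unfolding h using commutator_closed[OF is_group g xc] by simp
    qed
  qed
  with Suc.prems have "x \<in> ?C" by blast
  then show ?case using iff[of x y] y by simp
qed

lemma lower_central_subset_lower_p_central:
  assumes "topspace T = carrier G"
  shows "lower_central n \<subseteq> lower_p_central G T p (Suc n)"
proof (induction n)
  case (Suc n)
  have sub: "subgroup (lower_p_central G T p (Suc (Suc n))) G"
    using lower_p_central_closed_subgroup[OF is_group assms] by blast
  show ?case
    unfolding lower_central.simps
  proof (rule generate_subgroup_incl[OF _ sub])
    show "{commutator G g x | g x. g \<in> carrier G \<and> x \<in> lower_central n} \<subseteq> lower_p_central G T p (Suc (Suc n))"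
    proof clarify
      fix g x assume "g \<in> carrier G" "x \<in> lower_central n"
      then show "commutator G g x \<in> lower_p_central G T p (Suc (Suc n))"
        using Suc by (intro lower_p_central_commutator) auto
    qed
  qed
qed simp

lemma lyndon_tau_lower_central:
  assumes "range \<iota> \<subseteq> carrier G" "w \<noteq> []"
  shows "lyndon_tau G \<iota> w \<in> lower_central (length w - 1)"
  using assms(2)
proof (induction "length w" arbitrary: w rule: less_induct)
  case less
  show ?case
  proof (cases "length w = 1")
    case True
    then show ?thesis using less.prems assms(1) by (subst lyndon_tau.simps) auto
  next
    case False
    then have w: "2 \<le> length w" using less.prems by (cases w) (auto simp: Suc_le_eq)
    let ?i = "std_split w"
    have i: "0 < ?i" "?i < length w" using std_split_bounds[OF w] by auto
    have "lyndon_tau G \<iota> (take ?i w) \<in> lower_central (length (take ?i w) - 1)"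
      "lyndon_tau G \<iota> (drop ?i w) \<in> lower_central (length (drop ?i w) - 1)"
      using i less.prems by (intro less.hyps; simp)+
    then have "commutator G (lyndon_tau G \<iota> (take ?i w)) (lyndon_tau G \<iota> (drop ?i w)) \<in>
        lower_central (Suc (length (take ?i w) - 1 + (length (drop ?i w) - 1)))"
      by (rule commutator_lower_central)
    \<comment> \<open>With the shifted index a word of length a sits at a - 1, and the commutator
      adds the one that is missing.\<close>
    moreover have "Suc (length (take ?i w) - 1 + (length (drop ?i w) - 1)) = length w - 1"
      using i by simp
    ultimately have "commutator G (lyndon_tau G \<iota> (take ?i w)) (lyndon_tau G \<iota> (drop ?i w)) \<in>
        lower_central (length w - 1)" by (simp only:)
    then show ?thesis
      using False less.prems by (subst lyndon_tau.simps) simp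
  qed
qed

lemma lyndon_tau_closed:
  assumes "range \<iota> \<subseteq> carrier G" "w \<noteq> []"
  shows "lyndon_tau G \<iota> w \<in> carrier G"
  using lyndon_tau_lower_central[OF assms] normal_imp_subgroup[OF lower_central_normal]
  by (meson subgroup.mem_carrier)

text \<open>The weight n splits as |w| from the iterated commutator and n - |w| from taking p-th
  powers.\<close>

lemma lyndon_sigma_in_lower_p_central:
  assumes "topspace T = carrier G" "range \<iota> \<subseteq> carrier G" "w \<noteq> []" "length w \<le> n"
  shows "lyndon_sigma G \<iota> p n w \<in> lower_p_central G T p n"
proof -
  have "lyndon_tau G \<iota> w \<in> lower_p_central G T p (Suc (length w - 1))"
    using lyndon_tau_lower_central[OF assms(2,3)] lower_central_subset_lower_p_central[OF assms(1)]
    by blast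
  then have "lyndon_tau G \<iota> w \<in> lower_p_central G T p (length w)" using assms by simp
  from lower_p_central_power[OF is_group assms(1) _ this, of "n - length w"]
  show ?thesis using assms by (simp add: lyndon_sigma_def)
qed

end

section \<open>Unitriangular matrices over \<open>\<int>/p\<^bsup>n-s+1\<^esup>\<close>\<close>

lemma mod_sum_mult_cong:
  fixes f :: "'i \<Rightarrow> int"
  assumes "\<And>i. i \<in> A \<Longrightarrow> f i mod m = f' i mod m" "\<And>i. i \<in> A \<Longrightarrow> g i mod m = g' i mod m"
  shows "(\<Sum>i\<in>A. f i * g i) mod m = (\<Sum>i\<in>A. f' i * g' i) mod m"
proof -
  have "(\<Sum>i\<in>A. (f i * g i) mod m) = (\<Sum>i\<in>A. (f' i * g' i) mod m)"
    using assms by (intro sum.cong refl mod_mult_cong)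
  then show ?thesis by (metis mod_sum_eq)
qed

locale unipotent =
  fixes p n s :: nat
  assumes p: "1 < p" and s: "0 < s" "s \<le> n"
begin

declare One_nat_def [simp del]

abbreviation "N \<equiv> n - s + 1"
abbreviation "m \<equiv> int p ^ N"
abbreviation "U \<equiv> UU p n s"
abbreviation mult_U (infixl "\<cdot>" 70) where "M \<cdot> P \<equiv> M \<otimes>\<^bsub>U\<^esub> P"

lemma m_gt_1: "1 < m"
  using p by (simp add: one_less_power)

lemma carrier_iff:
  "M \<in> carrier U \<longleftrightarrow> M \<in> extensional ({..s} \<times> {..s}) \<and>
     (\<forall>i\<le>s. \<forall>j\<le>s. M (i, j) \<in> {0..m - 1}) \<and>
     (\<forall>i\<le>s. M (i, i) = 1) \<and> (\<forall>i\<le>s. \<forall>j<i. M (i, j) = 0)"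
  by (auto simp: unitriangular_def residue_ring_simps PiE_def Pi_iff)

lemma entry_mod: "M \<in> carrier U \<Longrightarrow> i \<le> s \<Longrightarrow> j \<le> s \<Longrightarrow> M (i, j) mod m = M (i, j)"
  by (auto simp: carrier_iff)

lemma matrix_eqI:
  assumes "M \<in> carrier U" "P \<in> carrier U"
    and "\<And>i j. i \<le> s \<Longrightarrow> j \<le> s \<Longrightarrow> M (i, j) mod m = P (i, j) mod m"
  shows "M = P"
proof (rule extensionalityI[of _ "{..s} \<times> {..s}"])
  fix x assume "x \<in> {..s} \<times> {..s}"
  then show "M x = P x" using assms entry_mod by (cases x) auto
qed (use assms in \<open>simp_all add: carrier_iff\<close>)

lemma mult_entry:
  assumes "M \<in> carrier U" "P \<in> carrier U" "i \<le> s" "k \<le> s"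
  shows "(M \<cdot> P) (i, k) = (\<Sum>j\<le>s. M (i, j) * P (j, k)) mod m"
proof -
  have "(M \<cdot> P) (i, k) = (\<Sum>j\<le>s. (M (i, j) * P (j, k)) mod m) mod m"
    using assms m_gt_1
    by (simp add: unitriangular_def residue_ring_simps residue_ring_finsum)
  then show ?thesis by (simp add: mod_sum_eq)
qed

lemma one_entry: "i \<le> s \<Longrightarrow> j \<le> s \<Longrightarrow> \<one>\<^bsub>U\<^esub> (i, j) = (if i = j then 1 else 0)"
  by (simp add: unitriangular_def residue_ring_simps)

lemma one_closed: "\<one>\<^bsub>U\<^esub> \<in> carrier U"
  using m_gt_1 unfolding carrier_iff
  by (use p in \<open>auto simp: one_entry\<close>) (simp add: unitriangular_def)

lemma mult_closed:
  assumes "M \<in> carrier U" "P \<in> carrier U"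
  shows "M \<cdot> P \<in> carrier U"
proof -
  have low: "(M \<cdot> P) (i, k) = P (i, k)" if "i \<le> s" "k \<le> i" for i k
  proof -
    have "(\<Sum>j\<le>s. M (i, j) * P (j, k)) = (\<Sum>j\<le>s. if j = i then P (i, k) else 0)"
    proof (rule sum.cong)
      fix j assume "j \<in> {..s}"
      then show "M (i, j) * P (j, k) = (if j = i then P (i, k) else 0)"
        using assms that by (cases "j < i"; cases "j = i") (auto simp: carrier_iff)
    qed simp
    then have "(\<Sum>j\<le>s. M (i, j) * P (j, k)) = P (i, k)" using that by simp
    then show ?thesis using that assms entry_mod[of P i k] by (simp add: mult_entry)
  qed
  have "(M \<cdot> P) (i, k) \<in> {0..m - 1}" if "i \<le> s" "k \<le> s" for i k
    using that assms mod_in_residues[OF m_gt_1] by (simp only: mult_entry)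
  moreover have "M \<cdot> P \<in> extensional ({..s} \<times> {..s})"
    by (simp add: unitriangular_def)
  ultimately show ?thesis
    unfolding carrier_iff using low assms by (simp add: carrier_iff)
qed

text \<open>Only a monoid at this stage: inverses are found below as powers, once a filtration step
  is known to be trivial.\<close>

sublocale U: monoid U
proof
  fix M P Q assume [simp]: "M \<in> carrier U" "P \<in> carrier U" "Q \<in> carrier U"
  show "M \<cdot> P \<cdot> Q = M \<cdot> (P \<cdot> Q)"
  proof (rule matrix_eqI)
    fix i k assume ik: "i \<le> s" "k \<le> s"
    have "(M \<cdot> P \<cdot> Q) (i, k) mod m = (\<Sum>j\<le>s. (M \<cdot> P) (i, j) * Q (j, k)) mod m"
      using ik by (simp add: mult_entry mult_closed)
    also have "\<dots> = (\<Sum>j\<le>s. (\<Sum>l\<le>s. M (i, l) * P (l, j)) * Q (j, k)) mod m"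
      using ik by (intro mod_sum_mult_cong) (simp_all add: mult_entry)
    also have "(\<Sum>j\<le>s. (\<Sum>l\<le>s. M (i, l) * P (l, j)) * Q (j, k)) =
        (\<Sum>l\<le>s. M (i, l) * (\<Sum>j\<le>s. P (l, j) * Q (j, k)))"
      unfolding sum_distrib_left sum_distrib_right
      by (subst sum.swap) (simp add: mult.assoc)
    also have "\<dots> mod m = (\<Sum>l\<le>s. M (i, l) * (P \<cdot> Q) (l, k)) mod m"
      using ik by (intro mod_sum_mult_cong) (simp_all add: mult_entry)
    also have "\<dots> = (M \<cdot> (P \<cdot> Q)) (i, k) mod m"
      using ik by (simp add: mult_entry mult_closed)
    finally show "(M \<cdot> P \<cdot> Q) (i, k) mod m = (M \<cdot> (P \<cdot> Q)) (i, k) mod m" .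
  qed (simp_all add: mult_closed)
next
  fix M assume [simp]: "M \<in> carrier U"
  show "\<one>\<^bsub>U\<^esub> \<cdot> M = M"
  proof (rule matrix_eqI)
    fix i k assume ik: "i \<le> s" "k \<le> s"
    have "(\<Sum>j\<le>s. \<one>\<^bsub>U\<^esub> (i, j) * M (j, k)) = (\<Sum>j\<le>s. if j = i then M (i, k) else 0)"
      using ik by (intro sum.cong) (auto simp: one_entry)
    then show "(\<one>\<^bsub>U\<^esub> \<cdot> M) (i, k) mod m = M (i, k) mod m"
      using ik by (simp add: mult_entry one_closed)
  qed (simp_all add: mult_closed one_closed)
  show "M \<cdot> \<one>\<^bsub>U\<^esub> = M"
  proof (rule matrix_eqI)
    fix i k assume ik: "i \<le> s" "k \<le> s"
    have "(\<Sum>j\<le>s. M (i, j) * \<one>\<^bsub>U\<^esub> (j, k)) = (\<Sum>j\<le>s. if j = k then M (i, k) else 0)"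
      using ik by (intro sum.cong) (auto simp: one_entry)
    then show "(M \<cdot> \<one>\<^bsub>U\<^esub>) (i, k) mod m = M (i, k) mod m"
      using ik by (simp add: mult_entry one_closed)
  qed (simp_all add: mult_closed one_closed)
qed (simp_all add: mult_closed one_closed)

text \<open>\<open>J k\<close> bounds the \<open>p\<close>-adic valuation at distance \<open>d > 0\<close> above the diagonal from below by
  \<open>k - d\<close> (truncated).  Since multiplication by \<open>p\<close> and by \<open>J 1\<close> both raise \<open>k\<close>, the groups
  \<open>I + J k\<close> contain the lower \<open>p\<close>-central filtration.\<close>

definition expo :: "nat \<Rightarrow> nat \<Rightarrow> nat \<Rightarrow> nat" where
  "expo k i j = (if i < j then min (k - (j - i)) N else N)"

definition J :: "nat \<Rightarrow> (nat \<Rightarrow> nat \<Rightarrow> int) \<Rightarrow> bool" where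
  "J k A \<longleftrightarrow> (\<forall>i\<le>s. \<forall>j\<le>s. int p ^ expo k i j dvd A i j)"

definition mm :: "(nat \<Rightarrow> nat \<Rightarrow> int) \<Rightarrow> (nat \<Rightarrow> nat \<Rightarrow> int) \<Rightarrow> nat \<Rightarrow> nat \<Rightarrow> int" where
  "mm A B i k = (\<Sum>j\<le>s. A i j * B j k)"

definition E :: "(nat \<times> nat \<Rightarrow> int) \<Rightarrow> nat \<Rightarrow> nat \<Rightarrow> int" where
  "E M i j = M (i, j) - (if i = j then 1 else 0)"

text \<open>\<open>J 1\<close> means strictly upper triangular modulo m, so this factor moves at
  least one step away from the diagonal, and that step pays for raising k by one.\<close>

lemma J_mult_left:
  assumes "J k A" "J 1 B"
  shows "J (Suc k) (mm A B)"
  unfolding J_def mm_def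
proof (intro allI impI dvd_sum)
  fix i l j assume "i \<le> s" "l \<le> s" "j \<in> {..s}"
  then have "int p ^ expo k i j dvd A i j" "int p ^ expo 1 j l dvd B j l"
    using assms by (auto simp: J_def)
  then have "int p ^ (expo k i j + expo 1 j l) dvd A i j * B j l"
    by (simp add: power_add mult_dvd_mono)
  moreover have "expo (Suc k) i l \<le> expo k i j + expo 1 j l" by (auto simp: expo_def)
  ultimately show "int p ^ expo (Suc k) i l dvd A i j * B j l" by (meson power_le_dvd)
qed

lemma J_mult_right:
  assumes "J 1 A" "J k B"
  shows "J (Suc k) (mm A B)"
  unfolding J_def mm_def
proof (intro allI impI dvd_sum)
  fix i l j assume "i \<le> s" "l \<le> s" "j \<in> {..s}"
  then have "int p ^ expo 1 i j dvd A i j" "int p ^ expo k j l dvd B j l"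
    using assms by (auto simp: J_def)
  then have "int p ^ (expo 1 i j + expo k j l) dvd A i j * B j l"
    by (simp add: power_add mult_dvd_mono)
  moreover have "expo (Suc k) i l \<le> expo 1 i j + expo k j l" by (auto simp: expo_def)
  ultimately show "int p ^ expo (Suc k) i l dvd A i j * B j l" by (meson power_le_dvd)
qed

lemma J_add: "J k A \<Longrightarrow> J k B \<Longrightarrow> J k (\<lambda>i j. A i j + B i j)"
  by (simp add: J_def)

lemma J_diff: "J k A \<Longrightarrow> J k B \<Longrightarrow> J k (\<lambda>i j. A i j - B i j)"
  by (simp add: J_def)

lemma J_scale: "J k A \<Longrightarrow> J k (\<lambda>i j. c * A i j)"
  by (simp add: J_def)

lemma J_scale_p:
  assumes "J k A"
  shows "J (Suc k) (\<lambda>i j. int p * A i j)"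
  unfolding J_def
proof (intro allI impI)
  fix i j assume "i \<le> s" "j \<le> s"
  then have "int p ^ Suc (expo k i j) dvd int p * A i j" using assms by (simp add: J_def)
  moreover have "expo (Suc k) i j \<le> Suc (expo k i j)" by (auto simp: expo_def)
  ultimately show "int p ^ expo (Suc k) i j dvd int p * A i j" by (meson power_le_dvd)
qed

lemma J_antimono:
  assumes "J l A" "k \<le> l"
  shows "J k A"
  unfolding J_def
proof (intro allI impI)
  fix i j assume "i \<le> s" "j \<le> s"
  moreover have "expo k i j \<le> expo l i j" using assms(2) by (auto simp: expo_def)
  ultimately show "int p ^ expo k i j dvd A i j" using assms(1) by (meson J_def power_le_dvd)
qed

text \<open>\<open>expo\<close> never exceeds N, so divisibility by p^expo depends only on the
  residue modulo m. This lets unreduced integer matrices stand for matrices over the residue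
  ring.\<close>

lemma J_cong:
  assumes "J k A" "\<And>i j. i \<le> s \<Longrightarrow> j \<le> s \<Longrightarrow> A i j mod m = B i j mod m"
  shows "J k B"
  unfolding J_def
proof (intro allI impI)
  fix i j assume ij: "i \<le> s" "j \<le> s"
  have "expo k i j \<le> N" by (simp add: expo_def)
  then have "int p ^ expo k i j dvd m" by (rule le_imp_power_dvd)
  then show "int p ^ expo k i j dvd B i j"
    using assms ij by (metis J_def dvd_mod_iff)
qed

text \<open>From (I + A)(I + B) = I + A + B + AB; the three delta sums are the terms involving
  I.\<close>

lemma E_mult:
  assumes M: "M \<in> carrier U" "P \<in> carrier U" and ij: "i \<le> s" "j \<le> s"
  shows "E (M \<cdot> P) i j mod m = (E M i j + E P i j + mm (E M) (E P) i j) mod m"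
proof -
  let ?\<delta> = "\<lambda>i j. if i = j then 1 else 0 :: int"
  have 1: "(\<Sum>l\<le>s. ?\<delta> i l * E P l j) = E P i j"
  proof -
    have "(\<Sum>l\<le>s. ?\<delta> i l * E P l j) = (\<Sum>l\<le>s. if l = i then E P i j else 0)"
      by (intro sum.cong) auto
    then show ?thesis using ij by simp
  qed
  have 2: "(\<Sum>l\<le>s. E M i l * ?\<delta> l j) = E M i j"
  proof -
    have "(\<Sum>l\<le>s. E M i l * ?\<delta> l j) = (\<Sum>l\<le>s. if l = j then E M i j else 0)"
      by (intro sum.cong) auto
    then show ?thesis using ij by simp
  qed
  have 3: "(\<Sum>l\<le>s. ?\<delta> i l * ?\<delta> l j) = ?\<delta> i j"
  proof -
    have "(\<Sum>l\<le>s. ?\<delta> i l * ?\<delta> l j) = (\<Sum>l\<le>s. if l = i then ?\<delta> i j else 0)"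
      by (intro sum.cong) auto
    then show ?thesis using ij by simp
  qed
  have "(\<Sum>l\<le>s. M (i, l) * P (l, j)) = (\<Sum>l\<le>s. (E M i l + ?\<delta> i l) * (E P l j + ?\<delta> l j))"
    by (simp add: E_def)
  also have "\<dots> = (\<Sum>l\<le>s. E M i l * E P l j) + (\<Sum>l\<le>s. E M i l * ?\<delta> l j) +
      (\<Sum>l\<le>s. ?\<delta> i l * E P l j) + (\<Sum>l\<le>s. ?\<delta> i l * ?\<delta> l j)"
    unfolding distrib_left distrib_right sum.distrib by (simp only: add_ac)
  also have "\<dots> = E M i j + E P i j + mm (E M) (E P) i j + ?\<delta> i j"
    unfolding 1 2 3 mm_def by simp
  finally have "(\<Sum>l\<le>s. M (i, l) * P (l, j)) = E M i j + E P i j + mm (E M) (E P) i j + ?\<delta> i j" .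
  then show ?thesis
    unfolding E_def[of "M \<cdot> P"] mult_entry[OF M ij] mod_diff_left_eq by simp
qed

section \<open>The subgroups I + J k of the unitriangular group\<close>

definition F :: "nat \<Rightarrow> (nat \<times> nat \<Rightarrow> int) set" where
  "F k = {M \<in> carrier U. J k (E M)}"

lemma F_1: "F 1 = carrier U"
proof -
  have "int p ^ expo 1 i j dvd E M i j" if "M \<in> carrier U" "i \<le> s" "j \<le> s" for M i j
    using that by (cases "i < j"; cases "i = j") (auto simp: expo_def E_def carrier_iff)
  then show ?thesis by (auto simp: F_def J_def)
qed

lemma F_D: "M \<in> F k \<Longrightarrow> M \<in> carrier U" "M \<in> F k \<Longrightarrow> J k (E M)"
  by (simp_all add: F_def)

lemma J_1: "M \<in> carrier U \<Longrightarrow> J 1 (E M)"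
  using F_1 F_D by blast

text \<open>Distances from the diagonal are at most s and n + 1 - s = N, so every exponent reaches N
  and all entries agree with the identity modulo m.\<close>

lemma F_Suc_n: "M \<in> F (Suc n) \<Longrightarrow> M = \<one>\<^bsub>U\<^esub>"
proof (rule matrix_eqI)
  fix i j assume M: "M \<in> F (Suc n)" and ij: "i \<le> s" "j \<le> s"
  have "expo (Suc n) i j = N" using ij s by (auto simp: expo_def)
  then have "m dvd E M i j" using F_D(2)[OF M] ij by (metis J_def)
  then have "M (i, j) mod m = (if i = j then 1 else 0) mod m"
    unfolding E_def by (simp only: mod_eq_dvd_iff)
  then show "M (i, j) mod m = \<one>\<^bsub>U\<^esub> (i, j) mod m" using ij by (simp only: one_entry)
qed (simp_all add: F_D)

text \<open>A binomial expansion to first order: every other term contains a product of a matrix in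
  J k with one in J 1, so it lies in J (k+1). For r = p the linear term rises to J (k+1) as
  well.\<close>

lemma E_pow:
  assumes M: "M \<in> F k" and k: "0 < k"
  shows "J (Suc k) (\<lambda>i j. E (M [^]\<^bsub>U\<^esub> (r::nat)) i j - int r * E M i j)"
proof (induction r)
  case 0
  have "E \<one>\<^bsub>U\<^esub> i j = 0" if "i \<le> s" "j \<le> s" for i j using that by (simp add: E_def one_entry)
  then show ?case by (simp add: J_def)
next
  case (Suc r)
  note Mc = F_D(1)[OF M]
  have J1: "J 1 (E M)" using Mc by (rule J_1)
  have "J k (\<lambda>i j. (E (M [^]\<^bsub>U\<^esub> r) i j - int r * E M i j) + int r * E M i j)"
    using J_antimono[OF Suc, of k] J_scale[OF F_D(2)[OF M]] by (intro J_add) auto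
  then have "J k (E (M [^]\<^bsub>U\<^esub> r))" by simp
  then have "J (Suc k) (mm (E (M [^]\<^bsub>U\<^esub> r)) (E M))" using J1 by (rule J_mult_left)
  from J_add[OF Suc this] show ?case
  proof (rule J_cong)
    fix i j assume ij: "i \<le> s" "j \<le> s"
    let ?e = "E (M [^]\<^bsub>U\<^esub> r) i j" and ?c = "mm (E (M [^]\<^bsub>U\<^esub> r)) (E M) i j"
    have "(?e + E M i j + ?c - int (Suc r) * E M i j) mod m =
        (E (M [^]\<^bsub>U\<^esub> Suc r) i j - int (Suc r) * E M i j) mod m"
      using E_mult[of "M [^]\<^bsub>U\<^esub> r" M i j] Mc ij by (intro mod_diff_cong) (simp_all)
    then show "(?e - int r * E M i j + ?c) mod m = (E (M [^]\<^bsub>U\<^esub> Suc r) i j - int (Suc r) * E M i j) mod m"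
      by (simp add: algebra_simps)
  qed
qed

lemma F_pow:
  assumes M: "M \<in> F k" and k: "0 < k"
  shows "M [^]\<^bsub>U\<^esub> (r::nat) \<in> F k"
proof -
  have "J k (\<lambda>i j. (E (M [^]\<^bsub>U\<^esub> r) i j - int r * E M i j) + int r * E M i j)"
    using J_antimono[OF E_pow[OF M k], of k] J_scale[OF F_D(2)[OF M]] by (intro J_add) auto
  then show ?thesis using F_D(1)[OF M] by (simp add: F_def)
qed

lemma F_pow_p:
  assumes M: "M \<in> F k" and k: "0 < k"
  shows "M [^]\<^bsub>U\<^esub> p \<in> F (Suc k)"
proof -
  have "J (Suc k) (\<lambda>i j. (E (M [^]\<^bsub>U\<^esub> p) i j - int p * E M i j) + int p * E M i j)"
    using E_pow[OF M k] J_scale_p[OF F_D(2)[OF M]] by (intro J_add) auto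
  then show ?thesis using F_D(1)[OF M] by (simp add: F_def)
qed

lemma pow_p_power: "M \<in> carrier U \<Longrightarrow> M [^]\<^bsub>U\<^esub> (p ^ k) \<in> F (Suc k)"
proof (induction k)
  case 0
  then have "M [^]\<^bsub>U\<^esub> (1::nat) \<in> F 1" using F_1 by simp
  then show ?case by (simp only: power_0 One_nat_def)
next
  case (Suc k)
  then have "(M [^]\<^bsub>U\<^esub> (p ^ k)) [^]\<^bsub>U\<^esub> p \<in> F (Suc (Suc k))" by (intro F_pow_p) auto
  then show ?case using Suc.prems by (simp add: U.nat_pow_pow mult.commute)
qed

text \<open>M^(p^n) lies in F (n+1), which is trivial, so a power of M is its inverse. As F k is
  closed under powers, inverses will stay in F k.\<close>

lemma pow_inverse:
  assumes "M \<in> carrier U"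
  shows "M [^]\<^bsub>U\<^esub> (p ^ n - 1) \<cdot> M = \<one>\<^bsub>U\<^esub>"
proof -
  have "Suc (p ^ n - 1) = p ^ n" using p by simp
  then have "M [^]\<^bsub>U\<^esub> (p ^ n - 1) \<cdot> M = M [^]\<^bsub>U\<^esub> (p ^ n)" by (metis U.nat_pow_Suc)
  then show ?thesis using F_Suc_n[OF pow_p_power[OF assms]] by simp
qed

sublocale U: group U
proof (rule U.group_l_invI)
  fix M assume "M \<in> carrier U"
  then show "\<exists>P\<in>carrier U. P \<cdot> M = \<one>\<^bsub>U\<^esub>" using pow_inverse U.nat_pow_closed by blast
qed

lemma F_subgroup:
  assumes k: "0 < k"
  shows "subgroup (F k) U"
proof
  show "F k \<subseteq> carrier U" by (auto simp: F_def)
  show "M \<cdot> P \<in> F k" if "M \<in> F k" "P \<in> F k" for M P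
  proof -
    have "J k (mm (E M) (E P))"
      using J_antimono[OF J_mult_left[OF F_D(2)[OF that(1)] J_1[OF F_D(1)[OF that(2)]]], of k] by simp
    from J_add[OF J_add[OF F_D(2)[OF that(1)] F_D(2)[OF that(2)]] this]
    have "J k (E (M \<cdot> P))"
      using E_mult F_D(1)[OF that(1)] F_D(1)[OF that(2)] by (rule_tac J_cong) (simp_all)
    then show ?thesis using that by (simp add: F_def)
  qed
  have "M [^]\<^bsub>U\<^esub> (p ^ n - 1) \<in> F k" if "M \<in> F k" for M using F_pow[OF that k] .
  moreover have "inv\<^bsub>U\<^esub> M = M [^]\<^bsub>U\<^esub> (p ^ n - 1)" if "M \<in> F k" for M
    using that pow_inverse by (intro U.inv_equality) (auto simp: F_def)
  ultimately show "inv\<^bsub>U\<^esub> M \<in> F k" if "M \<in> F k" for M using that by simp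
  have "E \<one>\<^bsub>U\<^esub> i j = 0" if "i \<le> s" "j \<le> s" for i j using that by (simp add: E_def one_entry)
  then show "\<one>\<^bsub>U\<^esub> \<in> F k" by (simp add: F_def J_def)
qed

text \<open>Let A = M - I and B = P - I. Comparing the two sides of MP = PMC gives
  \<open>E C\<close> as AB - BA minus the product of PM - I with \<open>E C\<close>, modulo m, and
  both AB and BA lie in J (k+1).\<close>

lemma F_commutator:
  assumes M: "M \<in> carrier U" and P: "P \<in> F k" and k: "0 < k"
  shows "commutator U M P \<in> F (Suc k)"
proof -
  define C where "C = commutator U M P"
  have Pc: "P \<in> carrier U" using P by (simp add: F_def)
  have Cc: "C \<in> carrier U" unfolding C_def using commutator_closed[OF U.is_group M Pc] .
  have eq: "M \<cdot> P = P \<cdot> M \<cdot> C"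
    using M Pc by (simp add: C_def commutator_def U.m_assoc U.inv_mult_cancel)
  let ?D = "P \<cdot> M"
  let ?R = "\<lambda>i j. mm (E M) (E P) i j - mm (E P) (E M) i j - mm (E ?D) (E C) i j"
  have EC: "?R i j mod m = E C i j mod m" if "i \<le> s" "j \<le> s" for i j
  proof -
    have "(E M i j + E P i j + mm (E M) (E P) i j) mod m =
        (E ?D i j + (E C i j + mm (E ?D) (E C) i j)) mod m"
      using E_mult[OF M Pc that] E_mult[of ?D C, OF _ Cc that] M Pc unfolding eq
      by (simp add: add.assoc)
    also have "\<dots> = (E P i j + E M i j + mm (E P) (E M) i j + (E C i j + mm (E ?D) (E C) i j)) mod m"
      using E_mult[OF Pc M that] by (intro mod_add_cong) simp_all
    finally have "m dvd E M i j + E P i j + mm (E M) (E P) i j -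
        (E P i j + E M i j + mm (E P) (E M) i j + (E C i j + mm (E ?D) (E C) i j))"
      by (simp only: mod_eq_dvd_iff)
    also have "E M i j + E P i j + mm (E M) (E P) i j -
        (E P i j + E M i j + mm (E P) (E M) i j + (E C i j + mm (E ?D) (E C) i j)) =
        ?R i j - E C i j" by simp
    finally show ?thesis by (simp only: mod_eq_dvd_iff)
  qed
  have "J (Suc k) (mm (E M) (E P))" "J (Suc k) (mm (E P) (E M))"
    using J_mult_right[OF J_1[OF M] F_D(2)[OF P]] J_mult_left[OF F_D(2)[OF P] J_1[OF M]] by auto
  then have MP: "J (Suc k) (\<lambda>i j. mm (E M) (E P) i j - mm (E P) (E M) i j)" by (rule J_diff)
  \<comment> \<open>\<open>E C\<close> occurs on both sides of \<open>EC\<close>. Each substitution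
    raises its level by one, because the factor \<open>E ?D\<close> is in J 1, until AB - BA limits
    it at k+1.\<close>
  have "J (Suc j) (E C)" if "j \<le> k" for j
    using that
  proof (induction j)
    case 0
    then show ?case using J_1[OF Cc] by (simp add: One_nat_def)
  next
    case (Suc j)
    then have "J (Suc (Suc j)) (mm (E ?D) (E C))"
      using J_mult_right[OF J_1[of ?D]] M Pc by simp
    moreover have "J (Suc (Suc j)) (\<lambda>i j. mm (E M) (E P) i j - mm (E P) (E M) i j)"
      using J_antimono[OF MP] Suc by simp
    ultimately have "J (Suc (Suc j)) ?R" by (rule J_diff[rotated])
    then show ?case using EC by (rule J_cong)
  qed
  from this[of k] show ?thesis using Cc by (simp add: F_def C_def)
qed

section \<open>The last filtration step and its identification with F_p\<close>

abbreviation "TU \<equiv> discrete_topology (carrier U)"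
abbreviation "Z \<equiv> UU_central_to_Fp p n s"

sublocale U: mult_topological_group U TU
proof
  have "prod_topology TU TU = discrete_topology (carrier U \<times> carrier U)"
    by (rule prod_topology_discrete_topology[symmetric])
  then show "continuous_map (prod_topology TU TU) TU (\<lambda>(x, y). x \<cdot> y)"
    by auto
qed simp

lemma lower_p_central_subset_F: "lower_p_central U TU p (Suc k) \<subseteq> F (Suc k)"
proof (induction k)
  case 0
  then show ?case using F_1 by (simp add: One_nat_def)
next
  case (Suc k)
  show ?case
  proof (rule lower_p_central_leastI)
    show "subgroup (F (Suc (Suc k))) U" by (rule F_subgroup) simp
    then show "closedin TU (F (Suc (Suc k)))" by (simp add: subgroup.subset)
    show "M [^]\<^bsub>U\<^esub> p \<in> F (Suc (Suc k))" if "M \<in> lower_p_central U TU p (Suc k)" for M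
      using that Suc by (intro F_pow_p) auto
    show "commutator U M P \<in> F (Suc (Suc k))"
      if "M \<in> carrier U" "P \<in> lower_p_central U TU p (Suc k)" for M P
      using that Suc by (intro F_commutator) auto
  qed simp
qed

lemma central_subset_F: "UU_central p n s \<subseteq> F n"
  using lower_p_central_subset_F[of "n - 1"] s by simp

text \<open>For every distance d < s the number n - d is at least N, so only the corner, with
  exponent n - s = N - 1, can differ from the identity.\<close>

lemma F_n_entry:
  assumes M: "M \<in> F n" and ij: "i \<le> s" "j \<le> s" "(i, j) \<noteq> (0, s)"
  shows "M (i, j) = \<one>\<^bsub>U\<^esub> (i, j)"
proof -
  have "expo n i j = N" using ij s by (auto simp: expo_def)
  then have "m dvd E M i j" using F_D(2)[OF M] ij by (metis J_def)
  then have "M (i, j) mod m = (if i = j then 1 else 0) mod m"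
    unfolding E_def by (simp only: mod_eq_dvd_iff)
  then have "M (i, j) mod m = \<one>\<^bsub>U\<^esub> (i, j) mod m" by (simp only: one_entry[OF ij(1,2)])
  then show ?thesis
    unfolding entry_mod[OF F_D(1)[OF M] ij(1,2)] entry_mod[OF one_closed ij(1,2)] .
qed

text \<open>The corner entry is a multiple a p^(n-s), and 0 <= a < p because entries lie below
  p^(n-s+1). Cancelling p^(n-s) makes a unique, so the description in
  \<open>UU_central_to_Fp\<close> is met.\<close>

lemma Z_entry:
  assumes M: "M \<in> F n"
  shows "Z M \<in> {0..int p - 1}" "M (0, s) = Z M * int p ^ (n - s)"
proof -
  let ?q = "int p ^ (n - s)"
  have q: "0 < ?q" "m = int p * ?q" using p by (auto simp: power_add)
  have Mc: "M \<in> carrier U" using M by (simp add: F_def)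
  have "expo n 0 s = n - s" using s by (auto simp: expo_def)
  then have "?q dvd E M 0 s" using F_D(2)[OF M] by (metis J_def le0 le_refl)
  then have "?q dvd M (0, s)" using s by (simp add: E_def)
  then obtain a where a: "M (0, s) = a * ?q" by (metis dvd_def mult.commute)
  have "M (0, s) \<in> {0..m - 1}" using Mc by (auto simp: carrier_iff)
  then have "0 \<le> a * ?q" "a * ?q < int p * ?q" using a q by auto
  then have ap: "0 \<le> a" "a < int p" using q(1) by (simp_all add: zero_le_mult_iff)
  have mod: "(b * ?q) mod m = (b mod int p) * ?q" for b
    unfolding q(2) by (simp add: mult.commute)
  have "M = \<one>\<^bsub>U\<^esub>((0, s) := (a * ?q) mod m)"
  proof
    fix x show "M x = (\<one>\<^bsub>U\<^esub>((0, s) := (a * ?q) mod m)) x"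
    proof (cases "x \<in> {..s} \<times> {..s}")
      case True
      then show ?thesis using F_n_entry[OF M] a ap mod by (cases x) auto
    next
      case False
      have "M \<in> extensional ({..s} \<times> {..s})" "\<one>\<^bsub>U\<^esub> \<in> extensional ({..s} \<times> {..s})"
        using Mc one_closed by (simp_all only: carrier_iff)
      then have "M x = undefined" "\<one>\<^bsub>U\<^esub> x = undefined"
        using False extensional_arb by metis+
      moreover have "x \<noteq> (0, s)" using False by auto
      ultimately show ?thesis by simp
    qed
  qed
  moreover have "b = a" if "b \<in> carrier (Fp p)" "M = \<one>\<^bsub>U\<^esub>((0, s) := (b * ?q) mod m)" for b
  proof -
    have "a * ?q = (b * ?q) mod m" using fun_cong[OF that(2), of "(0, s)"] a by simp
    also have "\<dots> = b * ?q" using that(1) by (simp add: mod residue_ring_simps)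
    finally show ?thesis using q(1) by (metis mult_right_cancel less_irrefl)
  qed
  moreover have "a \<in> carrier (Fp p)" using ap by (simp add: residue_ring_simps)
  ultimately have "Z M = a"
    unfolding UU_central_to_Fp_def by (intro the_equality conjI) (blast+)
  then show "Z M \<in> {0..int p - 1}" "M (0, s) = Z M * ?q" using a ap by auto
qed

text \<open>A product of a matrix in J n with one in J 1 lies in J (n+1) and vanishes modulo m, so
  multiplying by M from either side merely adds M - I. Centrality of F n and additivity of
  \<open>Z\<close> both follow.\<close>

lemma central_mult_entry:
  assumes M: "M \<in> F n" and P: "P \<in> carrier U" and ij: "i \<le> s" "j \<le> s"
  shows "(M \<cdot> P) (i, j) mod m = (P (i, j) + E M i j) mod m"
    and "(P \<cdot> M) (i, j) mod m = (P (i, j) + E M i j) mod m"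
proof -
  have Mc: "M \<in> carrier U" using M by (simp add: F_def)
  have 0: "m dvd X i j" if "J (Suc n) X" for X
  proof -
    have "expo (Suc n) i j = N" using ij s by (auto simp: expo_def)
    then show ?thesis using that ij by (metis J_def)
  qed
  have "E (M \<cdot> P) i j mod m = (E M i j + E P i j) mod m"
    using E_mult[OF Mc P ij] 0[OF J_mult_left[OF F_D(2)[OF M] J_1[OF P]]]
    by (metis add.right_neutral dvd_imp_mod_0 mod_add_right_eq)
  then show "(M \<cdot> P) (i, j) mod m = (P (i, j) + E M i j) mod m"
    unfolding E_def[of "M \<cdot> P"] E_def[of P]
    by (simp only: mod_eq_dvd_iff) (simp add: algebra_simps)
  have "E (P \<cdot> M) i j mod m = (E P i j + E M i j) mod m"
    using E_mult[OF P Mc ij] 0[OF J_mult_right[OF J_1[OF P] F_D(2)[OF M]]]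
    by (metis add.right_neutral dvd_imp_mod_0 mod_add_right_eq)
  then show "(P \<cdot> M) (i, j) mod m = (P (i, j) + E M i j) mod m"
    unfolding E_def[of "P \<cdot> M"] E_def[of P]
    by (simp only: mod_eq_dvd_iff) (simp add: algebra_simps)
qed

lemma central:
  assumes M: "M \<in> F n" and P: "P \<in> carrier U"
  shows "M \<cdot> P = P \<cdot> M"
proof (rule matrix_eqI)
  fix i j assume "i \<le> s" "j \<le> s"
  then show "(M \<cdot> P) (i, j) mod m = (P \<cdot> M) (i, j) mod m"
    using central_mult_entry[OF M P] by simp
qed (use M P in \<open>simp_all add: F_def\<close>)

lemma Z_mult:
  assumes M: "M \<in> F n" and P: "P \<in> F n"
  shows "Z (M \<cdot> P) = (Z M + Z P) mod int p"
proof -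
  let ?q = "int p ^ (n - s)"
  have q: "0 < ?q" "m = int p * ?q" using p by (auto simp: power_add)
  have MP: "M \<cdot> P \<in> F n"
    using F_subgroup[of n] M P s by (simp add: subgroup.m_closed)
  have "Z (M \<cdot> P) * ?q = (M \<cdot> P) (0, s) mod m"
    using Z_entry[OF MP] entry_mod[OF F_D(1)[OF MP], of 0 s] by simp
  also have "\<dots> = (P (0, s) + M (0, s)) mod m"
    using central_mult_entry(1)[OF M F_D(1)[OF P], of 0 s] s by (simp add: E_def)
  also have "\<dots> = ((Z M + Z P) * ?q) mod m"
    by (simp add: Z_entry(2)[OF M] Z_entry(2)[OF P] algebra_simps)
  also have "\<dots> = ((Z M + Z P) mod int p) * ?q"
    unfolding q(2) by (simp add: mult.commute)
  finally show ?thesis using q(1) by (metis mult_right_cancel less_irrefl)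
qed

end

section \<open>Profinite unit groups and the universal property\<close>

text \<open>Inversion is the one map whose continuity is not inherited from the monoid; it comes
  from the compactness of its graph.\<close>

lemma profinite_units:
  fixes G (structure)
  assumes G: "monoid G" and T: "topspace T = carrier G"
    and mult: "continuous_map (prod_topology T T) T (\<lambda>(x, y). x \<otimes> y)"
    and comp: "compact_space T" and haus: "Hausdorff_space T"
    and disc: "\<And>A. connectedin T A \<Longrightarrow> \<exists>a. A \<subseteq> {a}"
  shows "profinite_group (units_of G) (subtopology T (Units G))"
proof -
  interpret monoid G by fact
  interpret UG: group "units_of G" by (rule units_group)
  have mult': "continuous_map (prod_topology T T) T (\<lambda>(x, y). y \<otimes> x)"
    using continuous_map_compose[OF _ mult, of "prod_topology T T" "\<lambda>(x, y). (y, x)"]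
    by (simp add: o_def case_prod_unfold continuous_map_pairwise continuous_map_fst continuous_map_snd)
  \<comment> \<open>The graph of inversion. Its first projection is a continuous bijection from a
    compact space onto a Hausdorff space, hence a homeomorphism; inversion is its inverse followed
    by the second projection.\<close>
  define P where "P = {q \<in> topspace (prod_topology T T). (\<lambda>(x, y). x \<otimes> y) q \<in> {\<one>}} \<inter>
     {q \<in> topspace (prod_topology T T). (\<lambda>(x, y). y \<otimes> x) q \<in> {\<one>}}"
  have one: "closedin T {\<one>}" using haus by (simp add: closedin_Hausdorff_sing_eq T)
  have P: "closedin (prod_topology T T) P"
    unfolding P_def
    by (intro closedin_Int closedin_continuous_map_preimage[OF mult one]
        closedin_continuous_map_preimage[OF mult' one])
  have compP: "compactin (prod_topology T T) P"
    using P comp by (simp add: closedin_compact_space compact_space_prod_topology)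
  have P_iff: "(a, b) \<in> P \<longleftrightarrow> a \<in> Units G \<and> b = inv a" for a b
  proof
    assume "(a, b) \<in> P"
    then have "a \<in> carrier G" "b \<in> carrier G" "a \<otimes> b = \<one>" "b \<otimes> a = \<one>" by (auto simp: P_def T)
    then show "a \<in> Units G \<and> b = inv a"
      using inv_unique'[of a b] by (auto simp: Units_def)
  qed (auto simp: P_def T)
  let ?TP = "subtopology (prod_topology T T) P" and ?TU = "subtopology T (Units G)"
  have hausU: "Hausdorff_space ?TU" using haus by (rule Hausdorff_space_subtopology)
  have UC: "Units G \<subseteq> topspace T" by (auto simp: T)
  then have topU: "topspace ?TU = Units G" by (simp add: inf_absorb2)
  have topP: "topspace ?TP = P" using closedin_subset[OF P] by auto
  have fstP: "fst ` P = Units G" using P_iff by force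
  have cont_fst: "continuous_map ?TP ?TU fst"
    using fstP topP by (auto simp: continuous_map_in_subtopology
        intro: continuous_map_from_subtopology continuous_map_fst)
  have compactU: "compact_space ?TU"
    using image_compactin[OF compP continuous_map_fst] fstP by (simp add: compact_space_subtopology)
  have "homeomorphic_map ?TP ?TU fst"
  proof (rule continuous_imp_homeomorphic_map[OF cont_fst _ hausU])
    show "compact_space ?TP" using compP by (rule compact_space_subtopology)
    show "fst ` topspace ?TP = topspace ?TU" using fstP topP topU by simp
    show "inj_on fst (topspace ?TP)" unfolding topP using P_iff by (force intro: inj_onI)
  qed
  then obtain g where g: "homeomorphic_maps ?TP ?TU fst g"
    using homeomorphic_map_maps by blast
  have "continuous_map ?TU (prod_topology T T) g"
    using g by (simp add: homeomorphic_maps_def continuous_map_in_subtopology)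
  then have "continuous_map ?TU T (snd \<circ> g)"
    by (rule continuous_map_compose) (rule continuous_map_snd)
  moreover have gU: "(snd \<circ> g) a = inv\<^bsub>units_of G\<^esub> a" if "a \<in> Units G" for a
  proof -
    have "g a \<in> P" "fst (g a) = a"
      using g that topU topP by (auto simp: homeomorphic_maps_def continuous_map_def)
    then have "(a, snd (g a)) \<in> P" by (metis prod.collapse)
    then show ?thesis using P_iff units_of_inv that by simp
  qed
  ultimately have "continuous_map ?TU T (\<lambda>a. inv\<^bsub>units_of G\<^esub> a)"
    using topU by (subst continuous_map_eq[where f = "snd \<circ> g"]) auto
  moreover have "inv\<^bsub>units_of G\<^esub> a \<in> Units G" if "a \<in> Units G" for a
    using that by (simp add: units_of_inv)
  ultimately have inv_cont: "continuous_map ?TU ?TU (\<lambda>a. inv\<^bsub>units_of G\<^esub> a)"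
    using topU by (auto simp: continuous_map_in_subtopology)
  have "continuous_map (prod_topology ?TU ?TU) T (\<lambda>(x, y). x \<otimes> y)"
    unfolding subtopology_Times[symmetric] by (rule continuous_map_from_subtopology[OF mult])
  then have mult_cont: "continuous_map (prod_topology ?TU ?TU) ?TU (\<lambda>(x, y). x \<otimes> y)"
    using topU by (auto simp: continuous_map_in_subtopology)
  show ?thesis
    unfolding profinite_group_def
    using UG.is_group topU mult_cont inv_cont compactU hausU disc
    by (auto simp: units_of_carrier units_of_mult connectedin_subtopology)
qed

lemma profinite_closed_subgroup:
  assumes G: "profinite_group G T" and K: "subgroup K G" "closedin T K"
  shows "profinite_group (G\<lparr>carrier := K\<rparr>) (subtopology T K)"
proof -
  interpret group G using G by (simp add: profinite_group_def)
  let ?TK = "subtopology T K"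
  have topK: "topspace ?TK = K" using closedin_subset[OF K(2)] by auto
  have "continuous_map ?TK T (\<lambda>a. inv\<^bsub>G\<^esub> a)"
    using G by (auto simp: profinite_group_def intro: continuous_map_from_subtopology)
  then have "continuous_map ?TK T (\<lambda>a. inv\<^bsub>G\<lparr>carrier := K\<rparr>\<^esub> a)"
    by (rule continuous_map_eq) (use topK K m_inv_consistent in auto)
  moreover have "inv\<^bsub>G\<lparr>carrier := K\<rparr>\<^esub> a \<in> K" if "a \<in> K" for a
    using that K m_inv_consistent subgroup.m_inv_closed by fastforce
  ultimately have inv_cont: "continuous_map ?TK ?TK (\<lambda>a. inv\<^bsub>G\<lparr>carrier := K\<rparr>\<^esub> a)"
    using topK by (auto simp: continuous_map_in_subtopology)
  have "continuous_map (prod_topology T T) T (\<lambda>(x, y). x \<otimes>\<^bsub>G\<^esub> y)"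
    using G by (simp add: profinite_group_def)
  then have "continuous_map (prod_topology ?TK ?TK) T (\<lambda>(x, y). x \<otimes>\<^bsub>G\<^esub> y)"
    unfolding subtopology_Times[symmetric] by (rule continuous_map_from_subtopology)
  then have mult_cont: "continuous_map (prod_topology ?TK ?TK) ?TK (\<lambda>(x, y). x \<otimes>\<^bsub>G\<^esub> y)"
    using topK K subgroup.m_closed by (fastforce simp: continuous_map_in_subtopology)
  have "compact_space ?TK"
    using G K by (simp add: profinite_group_def closedin_compact_space compact_space_subtopology)
  then show ?thesis
    using G K topK inv_cont mult_cont subgroup_imp_group[OF K(1)]
    by (auto simp: profinite_group_def connectedin_subtopology Hausdorff_space_subtopology)
qed

text \<open>\<open>free_profinite_group\<close> tests only groups whose elements are sets of natural
  numbers; a group that injects into this type is moved there. Along an injection the quotient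
  topology is the transported topology.\<close>

lemma profinite_transport:
  fixes H :: "'c monoid" and e :: "'c \<Rightarrow> 'd"
  assumes H: "profinite_group H TH" and e: "inj_on e (carrier H)"
  obtains H' :: "'d monoid" and TH' where "profinite_group H' TH'"
    "e \<in> iso H H'" "homeomorphic_map TH TH' e"
proof -
  interpret group H using H by (simp add: profinite_group_def)
  have top: "topspace TH = carrier H" using H by (simp add: profinite_group_def)
  define d where "d = inv_into (carrier H) e"
  have de: "d (e a) = a" if "a \<in> carrier H" for a
    using that e by (simp add: d_def)
  define H' where "H' = \<lparr>carrier = e ` carrier H, mult = (\<lambda>a b. e (d a \<otimes>\<^bsub>H\<^esub> d b)), one = e \<one>\<^bsub>H\<^esub>\<rparr>"
  have H'_carrier: "carrier H' = e ` carrier H" by (simp add: H'_def)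
  define TH' where "TH' = quotient_topology TH e"
  have hom: "e \<in> hom H H'" by (auto simp: hom_def H'_def de)
  then have iso: "e \<in> iso H H'" using e by (auto simp: iso_def H'_def bij_betw_def)
  have "group (H'\<lparr>carrier := e ` carrier H, one := e \<one>\<^bsub>H\<^esub>\<rparr>)"
    using hom by (rule hom_imp_img_group)
  then have group': "group H'" by (simp add: H'_def)
  have homeo: "homeomorphic_map TH TH' e"
    unfolding TH'_def using e top by (simp add: homeomorphic_map_def quotient_map_quotient_topology)
  have top': "topspace TH' = carrier H'"
    using homeomorphic_imp_surjective_map[OF homeo] top by (simp add: H'_def)
  obtain d' where d': "homeomorphic_maps TH TH' e d'" using homeo homeomorphic_map_maps by blast
  have d'_cont: "continuous_map TH' TH d'" using d' by (simp add: homeomorphic_maps_def)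
  have d'_d: "d' a = d a" if a: "a \<in> carrier H'" for a
  proof -
    obtain b where b: "b \<in> carrier H" "a = e b" using a by (auto simp: H'_def)
    then have "d' (e b) = b" using d' top by (simp add: homeomorphic_maps_def)
    then show ?thesis using b de by simp
  qed
  have d_cont: "continuous_map TH' TH d"
    by (rule continuous_map_eq[OF d'_cont]) (simp add: top' d'_d)
  have e_cont: "continuous_map TH TH' e" using homeo by (rule homeomorphic_imp_continuous_map)
  have "continuous_map (prod_topology TH' TH') (prod_topology TH TH) (\<lambda>q. (d (fst q), d (snd q)))"
    using continuous_map_compose[OF continuous_map_fst[of TH' TH'] d_cont]
      continuous_map_compose[OF continuous_map_snd[of TH' TH'] d_cont]
    by (simp add: continuous_map_pairwise o_def)
  then have "continuous_map (prod_topology TH' TH') TH ((\<lambda>(x, y). x \<otimes>\<^bsub>H\<^esub> y) \<circ> (\<lambda>q. (d (fst q), d (snd q))))"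
    using H by (intro continuous_map_compose) (auto simp: profinite_group_def)
  then have "continuous_map (prod_topology TH' TH') TH' (e \<circ> ((\<lambda>(x, y). x \<otimes>\<^bsub>H\<^esub> y) \<circ> (\<lambda>q. (d (fst q), d (snd q)))))"
    using e_cont by (rule continuous_map_compose)
  then have mult_cont: "continuous_map (prod_topology TH' TH') TH' (\<lambda>(x, y). x \<otimes>\<^bsub>H'\<^esub> y)"
    by (simp add: H'_def o_def case_prod_unfold)
  have "continuous_map TH' TH ((\<lambda>x. inv\<^bsub>H\<^esub> x) \<circ> d)"
    using d_cont H by (intro continuous_map_compose) (auto simp: profinite_group_def)
  then have inv_cont: "continuous_map TH' TH' (e \<circ> ((\<lambda>x. inv\<^bsub>H\<^esub> x) \<circ> d))"
    using e_cont by (rule continuous_map_compose)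
  interpret e: group_hom H H' e using hom group' by (simp add: group_hom_def group_hom_axioms_def is_group)
  have inv_cont: "continuous_map TH' TH' (\<lambda>x. inv\<^bsub>H'\<^esub> x)"
  proof (rule continuous_map_eq[OF inv_cont])
    fix x assume "x \<in> topspace TH'"
    then have "x \<in> e ` carrier H" by (simp only: top' H'_carrier)
    then obtain a where a: "a \<in> carrier H" "x = e a" by blast
    then show "(e \<circ> ((\<lambda>x. inv\<^bsub>H\<^esub> x) \<circ> d)) x = inv\<^bsub>H'\<^esub> x"
      using e.hom_inv[OF a(1)] de[OF a(1)] by (simp only: a(2) o_apply)
  qed
  have "\<exists>a. A \<subseteq> {a}" if "connectedin TH' A" for A
  proof -
    have "connectedin TH (d ` A)" using connectedin_continuous_map_image[OF d_cont that] .
    then obtain a where a: "d ` A \<subseteq> {a}" using H by (auto simp: profinite_group_def)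
    have "x = e a" if "x \<in> A" for x
    proof -
      have "A \<subseteq> e ` carrier H"
        using connectedin_subset_topspace[OF \<open>connectedin TH' A\<close>] unfolding top' H'_carrier .
      then have "x \<in> e ` carrier H" using \<open>x \<in> A\<close> by (rule subsetD)
      then obtain b where b: "b \<in> carrier H" "x = e b" by (elim imageE)
      have "d x \<in> {a}" using a imageI[OF \<open>x \<in> A\<close>] by (rule subsetD)
      then show ?thesis using de[OF b(1)] b(2) by simp
    qed
    then show ?thesis by (intro exI[of _ "e a"] subsetI) simp
  qed
  moreover have "TH homeomorphic_space TH'" using homeo by (rule homeomorphic_map_imp_homeomorphic_space)
  then have "compact_space TH' \<longleftrightarrow> compact_space TH" "Hausdorff_space TH' \<longleftrightarrow> Hausdorff_space TH"
    by (simp_all only: homeomorphic_compact_space homeomorphic_Hausdorff_space)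
  moreover have "compact_space TH" "Hausdorff_space TH" using H by (simp_all add: profinite_group_def)
  ultimately have "profinite_group H' TH'"
    using group' top' mult_cont inv_cont unfolding profinite_group_def by iprover
  then show thesis using iso homeo by (rule that)
qed

lemma free_profinite_lift:
  fixes H :: "'c monoid" and e :: "'c \<Rightarrow> nat set" and f :: "'x::finite \<Rightarrow> 'c"
  assumes S: "free_profinite_group S T \<iota>" and H: "profinite_group H TH"
    and e: "inj_on e (carrier H)" and f: "range f \<subseteq> carrier H"
  shows "\<exists>!\<phi>. \<phi> \<in> hom S H \<and> \<phi> \<in> extensional (carrier S) \<and> continuous_map T TH \<phi> \<and>
    (\<forall>x. \<phi> (\<iota> x) = f x)"
proof -
  interpret S: group S using S by (simp add: free_profinite_group_def profinite_group_def)
  interpret H: group H using H by (simp add: profinite_group_def)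
  have topS: "topspace T = carrier S" and topH: "topspace TH = carrier H"
    using S H by (simp_all add: free_profinite_group_def profinite_group_def)
  have \<iota>: "\<iota> x \<in> carrier S" for x using S by (auto simp: free_profinite_group_def)
  obtain H' :: "nat set monoid" and TH' where H': "profinite_group H' TH'"
    and iso: "e \<in> iso H H'" and homeo: "homeomorphic_map TH TH' e"
    using profinite_transport[OF H e] by blast
  interpret H': group H' using H' by (simp add: profinite_group_def)
  have topH': "topspace TH' = carrier H'" using H' by (simp add: profinite_group_def)
  have e_hom: "e \<in> hom H H'" using iso by (simp add: iso_def)
  obtain d where d: "homeomorphic_maps TH TH' e d" using homeo homeomorphic_map_maps by blast
  have e_cont: "continuous_map TH TH' e" and d_cont: "continuous_map TH' TH d"
    and de: "\<And>a. a \<in> carrier H \<Longrightarrow> d (e a) = a" and ed: "\<And>b. b \<in> carrier H' \<Longrightarrow> e (d b) = b"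
    using d topH topH' by (auto simp: homeomorphic_maps_def)
  have d_closed: "d b \<in> carrier H" if "b \<in> carrier H'" for b
    using d_cont that topH topH' by (auto simp: continuous_map_def)
  have d_mult: "d (a \<otimes>\<^bsub>H'\<^esub> b) = d a \<otimes>\<^bsub>H\<^esub> d b" if "a \<in> carrier H'" "b \<in> carrier H'" for a b
  proof -
    have "e (d a \<otimes>\<^bsub>H\<^esub> d b) = a \<otimes>\<^bsub>H'\<^esub> b"
      using e_hom d_closed that ed by (simp add: hom_mult)
    then show ?thesis using de d_closed that by (metis H.m_closed)
  qed
  let ?P = "\<lambda>\<phi>. \<phi> \<in> hom S H \<and> \<phi> \<in> extensional (carrier S) \<and> continuous_map T TH \<phi> \<and>
    (\<forall>x. \<phi> (\<iota> x) = f x)"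
  let ?Q = "\<lambda>\<phi>. \<phi> \<in> hom S H' \<and> \<phi> \<in> extensional (carrier S) \<and> continuous_map T TH' \<phi> \<and>
    (\<forall>x. \<phi> (\<iota> x) = (e \<circ> f) x)"
  have "range (e \<circ> f) \<subseteq> carrier H'" using f e_hom by (auto simp: hom_def)
  then have ex1: "\<exists>!\<phi>. ?Q \<phi>" using S H' unfolding free_profinite_group_def by blast
  \<comment> \<open>Composing with e turns lifts to H into lifts to H', so the injectivity of e
    brings uniqueness back to H.\<close>
  have Q: "?Q (restrict (e \<circ> \<phi>) (carrier S))" if "?P \<phi>" for \<phi>
  proof (intro conjI allI)
    have "e \<circ> \<phi> \<in> hom S H'" using that e_hom by (metis Group.hom_compose)
    then show "restrict (e \<circ> \<phi>) (carrier S) \<in> hom S H'" by (auto simp: hom_def)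
    have "continuous_map T TH' (e \<circ> \<phi>)" using that e_cont by (metis continuous_map_compose)
    then show "continuous_map T TH' (restrict (e \<circ> \<phi>) (carrier S))"
      by (rule continuous_map_eq) (simp add: topS)
    show "restrict (e \<circ> \<phi>) (carrier S) (\<iota> x) = (e \<circ> f) x" for x using that \<iota> by simp
  qed simp
  show ?thesis
  proof (rule ex_ex1I)
    from ex1 obtain \<phi> where \<phi>: "?Q \<phi>" by blast
    have \<phi>_closed: "\<phi> g \<in> carrier H'" if "g \<in> carrier S" for g using \<phi> that by (auto simp: hom_def)
    have "?P (restrict (d \<circ> \<phi>) (carrier S))"
    proof (intro conjI allI)
      show "restrict (d \<circ> \<phi>) (carrier S) \<in> hom S H"
        using \<phi> by (auto simp: hom_def d_mult d_closed Pi_iff)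
      have "continuous_map T TH (d \<circ> \<phi>)" using \<phi> d_cont by (metis continuous_map_compose)
      then show "continuous_map T TH (restrict (d \<circ> \<phi>) (carrier S))"
        by (rule continuous_map_eq) (simp add: topS)
      show "restrict (d \<circ> \<phi>) (carrier S) (\<iota> x) = f x" for x
        using \<phi> \<iota> de[of "f x"] f by (simp add: image_subset_iff)
    qed simp
    then show "\<exists>\<phi>. ?P \<phi>" by blast
  next
    fix \<phi> \<phi>' assume P: "?P \<phi>" "?P \<phi>'"
    have eq: "restrict (e \<circ> \<phi>) (carrier S) = restrict (e \<circ> \<phi>') (carrier S)"
      using Q[OF P(1)] Q[OF P(2)] ex1 by blast
    show "\<phi> = \<phi>'"
    proof (rule extensionalityI[of _ "carrier S"])
      fix g assume g: "g \<in> carrier S"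
      then have "e (\<phi> g) = e (\<phi>' g)" using fun_cong[OF eq, of g] by simp
      moreover have "\<phi> g \<in> carrier H" "\<phi>' g \<in> carrier H" using P g by (auto simp: hom_def)
      ultimately show "\<phi> g = \<phi>' g" using e by (auto dest: inj_onD)
    qed (use P in auto)
  qed
qed

section \<open>The Magnus homomorphism\<close>

locale nc_residue_series =
  fixes m :: int and NC :: "('x::finite list \<Rightarrow> int) ring"
  assumes m_gt_1: "1 < m"
  defines "NC \<equiv> nc_series (residue_ring m)"
begin

abbreviation mult_NC (infixl "\<star>" 70) where "f \<star> g \<equiv> f \<otimes>\<^bsub>NC\<^esub> g"

abbreviation "Mag S T \<iota> \<equiv> magnus S T \<iota> (residue_ring m)"

abbreviation "TN \<equiv> nc_series_topology (residue_ring m) :: ('x list \<Rightarrow> int) topology"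

lemma carrier_NC: "f \<in> carrier NC \<longleftrightarrow> (\<forall>w. f w \<in> {0..m - 1})"
  by (auto simp: NC_def nc_series_def residue_ring_simps)

lemma mod_NC: "f \<in> carrier NC \<Longrightarrow> f w mod m = f w"
  by (simp add: carrier_NC)

lemma NC_eqI:
  assumes "f \<in> carrier NC" "g \<in> carrier NC" "\<And>w. f w mod m = g w mod m"
  shows "f = g"
  using assms by (simp add: mod_NC fun_eq_iff)

lemma mult_NC:
  assumes "f \<in> carrier NC" "g \<in> carrier NC"
  shows "(f \<star> g) w = (\<Sum>i\<le>length w. f (take i w) * g (drop i w)) mod m"
proof -
  have "(f \<star> g) w = (\<Sum>i\<le>length w. (f (take i w) * g (drop i w)) mod m) mod m"
    using m_gt_1 by (simp add: NC_def nc_series_def residue_ring_simps residue_ring_finsum)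
  then show ?thesis by (simp add: mod_sum_eq)
qed

lemma one_NC: "\<one>\<^bsub>NC\<^esub> w = (if w = [] then 1 else 0)"
  by (simp add: NC_def nc_series_def residue_ring_simps)

lemma one_NC_closed: "\<one>\<^bsub>NC\<^esub> \<in> carrier NC"
  using m_gt_1 by (auto simp: carrier_NC one_NC)

lemma mult_NC_closed: "f \<in> carrier NC \<Longrightarrow> g \<in> carrier NC \<Longrightarrow> f \<star> g \<in> carrier NC"
  using mod_in_residues[OF m_gt_1] unfolding carrier_NC[of "f \<star> g"] by (simp only: mult_NC simp_thms)

text \<open>Both sides sum over the factorizations of w into three consecutive words; the triangle
  reindexing changes the order in which the two cuts are chosen.\<close>

lemma convolution_assoc:
  fixes f g h :: "'x list \<Rightarrow> int"
  shows "(\<Sum>i\<le>length w. (\<Sum>j\<le>length (take i w). f (take j (take i w)) * g (drop j (take i w))) * h (drop i w)) =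
    (\<Sum>j\<le>length w. f (take j w) * (\<Sum>k\<le>length (drop j w). g (take k (drop j w)) * h (drop k (drop j w))))"
proof -
  let ?G = "\<lambda>j k. f (take j w) * g (take k (drop j w)) * h (drop (j + k) w)"
  have "(\<Sum>i\<le>length w. (\<Sum>j\<le>length (take i w). f (take j (take i w)) * g (drop j (take i w))) * h (drop i w)) =
      (\<Sum>i\<le>length w. \<Sum>j\<le>i. ?G j (i - j))"
    by (intro sum.cong refl) (auto simp: sum_distrib_right min_def drop_take intro!: sum.cong)
  also have "\<dots> = (\<Sum>(i, j)\<in>{(i, j). i + j \<le> length w}. ?G i j)"
    by (simp only: sum.triangle_reindex_eq)
  also have "{(i, j). i + j \<le> length w} = Sigma {..length w} (\<lambda>i. {..length w - i})" by auto
  also have "(\<Sum>(i, j)\<in>Sigma {..length w} (\<lambda>i. {..length w - i}). ?G i j) =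
      (\<Sum>i\<le>length w. \<Sum>j\<le>length w - i. ?G i j)"
    by (subst sum.Sigma) auto
  also have "\<dots> = (\<Sum>j\<le>length w. f (take j w) * (\<Sum>k\<le>length (drop j w). g (take k (drop j w)) * h (drop k (drop j w))))"
    by (intro sum.cong refl) (simp add: sum_distrib_left mult.assoc add.commute)
  finally show ?thesis .
qed

sublocale monoid NC
proof
  fix f g h assume fgh[simp]: "f \<in> carrier NC" "g \<in> carrier NC" "h \<in> carrier NC"
  show "f \<star> g \<star> h = f \<star> (g \<star> h)"
  proof (rule NC_eqI)
    fix w
    have "(f \<star> g \<star> h) w = (\<Sum>i\<le>length w. (f \<star> g) (take i w) * h (drop i w)) mod m"
      by (simp add: mult_NC mult_NC_closed)
    also have "\<dots> = (\<Sum>i\<le>length w. (\<Sum>j\<le>length (take i w). f (take j (take i w)) * g (drop j (take i w))) * h (drop i w)) mod m"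
      by (intro mod_sum_mult_cong) (simp_all only: mult_NC[OF fgh(1,2)] mod_mod_trivial)
    also have "\<dots> = (\<Sum>j\<le>length w. f (take j w) * (\<Sum>k\<le>length (drop j w). g (take k (drop j w)) * h (drop k (drop j w)))) mod m"
      by (simp only: convolution_assoc)
    also have "\<dots> = (\<Sum>j\<le>length w. f (take j w) * (g \<star> h) (drop j w)) mod m"
      by (intro mod_sum_mult_cong) (simp_all only: mult_NC[OF fgh(2,3)] mod_mod_trivial)
    also have "\<dots> = (f \<star> (g \<star> h)) w"
      by (simp add: mult_NC mult_NC_closed)
    finally show "(f \<star> g \<star> h) w mod m = (f \<star> (g \<star> h)) w mod m" by simp
  qed (simp_all add: mult_NC_closed)
next
  fix f assume [simp]: "f \<in> carrier NC"
  show "\<one>\<^bsub>NC\<^esub> \<star> f = f"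
  proof (rule NC_eqI)
    fix w
    have "(\<Sum>i\<le>length w. \<one>\<^bsub>NC\<^esub> (take i w) * f (drop i w)) = (\<Sum>i\<le>length w. if i = 0 then f w else 0)"
      by (intro sum.cong) (auto simp: one_NC)
    then show "(\<one>\<^bsub>NC\<^esub> \<star> f) w mod m = f w mod m"
      by (simp add: mult_NC one_NC_closed)
  qed (simp_all add: mult_NC_closed one_NC_closed)
  show "f \<star> \<one>\<^bsub>NC\<^esub> = f"
  proof (rule NC_eqI)
    fix w
    have "(\<Sum>i\<le>length w. f (take i w) * \<one>\<^bsub>NC\<^esub> (drop i w)) = (\<Sum>i\<le>length w. if i = length w then f w else 0)"
      by (intro sum.cong) (auto simp: one_NC)
    then show "(f \<star> \<one>\<^bsub>NC\<^esub>) w mod m = f w mod m"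
      by (simp add: mult_NC one_NC_closed)
  qed (simp_all add: mult_NC_closed one_NC_closed)
qed (simp_all add: mult_NC_closed one_NC_closed)

section \<open>The profinite topology on power series\<close>

lemma topspace_TN: "topspace TN = carrier NC"
  by (auto simp: nc_series_topology_def carrier_NC residue_ring_simps PiE_iff)

lemma continuous_coeff: "continuous_map TN (discrete_topology {0..m - 1}) (\<lambda>f. f w)"
  unfolding nc_series_topology_def residue_ring_simps
  by (rule continuous_map_product_projection) simp

lemma continuous_sum_discrete:
  fixes F :: "'i \<Rightarrow> 'b \<Rightarrow> int"
  assumes "finite A" "\<And>i. i \<in> A \<Longrightarrow> continuous_map X (discrete_topology UNIV) (F i)"
  shows "continuous_map X (discrete_topology UNIV) (\<lambda>x. \<Sum>i\<in>A. F i x)"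
  using assms
proof (induction A rule: finite_induct)
  case (insert i A)
  have "continuous_map X (discrete_topology UNIV) (\<lambda>x. F i x + (\<Sum>i\<in>A. F i x))"
    using insert by (intro continuous_map_discrete_binop[where F = "(+)"]) auto
  then show ?case using insert by simp
qed simp

lemma continuous_mult_NC: "continuous_map (prod_topology TN TN) TN (\<lambda>(f, g). f \<star> g)"
proof -
  have c: "continuous_map (prod_topology TN TN) (discrete_topology {0..m - 1}) (\<lambda>q. fst q w)"
     "continuous_map (prod_topology TN TN) (discrete_topology {0..m - 1}) (\<lambda>q. snd q w)" for w
    using continuous_map_compose[OF continuous_map_fst continuous_coeff]
      continuous_map_compose[OF continuous_map_snd continuous_coeff] by (simp_all add: o_def)
  have "continuous_map (prod_topology TN TN) (discrete_topology {0..m - 1})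
      (\<lambda>q. (fst q \<star> snd q) w)" for w
  proof -
    have "continuous_map (prod_topology TN TN) (discrete_topology UNIV)
        (\<lambda>q. \<Sum>i\<le>length w. fst q (take i w) * snd q (drop i w))"
      by (intro continuous_sum_discrete continuous_map_discrete_binop[OF c, where F = "(*)"]) auto
    from continuous_map_discrete_binop[OF this this, where F = "\<lambda>a _. a mod m" and C = "{0..m - 1}"]
    have "continuous_map (prod_topology TN TN) (discrete_topology {0..m - 1})
        (\<lambda>q. (\<Sum>i\<le>length w. fst q (take i w) * snd q (drop i w)) mod m)"
      using mod_in_residues[OF m_gt_1] by simp
    then show ?thesis
      by (rule continuous_map_eq) (auto simp: topspace_TN mult_NC)
  qed
  then have "continuous_map (prod_topology TN TN) (product_topology (\<lambda>_. discrete_topology {0..m - 1}) UNIV)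
      (\<lambda>q. fst q \<star> snd q)"
    by (simp add: continuous_map_componentwise_UNIV)
  then show ?thesis by (simp add: nc_series_topology_def residue_ring_simps case_prod_unfold)
qed

lemma compact_TN: "compact_space TN" and Hausdorff_TN: "Hausdorff_space TN"
  by (auto simp: nc_series_topology_def residue_ring_simps compact_space_product_topology
      compact_space_discrete_topology Hausdorff_space_product_topology)

lemma disconnected_TN:
  assumes "connectedin TN A"
  shows "\<exists>a. A \<subseteq> {a}"
proof (rule ccontr)
  assume "\<not> (\<exists>a. A \<subseteq> {a})"
  then obtain f g where fg: "f \<in> A" "g \<in> A" "f \<noteq> g" by blast
  then obtain w where w: "f w \<noteq> g w" by blast
  have "connectedin (discrete_topology {0..m - 1}) ((\<lambda>f. f w) ` A)"
    using connectedin_continuous_map_image[OF continuous_coeff assms] .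
  then obtain a where "(\<lambda>f. f w) ` A \<subseteq> {a}" by (auto simp: connectedin_discrete_topology)
  then show False using fg w by blast
qed

lemma profinite_Units: "profinite_group (units_of NC) (subtopology TN (Units NC))"
  by (rule profinite_units[OF monoid_axioms topspace_TN continuous_mult_NC compact_TN Hausdorff_TN
        disconnected_TN])

definition one_plus :: "'x \<Rightarrow> 'x list \<Rightarrow> int" where
  "one_plus x = \<one>\<^bsub>NC\<^esub> \<oplus>\<^bsub>NC\<^esub> nc_var (residue_ring m) x"

lemma one_plus_eq: "one_plus x w = (if w = [] \<or> w = [x] then 1 else 0)"
  using m_gt_1
  by (auto simp: one_plus_def NC_def nc_series_def nc_var_def residue_ring_simps)

lemma one_plus_closed: "one_plus x \<in> carrier NC"
  using m_gt_1 by (auto simp: carrier_NC one_plus_eq)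

text \<open>Reversal of words is an anti-automorphism of the series. It will turn a right inverse of
  1 + x into a left inverse, as both series are fixed by reversal.\<close>

lemma mult_NC_rev:
  assumes "f \<in> carrier NC" "g \<in> carrier NC"
  shows "(f \<star> g) (rev w) = ((g \<circ> rev) \<star> (f \<circ> rev)) w"
proof -
  have "(\<Sum>i\<le>length w. f (take i (rev w)) * g (drop i (rev w))) =
      (\<Sum>i\<le>length w. f (take (length w - i) (rev w)) * g (drop (length w - i) (rev w)))"
    by (rule sum.nat_diff_reindex[symmetric, of _ "Suc (length w)", unfolded lessThan_Suc_atMost, simplified])
  also have "\<dots> = (\<Sum>i\<le>length w. (g \<circ> rev) (take i w) * (f \<circ> rev) (drop i w))"
    by (intro sum.cong) (auto simp: take_rev drop_rev)
  finally show ?thesis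
    using assms mult_NC[of "g \<circ> rev" "f \<circ> rev"] by (simp add: mult_NC carrier_NC)
qed

text \<open>The inverse of \<open>1 + x\<close> is the geometric series in \<open>-x\<close>.\<close>

lemma one_plus_Units: "one_plus x \<in> Units NC"
proof -
  define g where "g = (\<lambda>w. if w = replicate (length w) x then ((- 1) ^ length w) mod m else 0)"
  have g: "g \<in> carrier NC"
    using mod_in_residues[OF m_gt_1] m_gt_1 by (auto simp: carrier_NC g_def)
  have right: "one_plus x \<star> g = \<one>\<^bsub>NC\<^esub>"
  proof (rule NC_eqI)
    fix w
    show "(one_plus x \<star> g) w mod m = \<one>\<^bsub>NC\<^esub> w mod m"
    proof (cases w)
      case Nil
      have "g [] = 1 mod m" by (simp add: g_def)
      with Nil show ?thesis by (simp add: mult_NC[OF one_plus_closed g] one_plus_eq one_NC)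
    next
      case (Cons y u)
      \<comment> \<open>Only the cuts after no letter and after one letter can meet the support of 1
        + x, and their contributions cancel.\<close>
      have "(\<Sum>i\<le>length w. one_plus x (take i w) * g (drop i w)) =
          (\<Sum>i\<le>length w. (if i = 0 then g w else 0) + (if i = 1 then (if y = x then g u else 0) else 0))"
      proof (rule sum.cong)
        fix i assume "i \<in> {..length w}"
        then show "one_plus x (take i w) * g (drop i w) =
            (if i = 0 then g w else 0) + (if i = 1 then (if y = x then g u else 0) else 0)"
          using Cons by (cases i; cases "i - 1") (auto simp: one_plus_eq)
      qed simp
      also have "\<dots> = g w + (if y = x then g u else 0)"
        using Cons by (simp add: sum.distrib del: sum.atMost_Suc)
      also have "\<dots> mod m = 0"
        using Cons by (auto simp: g_def mod_simps)
      finally show ?thesis using Cons by (simp add: mult_NC g one_plus_closed one_NC)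
    qed
  qed (simp_all add: g one_plus_closed mult_NC_closed one_NC_closed)
  have rev: "one_plus x \<circ> rev = one_plus x" "g \<circ> rev = g"
    by (auto simp: fun_eq_iff one_plus_eq g_def) (metis rev_replicate rev_rev_ident length_rev)+
  have left: "g \<star> one_plus x = \<one>\<^bsub>NC\<^esub>"
  proof
    fix w
    have "(g \<star> one_plus x) (rev (rev w)) = (one_plus x \<star> g) (rev w)"
      using mult_NC_rev[OF g one_plus_closed, of x "rev w"] by (simp only: rev)
    then show "(g \<star> one_plus x) w = \<one>\<^bsub>NC\<^esub> w" by (simp add: right one_NC)
  qed
  show ?thesis using g one_plus_closed left right by (auto simp: Units_def)
qed

lemma principal_units_subgroup: "subgroup {f \<in> Units NC. f [] = 1} (units_of NC)"
proof -
  interpret UG: group "units_of NC" by (rule units_group)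
  have Nil: "(f \<star> g) [] = (f [] * g []) mod m" if "f \<in> Units NC" "g \<in> Units NC" for f g
    using that by (simp add: mult_NC Units_closed)
  show ?thesis
  proof
    show "{f \<in> Units NC. f [] = 1} \<subseteq> carrier (units_of NC)" by (auto simp: units_of_carrier)
    show "f \<otimes>\<^bsub>units_of NC\<^esub> g \<in> {f \<in> Units NC. f [] = 1}"
      if "f \<in> {f \<in> Units NC. f [] = 1}" "g \<in> {f \<in> Units NC. f [] = 1}" for f g
      using that m_gt_1 by (simp add: units_of_mult Nil)
    show "\<one>\<^bsub>units_of NC\<^esub> \<in> {f \<in> Units NC. f [] = 1}"
      by (simp add: units_of_one one_NC)
    show "inv\<^bsub>units_of NC\<^esub> f \<in> {f \<in> Units NC. f [] = 1}" if "f \<in> {f \<in> Units NC. f [] = 1}" for f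
    proof -
      have f: "f \<in> Units NC" "f [] = 1" using that by auto
      have "(f \<star> inv\<^bsub>NC\<^esub> f) [] = 1" using f by (simp add: one_NC)
      then have "(inv\<^bsub>NC\<^esub> f) [] = 1"
        using Nil[of f "inv\<^bsub>NC\<^esub> f"] f mod_NC[of "inv\<^bsub>NC\<^esub> f"] by simp
      then show ?thesis using f by (simp add: units_of_inv)
    qed
  qed
qed

text \<open>Words over a finite alphabet and integers are countable, so the graph of a series is
  coded by a set of natural numbers. This is the injection that \<open>free_profinite_lift\<close>
  asks for.\<close>

definition graph_code :: "('x list \<Rightarrow> int) \<Rightarrow> nat set" where
  "graph_code f = range (\<lambda>w. to_nat (w, f w))"

lemma inj_graph_code: "inj_on graph_code A"
proof (rule inj_onI, rule ext)
  fix f g w assume "graph_code f = graph_code g"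
  then have "to_nat (w, f w) \<in> range (\<lambda>w. to_nat (w, g w))" by (auto simp: graph_code_def)
  then show "f w = g w" by auto
qed

text \<open>The universal property for \<open>1 + I\<close>, \<open>I\<close> the augmentation ideal, shows that constant terms
  are \<open>1\<close>.\<close>

lemma magnus_props:
  assumes S: "free_profinite_group S T \<iota>"
  defines "\<mu> \<equiv> Mag S T \<iota>"
  shows "\<mu> \<in> hom S (units_of NC)"
    and "continuous_map T (subtopology TN (Units NC)) \<mu>"
    and "\<And>x. \<mu> (\<iota> x) = one_plus x"
    and "\<And>\<sigma>. \<sigma> \<in> carrier S \<Longrightarrow> \<mu> \<sigma> [] = 1"
proof -
  let ?P = "\<lambda>\<phi>. \<phi> \<in> hom S (units_of NC) \<and> \<phi> \<in> extensional (carrier S) \<and>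
        continuous_map T (subtopology TN (Units NC)) \<phi> \<and> (\<forall>x. \<phi> (\<iota> x) = one_plus x)"
  have UC: "carrier (units_of NC) = Units NC" by (rule units_of_carrier)
  have ex1: "\<exists>!\<phi>. ?P \<phi>"
    using one_plus_Units by (intro free_profinite_lift[OF S profinite_Units inj_graph_code]) (auto simp: UC)
  have \<mu>: "\<mu> = (THE \<phi>. ?P \<phi>)"
    by (simp add: \<mu>_def magnus_def NC_def one_plus_def)
  have P\<mu>: "?P \<mu>" unfolding \<mu> using ex1 by (rule theI')
  then show "\<mu> \<in> hom S (units_of NC)" "continuous_map T (subtopology TN (Units NC)) \<mu>"
    "\<And>x. \<mu> (\<iota> x) = one_plus x" by auto
  let ?K = "{f \<in> Units NC. f [] = 1}"
  have UN: "Units NC \<subseteq> topspace TN" by (auto simp: topspace_TN)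
  have "closedin (subtopology TN (Units NC)) {f \<in> topspace (subtopology TN (Units NC)). f [] \<in> {1}}"
    using m_gt_1 by (intro closedin_continuous_map_preimage[OF continuous_map_from_subtopology[OF continuous_coeff]]) auto
  moreover have "{f \<in> topspace (subtopology TN (Units NC)). f [] \<in> {1}} = ?K" using UN by auto
  ultimately have clK: "closedin (subtopology TN (Units NC)) ?K" by simp
  have proK: "profinite_group ((units_of NC)\<lparr>carrier := ?K\<rparr>) (subtopology (subtopology TN (Units NC)) ?K)"
    by (rule profinite_closed_subgroup[OF profinite_Units principal_units_subgroup clK])
  have "range one_plus \<subseteq> carrier ((units_of NC)\<lparr>carrier := ?K\<rparr>)"
    using one_plus_Units by (auto simp: one_plus_eq)
  from free_profinite_lift[OF S proK inj_graph_code this]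
  obtain \<phi> where \<phi>: "\<phi> \<in> hom S ((units_of NC)\<lparr>carrier := ?K\<rparr>)" "\<phi> \<in> extensional (carrier S)"
    "continuous_map T (subtopology (subtopology TN (Units NC)) ?K) \<phi>" "\<And>x. \<phi> (\<iota> x) = one_plus x"
    by blast
  have "\<phi> \<in> hom S (units_of NC)" using \<phi>(1) by (auto simp: hom_def UC)
  moreover have "continuous_map T (subtopology TN (Units NC)) \<phi>"
    using \<phi>(3) by (simp add: continuous_map_in_subtopology)
  ultimately have "?P \<phi>" using \<phi> by blast
  \<comment> \<open>Regarded as a map into all units, the lift into the principal units has the
    property that characterizes \<open>\<mu>\<close>.\<close>
  then have "\<mu> = \<phi>" using ex1 P\<mu> by blast
  then show "\<mu> \<sigma> [] = 1" if "\<sigma> \<in> carrier S" for \<sigma> using \<phi>(1) that by (auto simp: hom_def)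
qed

end

section \<open>Leading coefficients\<close>

lemma sum_split_ends:
  fixes F :: "nat \<Rightarrow> int"
  assumes "0 < k"
  shows "(\<Sum>i\<le>k. F i) = F 0 + F k + (\<Sum>i\<in>{0<..<k}. F i)"
proof -
  have "{..k} = insert 0 (insert k {0<..<k})" using assms by auto
  then show ?thesis using assms by simp
qed

context nc_residue_series
begin

text \<open>Over Z/m, f is 1 + L plus terms of degree above a. L takes integer values and is
  compared with f only modulo m, so that a single L can be leading for all moduli at once.\<close>

definition leading :: "nat \<Rightarrow> ('x list \<Rightarrow> int) \<Rightarrow> ('x list \<Rightarrow> int) \<Rightarrow> bool" where
  "leading a f L \<longleftrightarrow> f \<in> carrier NC \<and> f [] = 1 \<and>
     (\<forall>v. 0 < length v \<and> length v < a \<longrightarrow> f v = 0) \<and> (\<forall>v. length v = a \<longrightarrow> f v = L v mod m)"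

lemma mult_NC_ends:
  assumes "f \<in> carrier NC" "g \<in> carrier NC" "f [] = 1" "g [] = 1" "0 < length v"
  shows "(f \<star> g) v =
    (f v + g v + (\<Sum>i\<in>{0<..<length v}. f (take i v) * g (drop i v))) mod m"
proof -
  have "(\<Sum>i\<le>length v. f (take i v) * g (drop i v)) =
      g v + f v + (\<Sum>i\<in>{0<..<length v}. f (take i v) * g (drop i v))"
    using assms by (subst sum_split_ends) simp_all
  then show ?thesis using assms by (simp add: mult_NC add.commute)
qed

lemma leading_mult:
  assumes f: "leading a f L" and g: "leading a g K" and a: "0 < a"
  shows "leading a (f \<star> g) (\<lambda>v. L v + K v)"
proof -
  have c: "f \<in> carrier NC" "g \<in> carrier NC" "f [] = 1" "g [] = 1"
    using f g by (auto simp: leading_def)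
  have prod: "(f \<star> g) v = (f v + g v) mod m" if "0 < length v" "length v \<le> a" for v
  proof -
    have "(\<Sum>i\<in>{0<..<length v}. f (take i v) * g (drop i v)) = 0"
      using f that by (intro sum.neutral) (auto simp: leading_def)
    then show ?thesis using mult_NC_ends[OF c that(1)] by simp
  qed
  have "(f \<star> g) [] = 1" using c m_gt_1 by (simp add: mult_NC)
  moreover have "(f \<star> g) v = 0" if "0 < length v" "length v < a" for v
    using prod[of v] f g that by (simp add: leading_def)
  moreover have "(f \<star> g) v = (L v + K v) mod m" if "length v = a" for v
    using prod[of v] f g that a by (simp add: leading_def mod_simps)
  ultimately show ?thesis using c by (auto simp: leading_def)
qed

lemma leading_one: "0 < a \<Longrightarrow> leading a \<one>\<^bsub>NC\<^esub> (\<lambda>_. 0)"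
  by (auto simp: leading_def one_NC)

text \<open>An interior cut at i contributes only if i >= a and |v| - i >= b; for words of length at
  most a + b this forces |v| = a + b and i = a.\<close>

lemma leading_product_coeff:
  assumes f: "leading a f L" and g: "leading b g K" and ab: "0 < a" "0 < b"
    and v: "0 < length v" "length v \<le> a + b"
  shows "(f \<star> g) v =
    (f v + g v + (if length v = a + b then L (take a v) * K (drop a v) else 0)) mod m"
proof -
  have c: "f \<in> carrier NC" "g \<in> carrier NC" "f [] = 1" "g [] = 1"
    using f g by (auto simp: leading_def)
  let ?M = "\<Sum>i\<in>{0<..<length v}. f (take i v) * g (drop i v)"
  have 0: "f (take i v) * g (drop i v) = 0"
    if i: "0 < i" "i < length v" "i < a \<or> length v - i < b" for i
    using i(3)
  proof
    assume "i < a"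
    then have "0 < length (take i v)" "length (take i v) < a" using i by auto
    then have "f (take i v) = 0" using f unfolding leading_def by blast
    then show ?thesis by simp
  next
    assume "length v - i < b"
    then have "0 < length (drop i v)" "length (drop i v) < b" using i by auto
    then have "g (drop i v) = 0" using g unfolding leading_def by blast
    then show ?thesis by simp
  qed
  have "?M mod m = (if length v = a + b then L (take a v) * K (drop a v) else 0) mod m"
  proof (cases "length v = a + b")
    case False
    then have "?M = 0" using v by (intro sum.neutral ballI 0) auto
    then show ?thesis using False by simp
  next
    case True
    have "?M = (\<Sum>i\<in>{0<..<length v}. if i = a then f (take a v) * g (drop a v) else 0)"
    proof (rule sum.cong)
      fix i assume i: "i \<in> {0<..<length v}"
      show "f (take i v) * g (drop i v) = (if i = a then f (take a v) * g (drop a v) else 0)"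
      proof (cases "i = a")
        case False
        then have "i < a \<or> length v - i < b" using True i by auto
        then show ?thesis using 0[of i] False i by simp
      qed simp
    qed simp
    also have "\<dots> = f (take a v) * g (drop a v)" using True ab by simp
    also have "\<dots> = (L (take a v) mod m) * (K (drop a v) mod m)"
      using f g True by (simp add: leading_def)
    finally show ?thesis using True by (simp add: mod_mult_eq)
  qed
  then show ?thesis unfolding mult_NC_ends[OF c v(1)] by (intro mod_add_cong) simp_all
qed

text \<open>Comparing coefficients in fg = gfh avoids inverting series: f v + g v occurs on both
  sides, and the cross terms of fg and gf leave the Lie bracket LK - KL.\<close>

lemma leading_commutator:
  assumes f: "leading a f L" and g: "leading b g K" and ab: "0 < a" "0 < b"
    and h: "h \<in> carrier NC" "h [] = 1" and eq: "f \<star> g = g \<star> f \<star> h"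
  shows "leading (a + b) h (\<lambda>v. L (take a v) * K (drop a v) - K (take b v) * L (drop b v))"
proof -
  have c: "f \<in> carrier NC" "g \<in> carrier NC" "f [] = 1" "g [] = 1"
    using f g by (auto simp: leading_def)
  have q: "g \<star> f \<in> carrier NC" "(g \<star> f) [] = 1"
    using c m_gt_1 by (auto simp: mult_NC)
  let ?D = "\<lambda>v. if length v = a + b
     then L (take a v) * K (drop a v) - K (take b v) * L (drop b v) else 0"
  have main: "h v = ?D v mod m" if "0 < length v" "length v \<le> a + b" for v
    using that
  proof (induction "length v" arbitrary: v rule: less_induct)
    case less
    \<comment> \<open>Proper suffixes of v are shorter than a + b, where h vanishes by induction, so
      the factor h enters only through h v itself.\<close>
    have "h (drop i v) = 0" if "i \<in> {0<..<length v}" for i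
    proof -
      have "h (drop i v) = ?D (drop i v) mod m" using that less.prems by (intro less.hyps) auto
      moreover have "length (drop i v) \<noteq> a + b" using that less.prems by auto
      ultimately show ?thesis by simp
    qed
    then have "(\<Sum>i\<in>{0<..<length v}. (g \<star> f) (take i v) * h (drop i v)) = 0"
      by (intro sum.neutral) simp
    then have "(f \<star> g) v = ((g \<star> f) v + h v) mod m"
      unfolding eq using mult_NC_ends[OF q(1) h(1) q(2) h(2) less.prems(1)] by simp
    then have "(f v + g v + (if length v = a + b then L (take a v) * K (drop a v) else 0)) mod m =
        (g v + f v + (if length v = b + a then K (take b v) * L (drop b v) else 0) + h v) mod m"
      using leading_product_coeff[OF f g ab less.prems]
        leading_product_coeff[OF g f ab(2,1) less.prems(1)] less.prems(2)
      by (simp add: mod_simps add.commute[of b a])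
    then have "m dvd (f v + g v + (if length v = a + b then L (take a v) * K (drop a v) else 0)) -
        (g v + f v + (if length v = b + a then K (take b v) * L (drop b v) else 0) + h v)"
      by (simp only: mod_eq_dvd_iff)
    also have "(f v + g v + (if length v = a + b then L (take a v) * K (drop a v) else 0)) -
        (g v + f v + (if length v = b + a then K (take b v) * L (drop b v) else 0) + h v) = ?D v - h v"
      by (simp add: add.commute[of b a])
    finally have "?D v mod m = h v mod m" by (simp only: mod_eq_dvd_iff)
    then show ?case using mod_NC[OF h(1)] by simp
  qed
  have "h v = (L (take a v) * K (drop a v) - K (take b v) * L (drop b v)) mod m"
    if "length v = a + b" for v
  proof -
    have "0 < length v" using that ab by linarith
    then show ?thesis using main[of v] that by simp
  qed
  moreover have "h v = 0" if "0 < length v" "length v < a + b" for v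
    using main[of v] that by simp
  ultimately show ?thesis unfolding leading_def using h by blast
qed

section \<open>Leading forms under the Magnus homomorphism\<close>

lemma magnus_mult:
  assumes S: "free_profinite_group S T \<iota>" and "\<sigma> \<in> carrier S" "\<tau> \<in> carrier S"
  shows "Mag S T \<iota> (\<sigma> \<otimes>\<^bsub>S\<^esub> \<tau>) =
    Mag S T \<iota> \<sigma> \<star> Mag S T \<iota> \<tau>"
  using magnus_props(1)[OF S] assms by (simp add: hom_mult units_of_mult)

lemma magnus_closed:
  assumes "free_profinite_group S T \<iota>" "\<sigma> \<in> carrier S"
  shows "Mag S T \<iota> \<sigma> \<in> carrier NC"
  using magnus_props(1)[OF assms(1)] assms(2) by (auto simp: hom_def units_of_carrier Units_def)

lemma magnus_one:
  assumes S: "free_profinite_group S T \<iota>"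
  shows "Mag S T \<iota> \<one>\<^bsub>S\<^esub> = \<one>\<^bsub>NC\<^esub>"
proof -
  interpret S: group S using S by (simp add: free_profinite_group_def profinite_group_def)
  interpret UG: group "units_of NC" by (rule units_group)
  show ?thesis
    using hom_one[OF magnus_props(1)[OF S] S.is_group UG.is_group] by (simp add: units_of_one)
qed

lemma leading_pow:
  assumes S: "free_profinite_group S T \<iota>" and \<sigma>: "\<sigma> \<in> carrier S" and a: "0 < a"
    and L: "leading a (Mag S T \<iota> \<sigma>) L"
  shows "leading a (Mag S T \<iota> (\<sigma> [^]\<^bsub>S\<^esub> (k::nat))) (\<lambda>v. int k * L v)"
proof (induction k)
  interpret S: group S using S by (simp add: free_profinite_group_def profinite_group_def)
  case 0
  show ?case using leading_one[OF a] magnus_one[OF S] by simp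
next
  interpret S: group S using S by (simp add: free_profinite_group_def profinite_group_def)
  case (Suc k)
  have "(\<lambda>v. int k * L v + L v) = (\<lambda>v. int (Suc k) * L v)" by (simp add: fun_eq_iff algebra_simps)
  then show ?case
    using leading_mult[OF Suc L a] magnus_mult[OF S _ \<sigma>] \<sigma> by simp
qed

end

text \<open>The leading form of \<open>Mag(\<tau>\<^sub>w)\<close> is the reduction of an integral Lie polynomial that does not
  depend on the coefficient ring.\<close>

lemma lyndon_tau_leading:
  fixes \<iota> :: "'x::{finite,linorder} \<Rightarrow> 'g"
  assumes S: "free_profinite_group S T \<iota>" and "w \<noteq> []"
  shows "\<exists>L. \<forall>m>1. nc_residue_series.leading m (length w)
    (magnus S T \<iota> (residue_ring m) (lyndon_tau S \<iota> w)) L"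
  using assms(2)
proof (induction "length w" arbitrary: w rule: less_induct)
  case less
  interpret S: group S using S by (simp add: free_profinite_group_def profinite_group_def)
  have \<iota>: "range \<iota> \<subseteq> carrier S" using S by (simp add: free_profinite_group_def)
  show ?case
  proof (cases "length w = 1")
    case True
    then obtain x where x: "w = [x]" by (cases w) auto
    show ?thesis
    proof (intro exI allI impI)
      fix m :: int assume "1 < m"
      then interpret nc_residue_series m "nc_series (residue_ring m)" by unfold_locales
      have "lyndon_tau S \<iota> w = \<iota> x" by (subst lyndon_tau.simps) (simp add: x)
      then show "leading (length w) (magnus S T \<iota> (residue_ring m) (lyndon_tau S \<iota> w))
          (\<lambda>v. if v = [x] then 1 else 0)"
        using magnus_props(3)[OF S] one_plus_closed[of x] m_gt_1 x
        by (auto simp: leading_def one_plus_eq)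
    qed
  next
    case False
    then have w: "2 \<le> length w" using less.prems by (cases w) (auto simp: Suc_le_eq)
    let ?u = "take (std_split w) w" and ?v = "drop (std_split w) w"
    have uv: "?u \<noteq> []" "?v \<noteq> []" "length ?u < length w" "length ?v < length w"
      "length ?u + length ?v = length w"
      using std_split_bounds[OF w] by auto
    obtain L where L: "\<forall>m>1. nc_residue_series.leading m (length ?u)
        (magnus S T \<iota> (residue_ring m) (lyndon_tau S \<iota> ?u)) L"
      using less.hyps[OF uv(3) uv(1)] by blast
    obtain K where K: "\<forall>m>1. nc_residue_series.leading m (length ?v)
        (magnus S T \<iota> (residue_ring m) (lyndon_tau S \<iota> ?v)) K"
      using less.hyps[OF uv(4) uv(2)] by blast
    have \<tau>: "lyndon_tau S \<iota> w = commutator S (lyndon_tau S \<iota> ?u) (lyndon_tau S \<iota> ?v)"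
      using False less.prems by (subst lyndon_tau.simps) simp
    have closed: "lyndon_tau S \<iota> ?u \<in> carrier S" "lyndon_tau S \<iota> ?v \<in> carrier S" "lyndon_tau S \<iota> w \<in> carrier S"
      using S.lyndon_tau_closed[OF \<iota>] uv less.prems by blast+
    \<comment> \<open>The defining relation of the commutator freed of inverses, the form in which
      \<open>leading_commutator\<close> takes it.\<close>
    have comm: "lyndon_tau S \<iota> ?u \<otimes>\<^bsub>S\<^esub> lyndon_tau S \<iota> ?v =
        lyndon_tau S \<iota> ?v \<otimes>\<^bsub>S\<^esub> lyndon_tau S \<iota> ?u \<otimes>\<^bsub>S\<^esub> lyndon_tau S \<iota> w"
      unfolding \<tau> commutator_def using closed(1,2) by (simp add: S.m_assoc S.inv_mult_cancel)
    show ?thesis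
    proof (intro exI allI impI)
      fix m :: int assume m: "1 < m"
      then interpret nc_residue_series m "nc_series (residue_ring m)" by unfold_locales
      show "leading (length w) (magnus S T \<iota> (residue_ring m) (lyndon_tau S \<iota> w))
         (\<lambda>v. L (take (length ?u) v) * K (drop (length ?u) v) - K (take (length ?v) v) * L (drop (length ?v) v))"
        unfolding uv(5)[symmetric]
      proof (rule leading_commutator)
        show "magnus S T \<iota> (residue_ring m) (lyndon_tau S \<iota> ?u) \<otimes>\<^bsub>nc_series (residue_ring m)\<^esub>
            magnus S T \<iota> (residue_ring m) (lyndon_tau S \<iota> ?v) =
            magnus S T \<iota> (residue_ring m) (lyndon_tau S \<iota> ?v) \<otimes>\<^bsub>nc_series (residue_ring m)\<^esub>
            magnus S T \<iota> (residue_ring m) (lyndon_tau S \<iota> ?u) \<otimes>\<^bsub>nc_series (residue_ring m)\<^esub>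
            magnus S T \<iota> (residue_ring m) (lyndon_tau S \<iota> w)"
          using closed comm by (metis S.m_closed magnus_mult[OF S])
      qed (use m L K uv closed magnus_props(4)[OF S] magnus_closed[OF S] in simp_all)
    qed
  qed
qed

section \<open>The extension class\<close>

context unipotent
begin

abbreviation "C \<equiv> UU_central p n s"
abbreviation coset_C ("\<kappa> _" [61] 60) where "\<kappa> x \<equiv> C #>\<^bsub>U\<^esub> x"
abbreviation "Ubar \<equiv> UU_bar p n s"

sublocale Q: topological_quotient U TU C
  by (intro topological_quotient.intro U.lower_p_central_normal U.mult_topological_group_axioms)

definition is_section :: "((nat \<times> nat \<Rightarrow> int) set \<Rightarrow> (nat \<times> nat \<Rightarrow> int)) \<Rightarrow> bool" where
  "is_section \<theta> \<longleftrightarrow> (\<forall>g\<in>carrier (Ubar). \<theta> g \<in> g)"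

lemma in_C_F: "c \<in> C \<Longrightarrow> c \<in> F n"
  using central_subset_F by blast

lemma section_props:
  assumes \<theta>: "is_section \<theta>" and x: "x \<in> carrier U"
  shows "\<theta> (\<kappa> x) \<in> carrier U" "x \<cdot> inv\<^bsub>U\<^esub> \<theta> (\<kappa> x) \<in> C"
    "\<kappa> \<theta> (\<kappa> x) = \<kappa> x"
proof -
  have "\<kappa> x \<in> carrier (Ubar)" using x by (auto simp: Q.carrier_quotient)
  then have "\<theta> (\<kappa> x) \<in> \<kappa> x" using \<theta> unfolding is_section_def by blast
  then obtain c where c: "c \<in> C" "\<theta> (\<kappa> x) = c \<cdot> x" by (auto simp: r_coset_def)
  then show \<theta>c: "\<theta> (\<kappa> x) \<in> carrier U" using x Q.mem_carrier by simp
  show "\<kappa> \<theta> (\<kappa> x) = \<kappa> x"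
    using Q.rcos_eq_iff[OF x \<theta>c] c by auto
  have "x \<cdot> inv\<^bsub>U\<^esub> \<theta> (\<kappa> x) = inv\<^bsub>U\<^esub> c"
    using c x Q.mem_carrier by (simp add: U.inv_mult_group U.inv_mult_cancel)
  then show "x \<cdot> inv\<^bsub>U\<^esub> \<theta> (\<kappa> x) \<in> C" using c by simp
qed

text \<open>The central element separating x from the chosen representative of its coset, read in
  F_p. As a cochain on U it splits the pullback of the extension cocycle, up to sign.\<close>

definition defect :: "((nat \<times> nat \<Rightarrow> int) set \<Rightarrow> (nat \<times> nat \<Rightarrow> int)) \<Rightarrow> (nat \<times> nat \<Rightarrow> int) \<Rightarrow> int" where
  "defect \<theta> x = Z (x \<cdot> inv\<^bsub>U\<^esub> \<theta> (\<kappa> x))"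

definition ext_cocycle :: "((nat \<times> nat \<Rightarrow> int) set \<Rightarrow> (nat \<times> nat \<Rightarrow> int)) \<Rightarrow>
    (nat \<times> nat \<Rightarrow> int) set \<times> (nat \<times> nat \<Rightarrow> int) set \<Rightarrow> int" where
  "ext_cocycle \<theta> = (\<lambda>(g, h)\<in>carrier (Ubar) \<times> carrier (Ubar).
     Z (\<theta> g \<cdot> \<theta> h \<cdot> inv\<^bsub>U\<^esub> (\<theta> (g \<otimes>\<^bsub>Ubar\<^esub> h))))"

lemma defect_range:
  assumes "is_section \<theta>" "x \<in> carrier U"
  shows "defect \<theta> x \<in> {0..int p - 1}"
  unfolding defect_def using section_props(2)[OF assms] by (intro Z_entry(1) in_C_F)

text \<open>Write x = k t and y = k' t' with representatives t, t' and central k, k'. Then k' moves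
  past t, and what remains of xy is k k' times the value t t' (representative of xy)^-1 of the
  cocycle.\<close>

lemma defect_mult:
  assumes \<theta>: "is_section \<theta>" and x: "x \<in> carrier U" and y: "y \<in> carrier U"
  shows "defect \<theta> (x \<cdot> y) =
    (defect \<theta> x + defect \<theta> y + ext_cocycle \<theta> (\<kappa> x, \<kappa> y)) mod int p"
proof -
  define tx ty txy where "tx = \<theta> (\<kappa> x)" and "ty = \<theta> (\<kappa> y)" and "txy = \<theta> (\<kappa> (x \<cdot> y))"
  have t[simp]: "tx \<in> carrier U" "ty \<in> carrier U" "txy \<in> carrier U"
    using section_props(1)[OF \<theta>] x y by (auto simp: tx_def ty_def txy_def)
  define kx ky c where "kx = x \<cdot> inv\<^bsub>U\<^esub> tx" and "ky = y \<cdot> inv\<^bsub>U\<^esub> ty" and "c = tx \<cdot> ty \<cdot> inv\<^bsub>U\<^esub> txy"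
  have k: "kx \<in> C" "ky \<in> C" "x \<cdot> y \<cdot> inv\<^bsub>U\<^esub> txy \<in> C"
    using section_props(2)[OF \<theta>] x y by (auto simp: kx_def ky_def tx_def ty_def txy_def)
  have kc[simp]: "kx \<in> carrier U" "ky \<in> carrier U" "c \<in> carrier U" using k Q.mem_carrier by (auto simp: c_def)
  have xk: "x = kx \<cdot> tx" "y = ky \<cdot> ty" using x y by (auto simp: kx_def ky_def U.m_assoc)
  have eq: "x \<cdot> y \<cdot> inv\<^bsub>U\<^esub> txy = kx \<cdot> ky \<cdot> c"
  proof -
    have "x \<cdot> y \<cdot> inv\<^bsub>U\<^esub> txy = kx \<cdot> (tx \<cdot> ky) \<cdot> ty \<cdot> inv\<^bsub>U\<^esub> txy"
      by (subst (1) xk(1), subst xk(2)) (simp add: U.m_assoc)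
    also have "\<dots> = kx \<cdot> (ky \<cdot> tx) \<cdot> ty \<cdot> inv\<^bsub>U\<^esub> txy"
      using central[OF in_C_F[OF k(2)], of tx] by simp
    finally show ?thesis by (simp add: c_def U.m_assoc)
  qed
  have "c = inv\<^bsub>U\<^esub> (kx \<cdot> ky) \<cdot> (x \<cdot> y \<cdot> inv\<^bsub>U\<^esub> txy)"
    unfolding eq by (simp add: U.m_assoc U.inv_mult_group U.inv_mult_cancel)
  then have cC: "c \<in> C" using k by simp
  have "Z (x \<cdot> y \<cdot> inv\<^bsub>U\<^esub> txy) = (Z kx + Z ky + Z c) mod int p"
    unfolding eq using k cC in_C_F by (simp add: Z_mult mod_simps)
  moreover have "Z c = ext_cocycle \<theta> (\<kappa> x, \<kappa> y)"
    using x y by (simp add: ext_cocycle_def c_def tx_def ty_def txy_def Q.carrier_quotient Q.rcos_sum)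
  ultimately show ?thesis
    unfolding defect_def kx_def ky_def tx_def ty_def txy_def by simp
qed

abbreviation "TQ \<equiv> discrete_topology (carrier (Ubar))"

text \<open>Two sections differ by the central elements with coordinates
  \<open>defect \<theta> (\<theta>' g)\<close>. Computing the defect of
  \<open>\<theta>' g \<cdot> \<theta>' h\<close> in two ways shows that the cocycles differ by the
  coboundary of this cochain.\<close>

lemma ext_cocycle_class:
  assumes \<theta>: "is_section \<theta>" and \<theta>': "is_section \<theta>'"
  shows "H2_class (Ubar) TQ (Fp p) (ext_cocycle \<theta>') = H2_class (Ubar) TQ (Fp p) (ext_cocycle \<theta>)"
proof -
  define z where "z = (\<lambda>g\<in>carrier (Ubar). defect \<theta> (\<theta>' g))"
  have \<theta>'c: "\<theta>' g \<in> carrier U" "\<kappa> \<theta>' g = g" if g: "g \<in> carrier (Ubar)" for g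
  proof -
    obtain x where x: "x \<in> carrier U" "g = \<kappa> x" using g by (auto simp: Q.carrier_quotient)
    show 1: "\<theta>' g \<in> carrier U" using section_props(1)[OF \<theta>' x(1)] x by simp
    have "\<theta>' g \<in> \<kappa> x" using \<theta>' g x unfolding is_section_def by blast
    then show "\<kappa> \<theta>' g = g" using x 1 U.repr_independence[OF _ _ Q.subgroup_axioms] by blast
  qed
  have z: "z \<in> cochains1 (Ubar) TQ (Fp p)"
    unfolding z_def using p defect_range[OF \<theta>] \<theta>'c by (intro cochains1_restrictI) auto
  show ?thesis
  proof (rule H2_class_cong[OF Q.factorgroup_is_group _ p z])
    fix g h assume g: "g \<in> carrier (Ubar)" and h: "h \<in> carrier (Ubar)"
    then have gh: "g \<otimes>\<^bsub>Ubar\<^esub> h \<in> carrier (Ubar)"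
      using Q.factorgroup_is_group by (simp add: group.is_monoid monoid.m_closed del: mult_FactGroup)
    note mult_FactGroup [simp del]
    let ?x = "\<theta>' g" and ?y = "\<theta>' h" and ?t = "\<theta>' (g \<otimes>\<^bsub>Ubar\<^esub> h)"
    note [simp] = \<theta>'c(1)[OF g] \<theta>'c(1)[OF h] \<theta>'c(1)[OF gh]
    have coset: "\<kappa> (?x \<cdot> ?y) = g \<otimes>\<^bsub>Ubar\<^esub> h"
      using \<theta>'c(2)[OF g] \<theta>'c(2)[OF h] Q.rcos_sum[of ?x ?y] by (simp add: mult_FactGroup)
    let ?r = "\<theta> (g \<otimes>\<^bsub>Ubar\<^esub> h)"
    have t0[simp]: "?r \<in> carrier U" 
      using section_props(1)[OF \<theta> \<theta>'c(1)[OF gh]] unfolding \<theta>'c(2)[OF gh] .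
    have "?x \<cdot> ?y \<cdot> inv\<^bsub>U\<^esub> ?r = (?x \<cdot> ?y \<cdot> inv\<^bsub>U\<^esub> ?t) \<cdot> (?t \<cdot> inv\<^bsub>U\<^esub> ?r)"
      by (simp add: U.m_assoc U.inv_mult_cancel)
    moreover have "?x \<cdot> ?y \<cdot> inv\<^bsub>U\<^esub> ?t \<in> C"
      using section_props(2)[OF \<theta>', of "?x \<cdot> ?y"] unfolding coset by simp
    moreover have "?t \<cdot> inv\<^bsub>U\<^esub> ?r \<in> C"
      using section_props(2)[OF \<theta> \<theta>'c(1)[OF gh]] unfolding \<theta>'c(2)[OF gh] .
    ultimately have "defect \<theta> (?x \<cdot> ?y) =
        (Z (?x \<cdot> ?y \<cdot> inv\<^bsub>U\<^esub> ?t) + Z (?t \<cdot> inv\<^bsub>U\<^esub> ?r)) mod int p"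
      unfolding defect_def coset using in_C_F by (simp add: Z_mult)
    moreover have "Z (?x \<cdot> ?y \<cdot> inv\<^bsub>U\<^esub> ?t) = ext_cocycle \<theta>' (g, h)"
      using g h by (simp add: ext_cocycle_def)
    moreover have "Z (?t \<cdot> inv\<^bsub>U\<^esub> ?r) = z (g \<otimes>\<^bsub>Ubar\<^esub> h)"
      using gh \<theta>'c(2)[OF gh] by (simp add: z_def defect_def)
    ultimately have "(ext_cocycle \<theta>' (g, h) + z (g \<otimes>\<^bsub>Ubar\<^esub> h)) mod int p =
        (z g + z h + ext_cocycle \<theta> (g, h)) mod int p"
      using defect_mult[OF \<theta>, of ?x ?y] g h by (simp add: \<theta>'c(2) z_def)
    then have "int p dvd ext_cocycle \<theta>' (g, h) + z (g \<otimes>\<^bsub>Ubar\<^esub> h) - (z g + z h + ext_cocycle \<theta> (g, h))"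
      by (simp only: mod_eq_dvd_iff)
    also have "ext_cocycle \<theta>' (g, h) + z (g \<otimes>\<^bsub>Ubar\<^esub> h) - (z g + z h + ext_cocycle \<theta> (g, h)) =
        ext_cocycle \<theta>' (g, h) - (z h - z (g \<otimes>\<^bsub>Ubar\<^esub> h) + z g + ext_cocycle \<theta> (g, h))" by simp
    finally have "ext_cocycle \<theta>' (g, h) mod int p =
        (z h - z (g \<otimes>\<^bsub>Ubar\<^esub> h) + z g + ext_cocycle \<theta> (g, h)) mod int p"
      by (simp only: mod_eq_dvd_iff)
    moreover have "ext_cocycle \<theta>' (g, h) \<in> {0..int p - 1}"
      using Z_entry(1)[OF in_C_F[OF \<open>?x \<cdot> ?y \<cdot> inv\<^bsub>U\<^esub> ?t \<in> C\<close>]] g h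
      by (simp add: ext_cocycle_def)
    ultimately show "ext_cocycle \<theta>' (g, h) =
        (z h - z (g \<otimes>\<^bsub>Ubar\<^esub> h) + z g + ext_cocycle \<theta> (g, h)) mod int p"
      using mod_residue by metis
  qed simp
qed

lemma extension_class_eq:
  assumes \<theta>: "is_section \<theta>"
  shows "extension_class p n s = H2_class (Ubar) TQ (Fp p) (ext_cocycle \<theta>)"
proof -
  have "{H2_class (Ubar) TQ (Fp p) (ext_cocycle \<theta>') | \<theta>'. is_section \<theta>'} =
      {H2_class (Ubar) TQ (Fp p) (ext_cocycle \<theta>)}" (is "?A = {?c}")
  proof (rule equalityI)
    show "?A \<subseteq> {?c}"
      by (rule subsetI, elim CollectE exE conjE) (simp only: ext_cocycle_class[OF \<theta>] singleton_iff)
    have "?c \<in> ?A" using \<theta> by blast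
    then show "{?c} \<subseteq> ?A" by (simp only: insert_subset empty_subsetI simp_thms)
  qed
  then have "the_elem ?A = ?c" by simp
  then show ?thesis by (simp only: extension_class_def ext_cocycle_def is_section_def)
qed

text \<open>Normalized to the identity on the trivial coset, so that on C the defect is
  \<open>Z\<close> itself and the cochain made from it extends \<open>\<psi>\<close>.\<close>

definition std_section :: "(nat \<times> nat \<Rightarrow> int) set \<Rightarrow> (nat \<times> nat \<Rightarrow> int)" where
  "std_section g = (if g = C then \<one>\<^bsub>U\<^esub> else (SOME x. x \<in> g))"

lemma is_section_std: "is_section std_section"
  unfolding is_section_def
proof
  fix g assume "g \<in> carrier (Ubar)"
  then obtain x where x: "x \<in> carrier U" "g = \<kappa> x" by (auto simp: Q.carrier_quotient)
  then have "x \<in> g" using U.rcos_self[OF _ Q.subgroup_axioms] by simp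
  then have "(SOME x. x \<in> g) \<in> g" by (rule someI[of "\<lambda>x. x \<in> g"])
  then show "std_section g \<in> g" using Q.one_closed by (simp add: std_section_def)
qed

lemma defect_std:
  assumes "c \<in> C"
  shows "defect std_section c = Z c"
proof -
  have "\<kappa> c = C" using assms U.is_group by (simp add: Q.rcos_const)
  then show ?thesis using assms Q.mem_carrier by (simp add: defect_def std_section_def)
qed

lemma ext_cocycle_range:
  assumes \<theta>: "is_section \<theta>" and x: "x \<in> carrier U" and y: "y \<in> carrier U"
  shows "ext_cocycle \<theta> (\<kappa> x, \<kappa> y) \<in> {0..int p - 1}"
proof -
  let ?tx = "\<theta> (\<kappa> x)" and ?ty = "\<theta> (\<kappa> y)" and ?txy = "\<theta> (\<kappa> (x \<cdot> y))"
  have t: "?tx \<in> carrier U" "?ty \<in> carrier U" using section_props(1)[OF \<theta>] x y by auto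
  have "\<kappa> (?tx \<cdot> ?ty) = \<kappa> (x \<cdot> y)"
    using section_props(3)[OF \<theta> x] section_props(3)[OF \<theta> y] t x y by (metis Q.rcos_sum)
  then have "?tx \<cdot> ?ty \<cdot> inv\<^bsub>U\<^esub> ?txy \<in> C"
    using section_props(2)[OF \<theta>, of "?tx \<cdot> ?ty"] t by simp
  from Z_entry(1)[OF in_C_F[OF this]] show ?thesis
    using x y by (simp add: ext_cocycle_def Q.carrier_quotient Q.rcos_sum)
qed

end

section \<open>The representations \<open>\<rho>\<^sub>w\<close> and the pairing\<close>

locale magnus_word =
  fixes S :: "('g, 'b) monoid_scheme" and T :: "'g topology" and \<iota> :: "'x::finite \<Rightarrow> 'g"
    and p n :: nat and w :: "'x list"
  assumes p_gt_1: "1 < p" and free: "free_profinite_group S T \<iota>"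
    and n: "2 \<le> n" and w: "w \<noteq> []" "length w \<le> n"
begin

sublocale unipotent p n "length w"
  using p_gt_1 w by unfold_locales auto

sublocale nc: nc_residue_series "int p ^ (n - length w + 1)" "nc_series (coeff_ring p n (length w))"
  using m_gt_1 by unfold_locales

abbreviation "\<mu> \<equiv> magnus S T \<iota> (coeff_ring p n (length w))"
abbreviation "\<rho> \<equiv> magnus_rep S T \<iota> (coeff_ring p n (length w)) w"
abbreviation "LS \<equiv> lower_p_central S T p n"

lemma S_profinite: "profinite_group S T"
  using free by (simp add: free_profinite_group_def)

sublocale S: mult_topological_group S T
  using S_profinite
  by (simp add: profinite_group_def mult_topological_group_def mult_topological_group_axioms_def)

sublocale SQ: topological_quotient S T LS
  by (intro topological_quotient.intro S.lower_p_central_normal S.mult_topological_group_axioms)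

lemma mu_coeff:
  assumes "\<sigma> \<in> carrier S"
  shows "\<mu> \<sigma> v \<in> {0..m - 1}" "\<mu> \<sigma> [] = 1"
  using nc.magnus_closed[OF free assms] nc.magnus_props(4)[OF free assms] by (auto simp: nc.carrier_NC)

lemma rho_entry:
  assumes "i \<le> length w" "j \<le> length w"
  shows "\<rho> \<sigma> (i, j) = (if i \<le> j then \<mu> \<sigma> (take (j - i) (drop i w)) else 0)"
  using assms by (simp add: magnus_rep_def magnus_coeff_def residue_ring_simps)

lemma rho_closed:
  assumes "\<sigma> \<in> carrier S"
  shows "\<rho> \<sigma> \<in> carrier U"
proof -
  have "\<rho> \<sigma> (i, j) \<in> {0..m - 1}" if "i \<le> length w" "j \<le> length w" for i j
    using that mu_coeff[OF assms] p_gt_1 by (simp add: rho_entry)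
  moreover have "\<rho> \<sigma> \<in> extensional ({..length w} \<times> {..length w})"
    by (simp add: magnus_rep_def)
  ultimately show ?thesis
    unfolding carrier_iff using mu_coeff[OF assms] by (simp add: rho_entry)
qed

text \<open>Entry (i,k) reads the subword of w between positions i and k; the intermediate index j
  runs through its cuts into two words, which is the product of series.\<close>

lemma rho_mult:
  assumes \<sigma>: "\<sigma> \<in> carrier S" and \<tau>: "\<tau> \<in> carrier S"
  shows "\<rho> (\<sigma> \<otimes>\<^bsub>S\<^esub> \<tau>) = \<rho> \<sigma> \<otimes>\<^bsub>U\<^esub> \<rho> \<tau>"
proof (rule matrix_eqI)
  fix i k assume ik: "i \<le> length w" "k \<le> length w"
  have "\<rho> (\<sigma> \<otimes>\<^bsub>S\<^esub> \<tau>) (i, k) mod m = (\<Sum>j\<le>length w. \<rho> \<sigma> (i, j) * \<rho> \<tau> (j, k)) mod m"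
  proof (cases "i \<le> k")
    case False
    then have "(\<Sum>j\<le>length w. \<rho> \<sigma> (i, j) * \<rho> \<tau> (j, k)) = 0"
      using ik by (intro sum.neutral) (auto simp: rho_entry)
    then show ?thesis using ik False by (simp add: rho_entry)
  next
    case True
    let ?v = "take (k - i) (drop i w)"
    have "(\<Sum>j\<le>length w. \<rho> \<sigma> (i, j) * \<rho> \<tau> (j, k)) = (\<Sum>j\<in>{i..k}. \<rho> \<sigma> (i, j) * \<rho> \<tau> (j, k))"
      using ik by (intro sum.mono_neutral_right) (auto simp: rho_entry)
    also have "\<dots> = (\<Sum>j\<in>{0..k - i}. \<rho> \<sigma> (i, i + j) * \<rho> \<tau> (i + j, k))"
      by (subst sum.atLeastAtMost_shift_0[OF True]) (simp add: o_def)
    also have "\<dots> = (\<Sum>j\<in>{0..k - i}. \<mu> \<sigma> (take j ?v) * \<mu> \<tau> (drop j ?v))"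
    proof (rule sum.cong)
      fix j assume "j \<in> {0..k - i}"
      then have j: "j \<le> k - i" "i + j \<le> k" using True by auto
      have "take j ?v = take j (drop i w)" using j by (simp add: min_absorb1)
      moreover have "drop j ?v = take (k - (i + j)) (drop (i + j) w)"
        by (simp add: drop_take add.commute)
      ultimately show "\<rho> \<sigma> (i, i + j) * \<rho> \<tau> (i + j, k) = \<mu> \<sigma> (take j ?v) * \<mu> \<tau> (drop j ?v)"
        using ik j by (simp add: rho_entry)
    qed simp
    also have "\<dots> = (\<Sum>j\<le>length ?v. \<mu> \<sigma> (take j ?v) * \<mu> \<tau> (drop j ?v))"
      using ik True by (simp add: atLeast0AtMost)
    finally have "(\<Sum>j\<le>length w. \<rho> \<sigma> (i, j) * \<rho> \<tau> (j, k)) mod m = \<mu> (\<sigma> \<otimes>\<^bsub>S\<^esub> \<tau>) ?v"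
      by (simp only: nc.magnus_mult[OF free \<sigma> \<tau>] nc.mult_NC nc.magnus_closed[OF free \<sigma>] nc.magnus_closed[OF free \<tau>])
    moreover have "\<mu> (\<sigma> \<otimes>\<^bsub>S\<^esub> \<tau>) ?v mod m = \<mu> (\<sigma> \<otimes>\<^bsub>S\<^esub> \<tau>) ?v"
      using mu_coeff(1)[of "\<sigma> \<otimes>\<^bsub>S\<^esub> \<tau>" ?v] \<sigma> \<tau> by simp
    ultimately show ?thesis using ik True by (simp add: rho_entry)
  qed
  then show "\<rho> (\<sigma> \<otimes>\<^bsub>S\<^esub> \<tau>) (i, k) mod m = (\<rho> \<sigma> \<otimes>\<^bsub>U\<^esub> \<rho> \<tau>) (i, k) mod m"
    using ik \<sigma> \<tau> rho_closed by (simp add: mult_entry)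
qed (use \<sigma> \<tau> rho_closed in auto)

lemma rho_hom: "\<rho> \<in> hom S U"
  using rho_closed rho_mult by (auto simp: hom_def)

sublocale \<rho>: group_hom S U \<rho>
  using rho_hom by unfold_locales

text \<open>The matrix \<open>\<rho> \<sigma>\<close> involves finitely many coefficients, each of
  them locally constant in \<open>\<sigma>\<close>.\<close>

lemma rho_continuous: "continuous_map T TU \<rho>"
proof (rule continuous_map_discreteI)
  fix \<sigma> assume "\<sigma> \<in> topspace T"
  then have \<sigma>: "\<sigma> \<in> carrier S" by (simp add: S.topspace_eq)
  then show "\<rho> \<sigma> \<in> carrier U" by (rule rho_closed)
  have "continuous_map T (nc.TN) \<mu>"
    using nc.magnus_props(2)[OF free] by (simp add: continuous_map_in_subtopology)
  from continuous_map_compose[OF this nc.continuous_coeff]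
  have "continuous_map T (discrete_topology {0..m - 1}) (\<lambda>\<sigma>. \<mu> \<sigma> v)" for v by (simp add: o_def)
  then have 1: "openin T {\<tau> \<in> topspace T. \<mu> \<tau> v \<in> {\<mu> \<sigma> v}}" for v
    using mu_coeff(1)[OF \<sigma>] by (intro openin_continuous_map_preimage) auto
  let ?V = "topspace T \<inter> (\<Inter>ij\<in>{..length w} \<times> {..length w}.
    {\<tau> \<in> topspace T. \<mu> \<tau> (take (snd ij - fst ij) (drop (fst ij) w)) \<in> {\<mu> \<sigma> (take (snd ij - fst ij) (drop (fst ij) w))}})"
  have "openin T (\<Inter>ij\<in>{..length w} \<times> {..length w}.
    {\<tau> \<in> topspace T. \<mu> \<tau> (take (snd ij - fst ij) (drop (fst ij) w)) \<in> {\<mu> \<sigma> (take (snd ij - fst ij) (drop (fst ij) w))}})"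
    by (rule openin_INT2) (use 1 in auto)
  then have "openin T ?V" by (intro openin_Int) auto
  moreover have "\<sigma> \<in> ?V" using \<sigma> by (simp add: S.topspace_eq)
  moreover have "?V \<subseteq> {\<tau>. \<rho> \<tau> = \<rho> \<sigma>}"
  proof
    fix \<tau> assume \<tau>: "\<tau> \<in> ?V"
    then have \<tau>c: "\<tau> \<in> carrier S" by (simp add: S.topspace_eq)
    have "\<mu> \<tau> (take (j - i) (drop i w)) = \<mu> \<sigma> (take (j - i) (drop i w))" if "i \<le> length w" "j \<le> length w" for i j
      using \<tau> that by force
    then have "\<rho> \<tau> = \<rho> \<sigma>"
      by (intro matrix_eqI rho_closed \<sigma> \<tau>c) (simp add: rho_entry)
    then show "\<tau> \<in> {\<tau>. \<rho> \<tau> = \<rho> \<sigma>}" by simp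
  qed
  ultimately show "\<exists>V. openin T V \<and> \<sigma> \<in> V \<and> V \<subseteq> {\<tau>. \<rho> \<tau> = \<rho> \<sigma>}" by blast
qed

lemma rho_central: "\<sigma> \<in> LS \<Longrightarrow> \<rho> \<sigma> \<in> C"
  using lower_p_central_hom[OF S.is_group S.topspace_eq U.is_group U.topspace_eq rho_hom rho_continuous]
  by blast

section \<open>The induced map on quotients and the class of w\<close>

lemma rho_bar:
  assumes \<sigma>: "\<sigma> \<in> carrier S"
  shows "magnus_rep_bar S T \<iota> p n w (LS #>\<^bsub>S\<^esub> \<sigma>) = C #>\<^bsub>U\<^esub> \<rho> \<sigma>"
proof -
  have "C #>\<^bsub>U\<^esub> \<rho> \<tau> = C #>\<^bsub>U\<^esub> \<rho> \<sigma>" if \<tau>: "\<tau> \<in> LS #>\<^bsub>S\<^esub> \<sigma>" for \<tau>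
  proof -
    obtain k where k: "k \<in> LS" "\<tau> = k \<otimes>\<^bsub>S\<^esub> \<sigma>" using \<tau> by (auto simp: r_coset_def)
    then have "\<rho> \<tau> = \<rho> k \<otimes>\<^bsub>U\<^esub> \<rho> \<sigma>" using \<sigma> SQ.mem_carrier by simp
    then show ?thesis
      using k \<sigma> rho_central SQ.mem_carrier rho_closed Q.rcos_eq_iff[of "\<rho> \<sigma>" "\<rho> \<tau>"]
      by (metis \<rho>.hom_closed Q.m_closed Q.mem_carrier U.m_closed)
  qed
  moreover have "\<sigma> \<in> LS #>\<^bsub>S\<^esub> \<sigma>" using S.rcos_self[OF \<sigma> SQ.subgroup_axioms] .
  ultimately have "(\<lambda>\<sigma>. C #>\<^bsub>U\<^esub> \<rho> \<sigma>) ` (LS #>\<^bsub>S\<^esub> \<sigma>) = {C #>\<^bsub>U\<^esub> \<rho> \<sigma>}" by blast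
  then have "the_elem ((\<lambda>\<sigma>. C #>\<^bsub>U\<^esub> \<rho> \<sigma>) ` (LS #>\<^bsub>S\<^esub> \<sigma>)) = C #>\<^bsub>U\<^esub> \<rho> \<sigma>" by simp
  then show ?thesis by (simp only: magnus_rep_bar_def Let_def)
qed

abbreviation "\<rho>bar \<equiv> magnus_rep_bar S T \<iota> p n w"

lemma rho_bar_hom: "\<rho>bar \<in> hom (S Mod LS) (Ubar)"
proof (rule homI)
  fix a assume "a \<in> carrier (S Mod LS)"
  then obtain \<sigma> where "\<sigma> \<in> carrier S" "a = LS #>\<^bsub>S\<^esub> \<sigma>" by (auto simp: SQ.carrier_quotient)
  then show "\<rho>bar a \<in> carrier (Ubar)"
    using rho_closed by (simp add: rho_bar Q.carrier_quotient)
next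
  fix a b assume "a \<in> carrier (S Mod LS)" "b \<in> carrier (S Mod LS)"
  then obtain \<sigma> \<tau> where "\<sigma> \<in> carrier S" "a = LS #>\<^bsub>S\<^esub> \<sigma>" "\<tau> \<in> carrier S" "b = LS #>\<^bsub>S\<^esub> \<tau>"
    by (auto simp: SQ.carrier_quotient)
  then show "\<rho>bar (a \<otimes>\<^bsub>S Mod LS\<^esub> b) = \<rho>bar a \<otimes>\<^bsub>Ubar\<^esub> \<rho>bar b"
    by (simp add: SQ.rcos_sum Q.rcos_sum rho_bar rho_closed)
qed

lemma rho_bar_continuous: "continuous_map (coset_topology S T LS) TQ \<rho>bar"
proof (rule continuous_compose_quotient_map[OF SQ.quotient_map_rcos])
  have "continuous_map T TQ ((\<lambda>M. C #>\<^bsub>U\<^esub> M) \<circ> \<rho>)"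
    by (rule continuous_map_compose[OF rho_continuous]) (auto simp: Q.carrier_quotient)
  then show "continuous_map T TQ (\<rho>bar \<circ> (\<lambda>g. LS #>\<^bsub>S\<^esub> g))"
    by (rule continuous_map_eq) (simp add: S.topspace_eq rho_bar)
qed

definition \<alpha>_cocycle :: "'g set \<times> 'g set \<Rightarrow> int" where
  "\<alpha>_cocycle = (\<lambda>(a, b)\<in>carrier (S Mod LS) \<times> carrier (S Mod LS). ext_cocycle std_section (\<rho>bar a, \<rho>bar b))"

lemma lyndon_alpha_eq:
  "lyndon_alpha S T \<iota> p n w = H2_class (S Mod LS) (coset_topology S T LS) (Fp p) \<alpha>_cocycle"
  unfolding lyndon_alpha_def Let_def extension_class_eq[OF is_section_std] \<alpha>_cocycle_def
  by (rule H2_pullback_class[OF SQ.factorgroup_is_group SQ.topspace_coset_topology _ p_gt_1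
      rho_bar_hom rho_bar_continuous]) simp

text \<open>\<open>\<alpha>\<^sub>w\<close> is the transgression of \<open>-Z \<circ> \<rho>\<^sub>w\<close>: the defect \<open>\<rho>(\<sigma>) \<theta>(\<sigma>)\<^sup>-\<^sup>1\<close> of the section is a
  cochain whose coboundary is minus the extension cocycle.\<close>

definition \<psi> :: "'g \<Rightarrow> int" where
  "\<psi> = (\<lambda>\<sigma>\<in>LS. (- Z (\<rho> \<sigma>)) mod int p)"

definition yc :: "'g \<Rightarrow> int" where
  "yc = (\<lambda>\<sigma>\<in>carrier S. (- defect std_section (\<rho> \<sigma>)) mod int p)"

lemma yc_cochain: "yc \<in> cochains1 S T (Fp p)"
proof -
  have "continuous_map T (discrete_topology {0..int p - 1}) ((\<lambda>M. (- defect std_section M) mod int p) \<circ> \<rho>)"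
    using mod_in_residues[of "int p"] p_gt_1 by (intro continuous_map_compose[OF rho_continuous]) auto
  then show ?thesis
    unfolding yc_def using p_gt_1 S.topspace_eq by (intro cochains1_restrictI) (auto simp: o_def)
qed

lemma psi_lift: "SQ.is_lift p \<psi> yc \<alpha>_cocycle"
  unfolding SQ.is_lift_def
proof (intro conjI ballI)
  show "yc \<in> cochains1 S T (Fp p)" by (rule yc_cochain)
  show "\<alpha>_cocycle \<in> extensional (carrier (S Mod LS) \<times> carrier (S Mod LS))"
    by (simp add: \<alpha>_cocycle_def)
  show "yc k = \<psi> k" if "k \<in> LS" for k
    using that SQ.mem_carrier by (simp add: yc_def \<psi>_def defect_std rho_central)
  fix \<sigma> \<tau> assume \<sigma>: "\<sigma> \<in> carrier S" and \<tau>: "\<tau> \<in> carrier S"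
  let ?D = "\<lambda>\<sigma>. defect std_section (\<rho> \<sigma>)" and ?c = "ext_cocycle std_section (C #>\<^bsub>U\<^esub> \<rho> \<sigma>, C #>\<^bsub>U\<^esub> \<rho> \<tau>)"
  have c: "\<alpha>_cocycle (LS #>\<^bsub>S\<^esub> \<sigma>, LS #>\<^bsub>S\<^esub> \<tau>) = ?c"
    using \<sigma> \<tau> by (simp add: \<alpha>_cocycle_def SQ.carrier_quotient rho_bar)
  have "?c \<in> {0..int p - 1}"
    using \<sigma> \<tau> rho_closed by (intro ext_cocycle_range is_section_std)
  then have "?c mod int p = ?c" by simp
  moreover have "?D (\<sigma> \<otimes>\<^bsub>S\<^esub> \<tau>) mod int p = (?D \<sigma> + ?D \<tau> + ?c) mod int p"
    using defect_mult[OF is_section_std, of "\<rho> \<sigma>" "\<rho> \<tau>"] \<sigma> \<tau> rho_closed rho_mult by simp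
  then have "int p dvd ?D (\<sigma> \<otimes>\<^bsub>S\<^esub> \<tau>) - (?D \<sigma> + ?D \<tau> + ?c)" by (simp only: mod_eq_dvd_iff)
  then have "int p dvd (- ?D \<tau> - - ?D (\<sigma> \<otimes>\<^bsub>S\<^esub> \<tau>) + - ?D \<sigma>) - ?c" by (simp add: algebra_simps)
  then have "?c mod int p = (- ?D \<tau> - - ?D (\<sigma> \<otimes>\<^bsub>S\<^esub> \<tau>) + - ?D \<sigma>) mod int p"
    by (simp only: mod_eq_dvd_iff[symmetric])
  ultimately show "\<alpha>_cocycle (LS #>\<^bsub>S\<^esub> \<sigma>, LS #>\<^bsub>S\<^esub> \<tau>) = (yc \<tau> - yc (\<sigma> \<otimes>\<^bsub>S\<^esub> \<tau>) + yc \<sigma>) mod int p"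
    using \<sigma> \<tau> unfolding c by (simp add: yc_def coboundary_mod)
qed

lemma psi_invariant: "\<psi> \<in> H1_invariants S T LS (Fp p)"
  unfolding SQ.H1_invariants_iff[OF p_gt_1]
proof (intro conjI ballI)
  show "\<psi> \<in> extensional LS" by (simp add: \<psi>_def)
  have "continuous_map (subtopology T LS) (discrete_topology {0..int p - 1}) yc"
    using yc_cochain p_gt_1 S.topspace_eq by (intro continuous_map_from_subtopology) (simp add: cochains1_iff)
  then show "continuous_map (subtopology T LS) (discrete_topology {0..int p - 1}) \<psi>"
    by (rule continuous_map_eq) (use psi_lift in \<open>simp add: SQ.is_lift_def\<close>)
  show "\<psi> (k \<otimes>\<^bsub>S\<^esub> l) = (\<psi> k + \<psi> l) mod int p" if "k \<in> LS" "l \<in> LS" for k l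
    using that SQ.mem_carrier rho_central in_C_F by (simp add: \<psi>_def Z_mult mod_simps)
  show "\<psi> (inv\<^bsub>S\<^esub> \<sigma> \<otimes>\<^bsub>S\<^esub> k \<otimes>\<^bsub>S\<^esub> \<sigma>) = \<psi> k" if \<sigma>: "\<sigma> \<in> carrier S" and k: "k \<in> LS" for \<sigma> k
  proof -
    have kc: "k \<in> carrier S" using k SQ.mem_carrier by simp
    have "\<rho> (inv\<^bsub>S\<^esub> \<sigma> \<otimes>\<^bsub>S\<^esub> k \<otimes>\<^bsub>S\<^esub> \<sigma>) = inv\<^bsub>U\<^esub> \<rho> \<sigma> \<otimes>\<^bsub>U\<^esub> (\<rho> k \<otimes>\<^bsub>U\<^esub> \<rho> \<sigma>)"
      using \<sigma> kc rho_closed by (simp add: U.m_assoc)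
    also have "\<rho> k \<otimes>\<^bsub>U\<^esub> \<rho> \<sigma> = \<rho> \<sigma> \<otimes>\<^bsub>U\<^esub> \<rho> k"
      using central[OF in_C_F[OF rho_central[OF k]] rho_closed[OF \<sigma>]] .
    finally have "\<rho> (inv\<^bsub>S\<^esub> \<sigma> \<otimes>\<^bsub>S\<^esub> k \<otimes>\<^bsub>S\<^esub> \<sigma>) = \<rho> k"
      using \<sigma> kc rho_closed by (simp add: U.inv_mult_cancel)
    then show ?thesis using SQ.inv_op_closed1[OF \<sigma> k] k by (simp add: \<psi>_def)
  qed
qed

lemma transgression_psi: "transgression S T LS (Fp p) \<psi> = lyndon_alpha S T \<iota> p n w"
  unfolding lyndon_alpha_eq
  using psi_lift by (intro SQ.transgression_eqI[OF p_gt_1]) (auto simp: SQ.is_lift_def)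

text \<open>\<open>the_inv_into\<close> is a definite description, so any other character with this
  transgression has to be excluded. Such a character has a lift since S is profinite, and then
  injectivity applies.\<close>

lemma inverse_transgression:
  "the_inv_into (H1_invariants S T LS (Fp p)) (transgression S T LS (Fp p)) (lyndon_alpha S T \<iota> p n w) = \<psi>"
  unfolding the_inv_into_def
proof (rule the_equality)
  show "\<psi> \<in> H1_invariants S T LS (Fp p) \<and> transgression S T LS (Fp p) \<psi> = lyndon_alpha S T \<iota> p n w"
    using psi_invariant transgression_psi by simp
  fix \<psi>' assume \<psi>': "\<psi>' \<in> H1_invariants S T LS (Fp p) \<and>
    transgression S T LS (Fp p) \<psi>' = lyndon_alpha S T \<iota> p n w"
  then obtain y' c' where "SQ.is_lift p \<psi>' y' c'"
    using SQ.lift_exists[OF S_profinite p_gt_1] by blast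
  then show "\<psi>' = \<psi>"
    using \<psi>' psi_invariant psi_lift transgression_psi S.hom_Fp_trivial[OF p_gt_1 _ _ n]
    by (intro SQ.transgression_inject[OF p_gt_1, of \<psi>' \<psi>]) auto
qed

text \<open>The sign in the pairing and the sign in \<open>\<psi>\<close> cancel, leaving
  \<open>Z (\<rho> \<sigma>)\<close>. The division is exact, because the corner entry is a multiple
  of p^(n - |w|).\<close>

lemma pairing_eq:
  assumes \<sigma>: "\<sigma> \<in> LS"
  shows "pairing S T p n \<sigma> (lyndon_alpha S T \<iota> p n w) = \<mu> \<sigma> w div int p ^ (n - length w)"
proof -
  have Z: "Z (\<rho> \<sigma>) \<in> {0..int p - 1}" "\<rho> \<sigma> (0, length w) = Z (\<rho> \<sigma>) * int p ^ (n - length w)"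
    using Z_entry[OF in_C_F[OF rho_central[OF \<sigma>]]] by auto
  have "pairing S T p n \<sigma> (lyndon_alpha S T \<iota> p n w) = (- ((- Z (\<rho> \<sigma>)) mod int p)) mod int p"
    using p_gt_1 \<sigma> by (simp add: pairing_def transgression_pairing_def inverse_transgression
        residue_ring_uminus \<psi>_def)
  also have "\<dots> = Z (\<rho> \<sigma>)" using Z(1) by (simp add: mod_simps)
  also have "\<dots> = \<mu> \<sigma> w div int p ^ (n - length w)"
    using Z(2) p_gt_1 by (simp add: rho_entry)
  finally show ?thesis .
qed

end

lemma pairing_lyndon:
  fixes \<iota> :: "'x::{finite,linorder} \<Rightarrow> 'g"
  assumes p: "1 < p" and S: "free_profinite_group S T \<iota>" and n: "2 \<le> n"
    and word: "w \<noteq> []" "length w \<le> n" "length w' = length w"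
    and L: "\<forall>m>1. nc_residue_series.leading m (length w)
      (magnus S T \<iota> (residue_ring m) (lyndon_tau S \<iota> w)) L"
  shows "pairing S T p n (lyndon_sigma S \<iota> p n w) (lyndon_alpha S T \<iota> p n w') = L w' mod int p"
proof -
  have w': "w' \<noteq> []" using word by auto
  interpret magnus_word S T \<iota> p n w'
    using p S n word w' by unfold_locales auto
  have \<iota>: "range \<iota> \<subseteq> carrier S" using S by (simp add: free_profinite_group_def)
  have \<sigma>: "lyndon_sigma S \<iota> p n w \<in> LS"
    using S.lyndon_sigma_in_lower_p_central[OF S.topspace_eq \<iota> word(1,2)] .
  have "nc.leading (length w) (\<mu> (lyndon_tau S \<iota> w)) L"
    using L m_gt_1 by blast
  then have "nc.leading (length w) (\<mu> (lyndon_sigma S \<iota> p n w)) (\<lambda>v. int (p ^ (n - length w)) * L v)"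
    unfolding lyndon_sigma_def using word
    by (intro nc.leading_pow[OF S]) (auto intro: S.lyndon_tau_closed[OF \<iota>])
  then have "\<mu> (lyndon_sigma S \<iota> p n w) w' = (int p ^ (n - length w') * L w') mod int p ^ (n - length w' + 1)"
    using word(3) unfolding nc.leading_def by (simp add: word(3))
  \<comment> \<open>Reducing p^k L modulo p^(k+1) gives p^k times L modulo p, so dividing by p^k
    removes the last trace of n.\<close>
  also have "\<dots> = int p ^ (n - length w') * (L w' mod int p)"
    by (simp add: power_add mult.commute[of "int p"])
  finally show ?thesis
    unfolding pairing_eq[OF \<sigma>] using p by simp
qed

theorem theoremB:
  fixes S :: "('g, 'b) monoid_scheme" and T :: "'g topology"
    and \<iota> :: "'x::{finite,linorder} \<Rightarrow> 'g"
    and p n m s :: nat and w0 :: "'x list"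
  assumes "prime p"
    and "free_profinite_group S T \<iota>"
    and "lyndon w0" and "length w0 = s"
    and "2 \<le> n" and "s \<le> n"
    and "2 \<le> m" and "s \<le> m"
  shows "lyndon_matrix S T \<iota> p n w0 = lyndon_matrix S T \<iota> p m w0"
proof -
  have "pairing S T p n (lyndon_sigma S \<iota> p n w) (lyndon_alpha S T \<iota> p n w') =
      pairing S T p m (lyndon_sigma S \<iota> p m w) (lyndon_alpha S T \<iota> p m w')"
    if w: "w \<in> lyndon_perms w0" and w': "w' \<in> lyndon_perms w0" for w w'
  proof -
    have "w \<noteq> []" using w by (auto simp: lyndon_perms_def lyndon_def)
    have len: "length w = s" "length w' = s"
      using w w' assms(4) by (auto simp: lyndon_perms_def dest!: mset_eq_length)
    \<comment> \<open>This \<open>L\<close> is fixed before any modulus, so it computes the entries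
      for both filtration indices.\<close>
    obtain L where "\<forall>m>1. nc_residue_series.leading m (length w)
      (magnus S T \<iota> (residue_ring m) (lyndon_tau S \<iota> w)) L"
      using lyndon_tau_leading[OF assms(2) \<open>w \<noteq> []\<close>] by blast
    from pairing_lyndon[OF prime_gt_1_nat[OF assms(1)] assms(2) _ \<open>w \<noteq> []\<close> _ _ this]
    show ?thesis using assms len by simp
  qed
  then show ?thesis
    by (auto simp: lyndon_matrix_def restrict_def fun_eq_iff)
qed

end
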